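(* Let $N\ge 1$ and let $X_1,\dots,X_N$ be independent (not necessarily identically distributed) generalized Gamma random variables, i.e. $X_i$ has density on $(0,\infty)$ $$f_{X_i}(x)=c_{1,i}\,x^{\epsilon_i-1}\exp(-c_{2,i}x^{r_i}),$$ where $0<|r_i|\le1$, $\epsilon_i/r_i>0$, $c_{2,i}>0$ and $c_{1,i}>0$ is the normalizing constant. Then the product $X=\prod_{i=1}^N X_i$ is a hyperbolically completely monotone random variable; consequently it is a generalized gamma convolution and infinitely divisible.
   Context: A nonnegative random variable $X$ is infinitely divisible if for every integer $n\ge1$ it has the same distribution as a sum of $n$ independent identically distributed random variables. A nonnegative random variable $X$ is a generalized gamma convolution (GGC) if there are $a\ge 0$ and a nonnegative measure $\mu$ on $(0,\infty)$ with $\int_{(0,1]}|\log u|\,\mu(du)+\int_{(1,\infty)}u^{-1}\,\mu(du)<\infty$ such that $\mathbb{E}[e^{-sX}]=\exp\left(-as-\int_0^\infty\log(1+s/u)\,\mu(du)\right)$ for all $s\ge0$. A function $g:(0,\infty)\to[0,\infty)$ is hyperbolically completely monotone (HCM) if for each $u>0$ there is a nonnegative measure $K(\cdot\,;u)$ on $[0,\infty)$ with $g(uv)g(u/v)=\int_0^\infty e^{-\lambda u(v+v^{-1})}K(d\lambda;u)$ for all $v>0$. A random variable is HCM if it has a probability density on $(0,\infty)$ that is an HCM function. *)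

theory Defs
  imports "HOL-Probability.Probability"
begin

definition has_density_on_pos :: "'a measure \<Rightarrow> ('a \<Rightarrow> real) \<Rightarrow> (real \<Rightarrow> real) \<Rightarrow> bool" where
  "has_density_on_pos M X f \<longleftrightarrow>
     (\<forall>x>0. 0 \<le> f x) \<and> distributed M lborel X (\<lambda>x. ennreal (f x) * indicator {0<..} x)"

definition gen_gamma_density :: "real \<Rightarrow> real \<Rightarrow> real \<Rightarrow> real \<Rightarrow> real \<Rightarrow> real" where
  "gen_gamma_density c1 c2 \<epsilon> r x = c1 * x powr (\<epsilon> - 1) * exp (- c2 * x powr r)"

(* The values of g outside (0,\<infinity>) are irrelevant. *)
definition HCM_function :: "(real \<Rightarrow> real) \<Rightarrow> bool" where
  "HCM_function g \<longleftrightarrow>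
     (\<forall>x>0. 0 \<le> g x) \<and>
     (\<forall>u>0. \<exists>K :: real measure.
        sets K = sets (restrict_space borel {0..}) \<and>
        (\<forall>v>0. ennreal (g (u * v) * g (u / v)) =
                (\<integral>\<^sup>+ l. ennreal (exp (- l * u * (v + inverse v))) \<partial>K)))"

definition HCM_rv :: "'a measure \<Rightarrow> ('a \<Rightarrow> real) \<Rightarrow> bool" where
  "HCM_rv M X \<longleftrightarrow> (\<exists>g. HCM_function g \<and> has_density_on_pos M X g)"

definition nonneg_rv :: "'a measure \<Rightarrow> ('a \<Rightarrow> real) \<Rightarrow> bool" where
  "nonneg_rv M X \<longleftrightarrow> X \<in> borel_measurable M \<and> (AE \<omega> in M. 0 \<le> X \<omega>)"

(* The integrability clause excludes no representing measure: if the integral of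
   ln (1 + s/u) were infinite, the right-hand side of the Laplace transform would be 0,
   which the left-hand side never is. It is needed because the Bochner integral of a
   non-integrable function is 0 by convention, and the finiteness condition alone does
   not control the mass near u = 1. *)
definition GGC_rv :: "'a measure \<Rightarrow> ('a \<Rightarrow> real) \<Rightarrow> bool" where
  "GGC_rv M X \<longleftrightarrow>
     nonneg_rv M X \<and>
     (\<exists>(a :: real) (\<mu> :: real measure).
        0 \<le> a \<and>
        sets \<mu> = sets (restrict_space borel {0<..}) \<and>
        (\<integral>\<^sup>+ u \<in> {0<..1}. ennreal \<bar>ln u\<bar> \<partial>\<mu>) + (\<integral>\<^sup>+ u \<in> {1<..}. ennreal (inverse u) \<partial>\<mu>) < \<infinity> \<and>
        (\<forall>s\<ge>0. integrable \<mu> (\<lambda>u. ln (1 + s / u)) \<and>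
               (\<integral>\<omega>. exp (- s * X \<omega>) \<partial>M) = exp (- a * s - (\<integral>u. ln (1 + s / u) \<partial>\<mu>))))"

(* The summands may live on another probability space. Taking its points in nat \<Rightarrow> real
   is no restriction, since only the joint law of Y 1, ..., Y n matters. *)
definition infinitely_divisible_rv :: "'a measure \<Rightarrow> ('a \<Rightarrow> real) \<Rightarrow> bool" where
  "infinitely_divisible_rv M X \<longleftrightarrow>
     nonneg_rv M X \<and>
     (\<forall>n\<ge>1. \<exists>(P :: (nat \<Rightarrow> real) measure) (Y :: nat \<Rightarrow> (nat \<Rightarrow> real) \<Rightarrow> real).
        prob_space P \<and>
        prob_space.indep_vars P (\<lambda>_. borel) Y {1..n} \<and>
        (\<forall>i\<in>{1..n}. \<forall>j\<in>{1..n}. distr P borel (Y i) = distr P borel (Y j)) \<and>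
        distr M borel X = distr P borel (\<lambda>\<omega>. \<Sum>i=1..n. Y i \<omega>))"

end

theory Submission
  imports Defs "HOL-Complex_Analysis.Complex_Analysis"
begin

text \<open>
  A Laplace transform of a measure on \<open>[0, \<infinity>)\<close> is a function of the class \<open>laplace_fn\<close>. The class
  is closed under limits (Helly) and under arbitrary mixtures. A density \<open>f\<close>, multiplied by \<open>x\<close>, is
  HCM iff for each \<open>p\<close> the product \<open>f x * f (p / x)\<close> is in this class as a function of \<open>x + p / x\<close>.
  Since \<open>\<integral> exp (- A x - B / x) dx / x\<close> depends on \<open>A B\<close> only, and \<open>A B\<close> is affine in \<open>x + p / x\<close>
  in the relevant case, HCM is preserved by multiplicative convolution. Generalized gamma densities
  are HCM because \<open>x\<^sup>r\<close> is, up to a constant, \<open>\<integral> ln (1 + x / t) t\<^sup>r\<^sup>-\<^sup>1 dt\<close> for \<open>0 < r < 1\<close>.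

  The Laplace transform \<open>\<phi>\<close> of the product \<open>X\<close> is HCM as well, being a multiplicative convolution with
  \<open>exp (- x)\<close>, and the gamma factor lets it extend to the plane slit along \<open>(-\<infinity>, 0]\<close>. Complete
  monotonicity of \<open>\<phi> (u v) \<phi> (u / v)\<close> in \<open>w = v + 1 / v \<ge> 2\<close> gives a Taylor series with alternating
  signs, which converges down to \<open>w = -2\<close>; putting \<open>v = cis t\<close>, the modulus of \<open>\<phi> (u cis t)\<close> increases
  in \<open>t \<in> [0, \<pi>)\<close>. Hence \<open>\<phi>\<close> has no zeros and \<open>H z = - z \<phi>' z / \<phi> z\<close> maps the upper half-plane into
  its closure. Transported to the disc, \<open>H\<close> is typically real, and Robertson's integral
  representation of such functions turns into the Thorin measure of \<open>X\<close>.
\<close>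

section \<open>Laplace transforms of measures on the half-line\<close>

text \<open>The HCM condition provides a representing measure for each parameter separately, and
  nothing makes these measures depend measurably on the parameter. Convolution of HCM functions
  nevertheless integrates over such a parameter. Mixtures are therefore never formed from the
  measures themselves: an average of transforms is approximated by finite averages of sampled ones,
  and Helly compactness supplies a measure for the limit. Densities are taken with respect to dx/x.
  Then multiplying independent variables is convolution, x -> 1/x preserves the measure, and a power
  of x contributes only a constant to f(x) f(p/x). The integral representation of H leaves an
  additive constant free, and its measure could charge both ends 0 and \<infinity> of the negative
  half-axis. In the parameter c = cos t these are the ends -1 and 1 of a compact interval, so no
  mass is lost in limits. H tends to 0 at the origin because the transform is continuous there and
  its increments control its derivative; this fixes the constant and removes the mass at -1. Mass at
  1 is legitimate and becomes the drift.\<close>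

lemma helly_compact:
  fixes \<sigma> :: "nat \<Rightarrow> real measure"
  assumes rd: "\<And>n. real_distribution (\<sigma> n)" and supp: "\<And>n. AE x in \<sigma> n. x \<in> {a..b}" and ab: "a \<le> b"
  obtains r \<tau> where "strict_mono (r :: nat \<Rightarrow> nat)" "real_distribution \<tau>" "AE x in \<tau>. x \<in> {a..b}"
    "\<And>f :: real \<Rightarrow> real. continuous_on {a..b} f \<Longrightarrow>
       (\<lambda>n. \<integral>x. f (max a (min b x)) \<partial>\<sigma> (r n)) \<longlonglongrightarrow> (\<integral>x. f (max a (min b x)) \<partial>\<tau>)"
proof -
  have one: "measure (\<sigma> n) {a-1<..b+1} = 1" for n
  proof -
    interpret real_distribution "\<sigma> n" by (rule rd)
    have "AE x in \<sigma> n. x \<in> {a-1<..b+1}" using supp[of n] by eventually_elim auto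
    then show ?thesis by (subst prob_eq_1) auto
  qed
  have "tight \<sigma>"
    unfolding tight_def
  proof (intro conjI allI impI)
    fix e :: real assume "e > 0"
    show "\<exists>a b. a < b \<and> (\<forall>n. 1 - e < measure (\<sigma> n) {a<..b})"
      using one \<open>e > 0\<close> ab by (intro exI[of _ "a - 1"] exI[of _ "b + 1"]) auto
  qed (rule rd)
  from tight_imp_convergent_subsubsequence[OF this strict_mono_id]
  obtain r \<tau> where r: "strict_mono (r :: nat \<Rightarrow> nat)" and \<tau>: "real_distribution \<tau>"
    and wc: "weak_conv_m (\<lambda>n. \<sigma> (r n)) \<tau>"
    by (auto simp: o_def)
  interpret T: real_distribution \<tau> by (rule \<tau>)
  have conv: "(\<lambda>n. \<integral>x. f x \<partial>\<sigma> (r n)) \<longlonglongrightarrow> (\<integral>x. f x \<partial>\<tau>)"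
    if "\<And>x. isCont f x" "\<And>x. norm (f x) \<le> B" for f :: "real \<Rightarrow> real" and B
    using weak_conv_imp_integral_bdd_continuous_conv[of "\<lambda>n. \<sigma> (r n)" \<tau> f B] rd \<tau> wc that by auto
  \<comment> \<open>Distance to [a, b], cut off at 1 so that weak convergence can be tested on it:
    its integrals against the \<sigma> vanish, hence so does the one against the limit.\<close>
  define d where "d x = min 1 \<bar>x - max a (min b x)\<bar>" for x :: real
  have [measurable]: "d \<in> borel_measurable borel" by (simp add: d_def[abs_def])
  have d_int: "integrable \<tau> d"
    by (rule T.integrable_const_bound[where B = 1]) (auto simp: d_def)
  have "(\<lambda>n. \<integral>x. d x \<partial>\<sigma> (r n)) \<longlonglongrightarrow> (\<integral>x. d x \<partial>\<tau>)"
    by (rule conv[of _ 1]) (auto simp: d_def intro!: continuous_intros)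
  moreover have "(\<integral>x. d x \<partial>\<sigma> (r n)) = 0" for n
  proof -
    have "AE x in \<sigma> (r n). d x = 0" using supp[of "r n"] by eventually_elim (auto simp: d_def)
    then show ?thesis by (rule integral_eq_zero_AE)
  qed
  ultimately have "(\<integral>x. d x \<partial>\<tau>) = 0" by (simp add: LIMSEQ_const_iff)
  then have "AE x in \<tau>. d x = 0"
    by (subst (asm) integral_nonneg_eq_0_iff_AE[OF d_int]) (auto simp: d_def)
  then have supp': "AE x in \<tau>. x \<in> {a..b}"
    by eventually_elim (use ab in \<open>auto simp: d_def min_def max_def split: if_splits\<close>)
  \<comment> \<open>Clamping extends a function given on [a, b] to a bounded continuous function on
    the line, as the weak convergence theorem asks.\<close>
  have "(\<lambda>n. \<integral>x. f (max a (min b x)) \<partial>\<sigma> (r n)) \<longlonglongrightarrow> (\<integral>x. f (max a (min b x)) \<partial>\<tau>)"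
    if f: "continuous_on {a..b} f" for f :: "real \<Rightarrow> real"
  proof -
    have "continuous_on UNIV (\<lambda>x. f (max a (min b x)))"
      by (rule continuous_on_compose2[OF f]) (use ab in \<open>auto intro!: continuous_intros\<close>)
    then have c: "isCont (\<lambda>x. f (max a (min b x))) x" for x
      by (simp add: continuous_on_eq_continuous_at)
    obtain B where B: "\<forall>x\<in>{a..b}. norm (f x) \<le> B"
      using compact_continuous_image[OF f] compact_imp_bounded[of "f ` {a..b}"]
      by (auto simp: bounded_iff)
    show ?thesis by (rule conv[OF c, of B]) (use B ab in auto)
  qed
  with r \<tau> supp' show ?thesis using that by blast
qed

text \<open>The measure lives on the whole line and is concentrated on the half-line only almost
  everywhere, so that pushforwards and weak limits of real distributions apply directly. Its
  finiteness makes the total mass \<open>h 0\<close> finite; negative arguments are left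
  free.\<close>

definition laplace_fn :: "(real \<Rightarrow> real) \<Rightarrow> bool" where
  "laplace_fn h \<longleftrightarrow> (\<exists>K. finite_measure K \<and> sets K = sets borel \<and> (AE l in K. 0 \<le> l) \<and>
     (\<forall>s\<ge>0. 0 \<le> h s \<and> ennreal (h s) = (\<integral>\<^sup>+ l. ennreal (exp (- s * l)) \<partial>K)))"

text \<open>The exponent \<Lambda> may live on any measure space: its distribution represents h.
  That this distribution is finite comes for free, since s = 0 equates its mass with the real number
  \<open>h 0\<close>.\<close>

lemma laplace_fnI:
  assumes [measurable]: "\<Lambda> \<in> borel_measurable M" and "AE x in M. 0 \<le> \<Lambda> x"
    and "\<And>s. s \<ge> 0 \<Longrightarrow> 0 \<le> h s"
    and eq: "\<And>s. s \<ge> 0 \<Longrightarrow> ennreal (h s) = (\<integral>\<^sup>+ x. ennreal (exp (- s * \<Lambda> x)) \<partial>M)"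
  shows "laplace_fn h"
  unfolding laplace_fn_def
proof (intro exI[of _ "distr M borel \<Lambda>"] conjI allI impI)
  show "finite_measure (distr M borel \<Lambda>)"
    using eq[of 0] by (intro finite_measureI) (auto simp: emeasure_distr)
  show "AE l in distr M borel \<Lambda>. 0 \<le> l"
    using assms(2) by (subst AE_distr_iff) auto
qed (use assms in \<open>auto simp: nn_integral_distr\<close>)

lemma laplace_fnE:
  assumes "laplace_fn h"
  obtains K where "finite_measure K" "sets K = sets borel" "AE l in K. 0 \<le> l"
    "\<And>s. s \<ge> 0 \<Longrightarrow> ennreal (h s) = (\<integral>\<^sup>+ l. ennreal (exp (- s * l)) \<partial>K)"
  using assms unfolding laplace_fn_def by blast

section \<open>Closure properties and the continuity theorem\<close>

lemma laplace_fn_cong: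
  "laplace_fn h \<Longrightarrow> (\<And>s. s \<ge> 0 \<Longrightarrow> h s = h' s) \<Longrightarrow> laplace_fn h'"
  unfolding laplace_fn_def by auto

lemma laplace_fn_zero: "laplace_fn (\<lambda>_. 0)"
  by (rule laplace_fnI[of "\<lambda>_. 0" "null_measure borel"]) auto

lemma laplace_fn_nonneg: "laplace_fn h \<Longrightarrow> s \<ge> 0 \<Longrightarrow> 0 \<le> h s"
  by (auto simp: laplace_fn_def)

lemma laplace_fn_antimono:
  assumes h: "laplace_fn h" and st: "0 \<le> s" "s \<le> t"
  shows "h t \<le> h s"
proof -
  obtain K where K: "AE l in K. 0 \<le> l"
    "\<And>s. s \<ge> 0 \<Longrightarrow> ennreal (h s) = (\<integral>\<^sup>+ l. ennreal (exp (- s * l)) \<partial>K)"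
    using laplace_fnE[OF h] by metis
  have "ennreal (h t) \<le> ennreal (h s)"
    unfolding K(2)[OF st(1)] K(2)[OF order_trans[OF st]]
    by (rule nn_integral_mono_AE, rule eventually_mono[OF K(1)])
      (use st in \<open>auto intro!: ennreal_leI mult_right_mono\<close>)
  then show ?thesis using laplace_fn_nonneg[OF h st(1)] by simp
qed

lemma laplace_fn_cmult:
  assumes h: "laplace_fn h" and c: "c \<ge> 0"
  shows "laplace_fn (\<lambda>s. c * h s)"
proof -
  obtain K where [measurable_cong]: "sets K = sets borel" and K: "AE l in K. 0 \<le> l"
    "\<And>s. s \<ge> 0 \<Longrightarrow> ennreal (h s) = (\<integral>\<^sup>+ l. ennreal (exp (- s * l)) \<partial>K)"
    using laplace_fnE[OF h] by metis
  show ?thesis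
  proof (rule laplace_fnI[of "\<lambda>l. l" "density K (\<lambda>_. ennreal c)"])
    show "AE x in density K (\<lambda>_. ennreal c). 0 \<le> x"
      by (subst AE_density) (auto intro!: eventually_mono[OF K(1)])
    show "ennreal (c * h s) = (\<integral>\<^sup>+ x. ennreal (exp (- s * x)) \<partial>density K (\<lambda>_. ennreal c))" if "s \<ge> 0" for s
      using laplace_fn_nonneg[OF h that] c
      by (simp only: ennreal_mult K(2)[OF that]) (subst nn_integral_density; simp add: nn_integral_cmult)
  qed (use laplace_fn_nonneg[OF h] c in auto)
qed

lemma laplace_fn_scale:
  assumes h: "laplace_fn h" and c: "c \<ge> 0"
  shows "laplace_fn (\<lambda>s. h (c * s))"
proof -
  obtain K where [measurable_cong]: "sets K = sets borel" and K: "AE l in K. 0 \<le> l"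
    "\<And>s. s \<ge> 0 \<Longrightarrow> ennreal (h s) = (\<integral>\<^sup>+ l. ennreal (exp (- s * l)) \<partial>K)"
    using laplace_fnE[OF h] by metis
  show ?thesis
  proof (rule laplace_fnI[of "\<lambda>l. c * l" K])
    show "AE x in K. 0 \<le> c * x" by (rule eventually_mono[OF K(1)]) (use c in auto)
    show "ennreal (h (c * s)) = (\<integral>\<^sup>+ x. ennreal (exp (- s * (c * x))) \<partial>K)" if "s \<ge> 0" for s
      using K(2)[of "c * s"] c that by (simp add: mult_ac)
  qed (use laplace_fn_nonneg[OF h] c in auto)
qed

lemma laplace_fn_mult:
  assumes h: "laplace_fn h" and g: "laplace_fn g"
  shows "laplace_fn (\<lambda>s. h s * g s)"
proof -
  obtain K where fK: "finite_measure K" and sK[measurable_cong]: "sets K = sets borel" and K: "AE l in K. 0 \<le> l"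
    "\<And>s. s \<ge> 0 \<Longrightarrow> ennreal (h s) = (\<integral>\<^sup>+ l. ennreal (exp (- s * l)) \<partial>K)"
    using laplace_fnE[OF h] by metis
  obtain L where fL: "finite_measure L" and sL[measurable_cong]: "sets L = sets borel" and L: "AE l in L. 0 \<le> l"
    "\<And>s. s \<ge> 0 \<Longrightarrow> ennreal (g s) = (\<integral>\<^sup>+ l. ennreal (exp (- s * l)) \<partial>L)"
    using laplace_fnE[OF g] by metis
  interpret K: finite_measure K by fact
  interpret L: finite_measure L by fact
  interpret KL: pair_sigma_finite K L ..
  show ?thesis
  proof (rule laplace_fnI[of "\<lambda>(k, l). k + l" "K \<Otimes>\<^sub>M L"])
    have "AE k in K. AE l in L. 0 \<le> k + l"
      using K(1)
    proof eventually_elim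
      case (elim k) show ?case using L(1) by eventually_elim (use elim in auto)
    qed
    then show "AE x in K \<Otimes>\<^sub>M L. 0 \<le> (case x of (k, l) \<Rightarrow> k + l)"
      by (subst (asm) KL.AE_pair_iff) auto
    fix s :: real assume s: "s \<ge> 0"
    have "(\<integral>\<^sup>+ x. ennreal (exp (- s * (case x of (k, l) \<Rightarrow> k + l))) \<partial>(K \<Otimes>\<^sub>M L))
       = (\<integral>\<^sup>+ k. \<integral>\<^sup>+ l. ennreal (exp (- s * k)) * ennreal (exp (- s * l)) \<partial>L \<partial>K)"
      by (subst L.nn_integral_fst[symmetric])
         (auto simp: ennreal_mult[symmetric] exp_add[symmetric] algebra_simps)
    also have "\<dots> = ennreal (h s) * ennreal (g s)"
      by (simp add: nn_integral_cmult nn_integral_multc K(2)[OF s] L(2)[OF s])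
    finally show "ennreal (h s * g s) = (\<integral>\<^sup>+ x. ennreal (exp (- s * (case x of (k, l) \<Rightarrow> k + l))) \<partial>(K \<Otimes>\<^sub>M L))"
      using laplace_fn_nonneg[OF h s] laplace_fn_nonneg[OF g s] by (simp add: ennreal_mult)
  qed (use laplace_fn_nonneg[OF h] laplace_fn_nonneg[OF g] in auto)
qed

lemma laplace_fn_exp: "c \<ge> 0 \<Longrightarrow> laplace_fn (\<lambda>s. exp (- c * s))"
  by (rule laplace_fnI[of "\<lambda>_. c" "return borel 0"]) (auto simp: nn_integral_return AE_return mult_ac)

lemma laplace_fn_prod:
  "finite I \<Longrightarrow> (\<And>i. i \<in> I \<Longrightarrow> laplace_fn (h i)) \<Longrightarrow> laplace_fn (\<lambda>s. \<Prod>i\<in>I. h i s)"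
proof (induction I rule: finite_induct)
  case empty
  show ?case using laplace_fn_exp[of 0] by simp
next
  case (insert i I)
  then show ?case using laplace_fn_mult[of "h i" "\<lambda>s. \<Prod>i\<in>I. h i s"] by auto
qed

lemma laplace_fn_distribution:
  assumes h: "laplace_fn h" and h0: "h 0 > 0"
  obtains K where "real_distribution K" "AE l in K. 0 \<le> l"
    "\<And>s. s \<ge> 0 \<Longrightarrow> h s = h 0 * (\<integral>l. exp (- s * l) \<partial>K)"
proof -
  have "laplace_fn (\<lambda>s. 1 / h 0 * h s)" using h0 by (intro laplace_fn_cmult h) auto
  then obtain K where sK[measurable_cong]: "sets K = sets borel" and K: "AE l in K. 0 \<le> l"
    "\<And>s. s \<ge> 0 \<Longrightarrow> ennreal (1 / h 0 * h s) = (\<integral>\<^sup>+ l. ennreal (exp (- s * l)) \<partial>K)"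
    using laplace_fnE by metis
  have "emeasure K (space K) = 1" using K(2)[of 0] h0 by simp
  then interpret K: prob_space K by (rule prob_spaceI)
  have rd: "real_distribution K"
    by unfold_locales (use sK sets_eq_imp_space_eq[OF sK] in auto)
  show ?thesis
  proof (rule that[OF rd K(1)])
    fix s :: real assume s: "s \<ge> 0"
    have "(\<integral>l. exp (- s * l) \<partial>K) = h s / h 0"
      by (subst integral_eq_nn_integral, simp, simp)
        (use laplace_fn_nonneg[OF h s] h0 K(2)[OF s, symmetric] in simp)
    then show "h s = h 0 * (\<integral>l. exp (- s * l) \<partial>K)" using h0 by simp
  qed
qed

lemma laplace_fn_continuous:
  assumes "laplace_fn h" shows "continuous_on {0..} h"
proof (cases "h 0 > 0")
  case True
  obtain K where "real_distribution K" and K: "AE l in K. 0 \<le> l"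
    and hs: "\<And>s. s \<ge> 0 \<Longrightarrow> h s = h 0 * (\<integral>l. exp (- s * l) \<partial>K)"
    using laplace_fn_distribution[OF assms True] by blast
  interpret real_distribution K by fact
  have "continuous_on {0..} (\<lambda>s. \<integral>l. exp (- s * l) \<partial>K)"
  proof (rule continuous_on_sequentiallyI)
    fix u :: "nat \<Rightarrow> real" and a assume u: "\<forall>n. u n \<in> {0..}" "a \<in> {0..}" "u \<longlonglongrightarrow> a"
    show "(\<lambda>n. \<integral>l. exp (- u n * l) \<partial>K) \<longlonglongrightarrow> (\<integral>l. exp (- a * l) \<partial>K)"
    proof (rule integral_dominated_convergence[where w = "\<lambda>_. 1"])
      show "AE x in K. (\<lambda>n. exp (- u n * x)) \<longlonglongrightarrow> exp (- a * x)"
        using u(3) by (auto intro!: tendsto_intros)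
      show "AE x in K. norm (exp (- u n * x)) \<le> 1" for n
        using K by eventually_elim (use u in auto)
    qed auto
  qed
  then have "continuous_on {0..} (\<lambda>s. h 0 * (\<integral>l. exp (- s * l) \<partial>K))"
    by (intro continuous_intros)
  then show ?thesis by (rule continuous_on_eq) (use hs[symmetric] in \<open>simp only: atLeast_iff\<close>)
next
  case False
  have "h s = 0" if "s \<ge> 0" for s
    using laplace_fn_nonneg[OF assms that] laplace_fn_antimono[OF assms order_refl that] False by linarith
  then have "continuous_on {0..} h \<longleftrightarrow> continuous_on {0::real..} (\<lambda>_. 0 :: real)"
    by (intro continuous_on_cong) auto
  then show ?thesis by simp
qed

text \<open>Continuity theorem for Laplace transforms. The substitution x = exp (- l) carries the
  normalised measures to [0, 1], where Helly applies and exp (- s l) becomes x powr s. Mass can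
  escape only to l = \<infinity>, that is to x = 0, and continuity of h at 0 forbids this.
  Convergence on a dense set D suffices, which later allows D to be countable.\<close>

lemma laplace_fn_limit:
  assumes lg: "\<And>n. laplace_fn (g n)" and lim: "\<And>s. s \<in> D \<Longrightarrow> (\<lambda>n. g n s) \<longlonglongrightarrow> h s"
    and D: "0 \<in> D" "D \<subseteq> {0..}" "{0..} \<subseteq> closure D" and cont: "continuous_on {0..} h"
  shows "laplace_fn h"
proof -
  have approx: "\<exists>d. (\<forall>n. d n \<in> D) \<and> d \<longlonglongrightarrow> s \<and> (\<lambda>n. h (d n)) \<longlonglongrightarrow> h s" if "s \<ge> 0" for s
  proof -
    have "s \<in> closure D" using D that by auto
    then obtain d where d: "\<forall>n. d n \<in> D" "d \<longlonglongrightarrow> s" by (auto simp: closure_sequential)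
    then have "(\<lambda>n. h (d n)) \<longlonglongrightarrow> h s"
      using cont that D(2) by (intro continuous_on_tendsto_compose[OF cont]) (auto intro!: always_eventually)
    with d show ?thesis by blast
  qed
  have h0: "0 \<le> h 0"
    using lim[OF D(1)] laplace_fn_nonneg[OF lg] by (intro LIMSEQ_le_const) auto
  show ?thesis
  proof (cases "h 0 = 0")
    case True
    have z: "h s = 0" if "s \<in> D" for s
    proof (rule antisym)
      have s: "s \<ge> 0" using D that by auto
      show "h s \<le> 0"
        using LIMSEQ_le[OF lim[OF that] lim[OF D(1)]] laplace_fn_antimono[OF lg order_refl s] True by auto
      show "0 \<le> h s"
        using lim[OF that] laplace_fn_nonneg[OF lg s] by (intro LIMSEQ_le_const) auto
    qed
    have "h s = 0" if "s \<ge> 0" for s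
      using approx[OF that] z by (auto simp: LIMSEQ_const_iff)
    then show ?thesis by (intro laplace_fn_cong[OF laplace_fn_zero]) auto
  next
    case False
    with h0 have h0: "h 0 > 0" by simp
    have "eventually (\<lambda>n. g n 0 > 0) sequentially"
      using order_tendstoD(1)[OF lim[OF D(1)] h0] .
    then obtain n0 where n0: "\<And>n. n \<ge> n0 \<Longrightarrow> g n 0 > 0" by (auto simp: eventually_sequentially)
    have "\<exists>K. real_distribution K \<and> (AE l in K. 0 \<le> l) \<and>
        (\<forall>s\<ge>0. g (n + n0) s = g (n + n0) 0 * (\<integral>l. exp (- s * l) \<partial>K))" for n
      using laplace_fn_distribution[OF lg[of "n + n0"] n0] by (metis le_add2)
    then obtain K where K: "\<And>n. real_distribution (K n)" "\<And>n. AE l in K n. 0 \<le> l"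
      "\<And>n s. s \<ge> 0 \<Longrightarrow> g (n + n0) s = g (n + n0) 0 * (\<integral>l. exp (- s * l) \<partial>K n)"
      by metis
    define \<sigma> where "\<sigma> n = distr (K n) borel (\<lambda>l. exp (- l))" for n
    have sK[measurable_cong]: "sets (K n) = sets borel" for n
      using K(1)[of n] by (simp add: real_distribution.events_eq_borel)
    have rd: "real_distribution (\<sigma> n)" for n
    proof -
      interpret real_distribution "K n" by (rule K)
      show ?thesis unfolding \<sigma>_def by (rule real_distribution_distr) auto
    qed
    have supp: "AE x in \<sigma> n. x \<in> {0..1}" for n
      unfolding \<sigma>_def by (subst AE_distr_iff) (auto intro!: eventually_mono[OF K(2)[of n]])
    obtain r \<tau> where r: "strict_mono (r :: nat \<Rightarrow> nat)" and \<tau>: "real_distribution \<tau>"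
      and \<tau>01: "AE x in \<tau>. x \<in> {0..1}"
      and conv: "\<And>f :: real \<Rightarrow> real. continuous_on {0..1} f \<Longrightarrow>
       (\<lambda>n. \<integral>x. f (max 0 (min 1 x)) \<partial>\<sigma> (r n)) \<longlonglongrightarrow> (\<integral>x. f (max 0 (min 1 x)) \<partial>\<tau>)"
      by (rule helly_compact[of \<sigma> 0 1, OF rd supp zero_le_one]) blast
    interpret T: real_distribution \<tau> by (rule \<tau>)
    define p where "p s = (\<integral>x. x powr s \<partial>\<tau>)" for s
    \<comment> \<open>Here s > 0 is essential: x powr 0 is 1 for x > 0 but 0 powr 0 = 0, so the test
      function is continuous on [0, 1] only for positive exponents.\<close>
    have hp: "h s = h 0 * p s" if s: "s \<in> D" "s > 0" for s
    proof -
      have c: "continuous_on {0..1} (\<lambda>x::real. x powr s)"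
        using s by (intro continuous_on_powr') (auto intro!: continuous_intros)
      have 1: "(\<integral>x. max 0 (min 1 x) powr s \<partial>\<tau>) = p s"
        unfolding p_def by (rule integral_cong_AE) (auto intro!: eventually_mono[OF \<tau>01])
      have 2: "(\<integral>x. max 0 (min 1 x) powr s \<partial>\<sigma> n) = (\<integral>l. exp (- s * l) \<partial>K n)" for n
        unfolding \<sigma>_def
        by (subst integral_distr, simp, simp, rule integral_cong_AE)
           (auto simp: powr_def mult_ac intro!: eventually_mono[OF K(2)[of n]])
      have 3: "(\<lambda>n. g (r n + n0) 0 * (\<integral>l. exp (- s * l) \<partial>K (r n))) \<longlonglongrightarrow> h 0 * p s"
      proof (rule tendsto_mult)
        have "strict_mono (\<lambda>n. r n + n0)" using r by (auto simp: strict_mono_def)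
        from LIMSEQ_subseq_LIMSEQ[OF lim[OF D(1)] this] show "(\<lambda>n. g (r n + n0) 0) \<longlonglongrightarrow> h 0"
          by (simp add: o_def)
        show "(\<lambda>n. \<integral>l. exp (- s * l) \<partial>K (r n)) \<longlonglongrightarrow> p s"
          using conv[OF c] by (simp add: 1 2)
      qed
      have "strict_mono (\<lambda>n. r n + n0)" using r by (auto simp: strict_mono_def)
      from LIMSEQ_subseq_LIMSEQ[OF lim[OF s(1)] this] have "(\<lambda>n. g (r n + n0) s) \<longlonglongrightarrow> h s"
        by (simp add: o_def)
      moreover have "g (r n + n0) s = g (r n + n0) 0 * (\<integral>l. exp (- s * l) \<partial>K (r n))" for n
        using K(3)[of s "r n"] s by auto
      ultimately show ?thesis using 3 LIMSEQ_unique by simp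
    qed
    have hp': "h s = h 0 * p s" if s: "s > 0" for s
    proof -
      obtain d where d: "\<forall>n. d n \<in> D" "d \<longlonglongrightarrow> s" "(\<lambda>n. h (d n)) \<longlonglongrightarrow> h s"
        using approx[of s] s by auto
      have pd: "(\<lambda>n. p (d n)) \<longlonglongrightarrow> p s"
        unfolding p_def
      proof (rule integral_dominated_convergence[where w = "\<lambda>_. 1"])
        show "AE x in \<tau>. (\<lambda>n. x powr d n) \<longlonglongrightarrow> x powr s"
          using d(2) s by (intro AE_I2) (auto intro!: tendsto_intros simp: powr_def)
        show "AE x in \<tau>. norm (x powr d n) \<le> 1" for n
          using \<tau>01
        proof eventually_elim
          case (elim x)
          have "d n \<ge> 0" using d(1) D(2) by auto
          then show ?case using elim by (auto intro: powr_le1)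
        qed
      qed auto
      have "eventually (\<lambda>n. d n > 0) sequentially" using order_tendstoD(1)[OF d(2) s] .
      then have "eventually (\<lambda>n. h (d n) = h 0 * p (d n)) sequentially"
        by eventually_elim (use hp d(1) in auto)
      then have "(\<lambda>n. h (d n)) \<longlonglongrightarrow> h 0 * p s"
        using tendsto_mult[OF tendsto_const pd, of "h 0"] by (simp add: tendsto_cong)
      with d(3) show ?thesis using LIMSEQ_unique by blast
    qed
    \<comment> \<open>The values h (1 / (n + 1)) tend to h 0, while each is at most h 0 times the
      mass of \<tau> on x > 0; so no mass sits at x = 0.\<close>
    have "measure \<tau> {0<..} \<ge> 1"
    proof -
      have s: "(\<lambda>n. 1 / real (Suc n)) \<longlonglongrightarrow> 0"
        using LIMSEQ_inverse_real_of_nat by (simp add: inverse_eq_divide)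
      have "(\<lambda>n. h (1 / real (Suc n))) \<longlonglongrightarrow> h 0"
        by (rule continuous_on_tendsto_compose[OF cont s]) auto
      moreover have "h (1 / real (Suc n)) \<le> h 0 * measure \<tau> {0<..}" for n
      proof -
        have "p (1 / real (Suc n)) \<le> (\<integral>x. indicator {0<..} x \<partial>\<tau>)"
          unfolding p_def
        proof (rule integral_mono_AE)
          show "integrable \<tau> (\<lambda>x. x powr (1 / real (Suc n)))"
            by (rule T.integrable_const_bound[where B = 1])
              (auto intro!: eventually_mono[OF \<tau>01] powr_le1)
          show "integrable \<tau> (indicator {0<..} :: real \<Rightarrow> real)"
            by (rule T.integrable_const_bound[where B = 1]) (auto simp: indicator_def)
          show "AE x in \<tau>. x powr (1 / real (Suc n)) \<le> indicator {0<..} x"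
            by (auto intro!: eventually_mono[OF \<tau>01] powr_le1 simp: indicator_def)
        qed
        then have "p (1 / real (Suc n)) \<le> measure \<tau> {0<..}" by simp
        moreover have "h (1 / real (Suc n)) = h 0 * p (1 / real (Suc n))" by (rule hp') simp
        ultimately show ?thesis using h0 by simp
      qed
      ultimately have "h 0 \<le> h 0 * measure \<tau> {0<..}" by (intro LIMSEQ_le_const2) auto
      then show ?thesis using h0 by simp
    qed
    then have "measure \<tau> {0<..} = 1" using T.prob_le_1[of "{0<..}"] by linarith
    then have "AE x in \<tau>. x \<in> {0<..}" by (subst (asm) T.prob_eq_1) auto
    with \<tau>01 have pos: "AE x in \<tau>. 0 < x \<and> x \<le> 1" by eventually_elim auto
    have nnp: "ennreal (p s) = (\<integral>\<^sup>+x. ennreal (exp (- s * - ln x)) \<partial>\<tau>)" if "s \<ge> 0" for s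
    proof -
      have "ennreal (p s) = (\<integral>\<^sup>+x. ennreal (x powr s) \<partial>\<tau>)"
        unfolding p_def
        by (rule nn_integral_eq_integral[symmetric])
           (use that in \<open>auto intro!: eventually_mono[OF pos] powr_le1 T.integrable_const_bound[where B = 1]\<close>)
      also have "\<dots> = (\<integral>\<^sup>+x. ennreal (exp (- s * - ln x)) \<partial>\<tau>)"
        by (rule nn_integral_cong_AE) (auto intro!: eventually_mono[OF pos] simp: powr_def)
      finally show ?thesis .
    qed
    have "laplace_fn p"
      by (rule laplace_fnI[of "\<lambda>x. - ln x" \<tau>]) (use nnp in \<open>auto intro!: eventually_mono[OF pos] simp: p_def\<close>)
    then have lp: "laplace_fn (\<lambda>s. h 0 * p s)" using h0 by (intro laplace_fn_cmult) auto
    have p0: "p 0 = 1"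
    proof -
      have "p 0 = (\<integral>x. 1 \<partial>\<tau>)"
        unfolding p_def by (rule integral_cong_AE) (auto intro!: eventually_mono[OF pos])
      then show ?thesis using T.prob_space by simp
    qed
    have "h 0 * p s = h s" if "s \<ge> 0" for s
      using hp'[of s] p0 that by (cases "s = 0") auto
    then show ?thesis by (rule laplace_fn_cong[OF lp])
  qed
qed

section \<open>Mixtures of Laplace transforms\<close>

lemma laplace_fn_average:
  assumes k: "\<And>i. i < n \<Longrightarrow> laplace_fn (k i)" and k1: "\<And>i. i < n \<Longrightarrow> k i 0 = 1" and n: "n > 0"
  shows "laplace_fn (\<lambda>s. (\<Sum>i<n. k i s) / real n)"
proof -
  have "\<exists>K. real_distribution K \<and> (AE l in K. 0 \<le> l) \<and>
      (\<forall>s\<ge>0. ennreal (k i s) = (\<integral>\<^sup>+ l. ennreal (exp (- s * l)) \<partial>K))" if "i < n" for i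
  proof -
    have "laplace_fn (k i)" using that by (rule k)
    then obtain K where sK[measurable_cong]: "sets K = sets borel" and K: "AE l in K. 0 \<le> l"
      "\<And>s. s \<ge> 0 \<Longrightarrow> ennreal (k i s) = (\<integral>\<^sup>+ l. ennreal (exp (- s * l)) \<partial>K)"
      using laplace_fnE by metis
    have "emeasure K (space K) = 1" using K(2)[of 0] k1[OF that] by simp
    then interpret K: prob_space K by (rule prob_spaceI)
    have "real_distribution K"
      by unfold_locales (use sK sets_eq_imp_space_eq[OF sK] in auto)
    with K show ?thesis by blast
  qed
  then obtain K0 where K0: "\<And>i. i < n \<Longrightarrow> real_distribution (K0 i)" "\<And>i. i < n \<Longrightarrow> AE l in K0 i. 0 \<le> l"
    "\<And>i s. i < n \<Longrightarrow> s \<ge> 0 \<Longrightarrow> ennreal (k i s) = (\<integral>\<^sup>+ l. ennreal (exp (- s * l)) \<partial>K0 i)"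
    by metis
  \<comment> \<open>The kernel has to be a probability measure at every natural number, also at
    those of weight zero; a point mass serves there.\<close>
  define K where "K i = (if i < n then K0 i else return borel 0)" for i
  have rdK: "real_distribution (K i)" for i
  proof (cases "i < n")
    case False
    interpret prob_space "return borel (0::real)" by (rule prob_space_return) auto
    show ?thesis using False by (auto simp: K_def intro!: real_distribution.intro prob_space_axioms real_distribution_axioms.intro)
  qed (simp add: K_def K0)
  have sK[measurable_cong]: "sets (K i) = sets borel" for i
    using rdK[of i] by (simp add: real_distribution.events_eq_borel)
  have mK[measurable]: "K \<in> measurable (measure_pmf (pmf_of_set {..<n})) (subprob_algebra borel)"
    using rdK by (auto simp: measurable_def space_subprob_algebra sK real_distribution_def intro!: prob_space_imp_subprob_space)
  \<comment> \<open>Drawing the index uniformly and then a point from \<open>K i\<close> realises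
    the average of the measures.\<close>
  let ?M = "measure_pmf (pmf_of_set {..<n}) \<bind> K"
  have sM[measurable_cong]: "sets ?M = sets borel"
    by (rule sets_bind) (auto simp: sK)
  have bindM: "(\<integral>\<^sup>+ l. f l \<partial>?M) = (\<Sum>i<n. \<integral>\<^sup>+ l. f l \<partial>K i) / of_nat n" if "f \<in> borel_measurable borel" for f
    using n by (subst nn_integral_bind[OF that mK], subst nn_integral_pmf_of_set) auto
  show ?thesis
  proof (rule laplace_fnI[of "\<lambda>l. l" ?M])
    have "(\<integral>\<^sup>+ l. indicator {..<0} l \<partial>?M) = 0"
    proof -
      have "(\<integral>\<^sup>+ l. indicator {..<0} l \<partial>K i) = 0" if "i < n" for i
      proof -
        have "K i = K0 i" using that by (simp add: K_def)
        with K0(2)[OF that] have "AE l in K i. 0 \<le> l" by metis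
        then have "(\<integral>\<^sup>+ l. indicator {..<0} l \<partial>K i) = (\<integral>\<^sup>+ l. 0 \<partial>K i)"
          by (intro nn_integral_cong_AE) (auto elim!: eventually_mono)
        then show ?thesis by simp
      qed
      then show ?thesis by (subst bindM) auto
    qed
    then show "AE x in ?M. 0 \<le> x"
      by (subst (asm) nn_integral_0_iff_AE) (auto simp: indicator_def not_less elim!: eventually_mono split: if_splits)
    fix s :: real assume s: "s \<ge> 0"
    show "0 \<le> (\<Sum>i<n. k i s) / real n"
      using laplace_fn_nonneg[OF k s] by (auto intro!: sum_nonneg divide_nonneg_nonneg)
    have "(\<integral>\<^sup>+ l. ennreal (exp (- s * l)) \<partial>?M) = (\<Sum>i<n. ennreal (k i s)) / of_nat n"
      using K0(3) s by (subst bindM) (auto simp: K_def)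
    also have "(\<Sum>i<n. ennreal (k i s)) = ennreal (\<Sum>i<n. k i s)"
      using laplace_fn_nonneg[OF k s] by (intro sum_ennreal) auto
    also have "ennreal (\<Sum>i<n. k i s) / of_nat n = ennreal ((\<Sum>i<n. k i s) / real n)"
      unfolding ennreal_of_nat_eq_real_of_nat
      using laplace_fn_nonneg[OF k s] n by (intro divide_ennreal sum_nonneg) auto
    finally show "ennreal ((\<Sum>i<n. k i s) / real n) = (\<integral>\<^sup>+ l. ennreal (exp (- s * l)) \<partial>?M)" ..
  qed simp
qed

text \<open>Frank--Wolfe selection: the deviation from the mean has average inner product zero with the
  current error, so some new point does not increase the squared error by more than its own size.\<close>

lemma (in prob_space) greedy_average:
  fixes k :: "'a \<Rightarrow> 'w \<Rightarrow> real"
  assumes W: "finite W" and G: "AE s in M. G s"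
    and [measurable]: "\<And>w. w \<in> W \<Longrightarrow> (\<lambda>s. k s w) \<in> borel_measurable M"
    and k01: "\<And>s w. G s \<Longrightarrow> w \<in> W \<Longrightarrow> 0 \<le> k s w \<and> k s w \<le> 1"
    and H: "\<And>w. w \<in> W \<Longrightarrow> H w = (\<integral>s. k s w \<partial>M)"
  shows "\<exists>z. (\<forall>i<n. G (z i)) \<and> (\<Sum>w\<in>W. (\<Sum>i<n. k (z i) w - H w)\<^sup>2) \<le> real n * card W"
proof (induction n)
  case 0
  show ?case by simp
next
  case (Suc n)
  then obtain z where z: "\<forall>i<n. G (z i)" "(\<Sum>w\<in>W. (\<Sum>i<n. k (z i) w - H w)\<^sup>2) \<le> real n * card W"
    by blast
  define e where "e w = (\<Sum>i<n. k (z i) w - H w)" for w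
  have int: "integrable M (\<lambda>s. k s w)" if "w \<in> W" for w
    by (rule integrable_const_bound[where B = 1]) (use that k01 in \<open>auto intro!: eventually_mono[OF G]\<close>)
  have H01: "0 \<le> H w \<and> H w \<le> 1" if "w \<in> W" for w
  proof -
    have "(\<integral>s. k s w \<partial>M) \<le> (\<integral>s. 1 \<partial>M)"
      by (rule integral_mono_AE) (use that int k01 in \<open>auto intro!: eventually_mono[OF G]\<close>)
    moreover have "0 \<le> (\<integral>s. k s w \<partial>M)"
      by (rule integral_nonneg_AE) (use that k01 in \<open>auto intro!: eventually_mono[OF G]\<close>)
    ultimately show ?thesis using H[OF that] prob_space by simp
  qed
  define f where "f s = (\<Sum>w\<in>W. (k s w - H w) * e w)" for s
  have f_int: "integrable M f" unfolding f_def
    by (intro Bochner_Integration.integrable_sum integrable_mult_left Bochner_Integration.integrable_diff int) auto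
  have f0: "(\<integral>s. f s \<partial>M) = 0"
  proof -
    have "(\<integral>s. f s \<partial>M) = (\<Sum>w\<in>W. \<integral>s. (k s w - H w) * e w \<partial>M)"
      unfolding f_def
      by (intro Bochner_Integration.integral_sum integrable_mult_left Bochner_Integration.integrable_diff int) auto
    also have "\<dots> = (\<Sum>w\<in>W. ((\<integral>s. k s w \<partial>M) - H w) * e w)"
      by (intro sum.cong refl) (use int prob_space in auto)
    finally show ?thesis using H by simp
  qed
  have "\<exists>s. G s \<and> f s \<le> 0"
  proof (rule ccontr)
    assume "\<not> ?thesis"
    then have "AE s in M. 0 < f s" by (intro eventually_mono[OF G]) force
    then have "(\<integral>s. 0 \<partial>M) < (\<integral>s. f s \<partial>M)"
      by (intro integral_less_AE_space f_int) (auto simp: emeasure_space_1)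
    then show False using f0 by simp
  qed
  then obtain s where s: "G s" "f s \<le> 0" by blast
  define z' where "z' = z(n := s)"
  have "(\<Sum>w\<in>W. (\<Sum>i<Suc n. k (z' i) w - H w)\<^sup>2) = (\<Sum>w\<in>W. (e w + (k s w - H w))\<^sup>2)"
    by (intro sum.cong refl) (simp add: z'_def e_def)
  also have "\<dots> = (\<Sum>w\<in>W. (e w)\<^sup>2) + 2 * f s + (\<Sum>w\<in>W. (k s w - H w)\<^sup>2)"
    unfolding f_def sum_distrib_left sum.distrib[symmetric]
    by (intro sum.cong refl) (simp add: power2_eq_square algebra_simps)
  also have "\<dots> \<le> real n * card W + 0 + (\<Sum>w\<in>W. 1)"
  proof (intro add_mono sum_mono)
    fix w assume w: "w \<in> W"
    have "\<bar>k s w - H w\<bar> \<le> 1" using k01[OF s(1) w] H01[OF w] by auto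
    then show "(k s w - H w)\<^sup>2 \<le> 1" by (simp add: abs_square_le_1)
  qed (use z(2) s(2) in \<open>auto simp: e_def\<close>)
  finally have "(\<Sum>w\<in>W. (\<Sum>i<Suc n. k (z' i) w - H w)\<^sup>2) \<le> real (Suc n) * card W"
    by (simp add: algebra_simps)
  moreover have "\<forall>i<Suc n. G (z' i)" using z(1) s(1) by (auto simp: z'_def less_Suc_eq)
  ultimately show ?case by blast
qed

text \<open>Sampled averages match the expectation to within 1 / (m + 1) at the first m + 1 members
  of an enumeration of the nonnegative rationals. The resulting sequence converges on this dense
  set, and the continuity theorem applies. The measures behind the \<open>k s\<close> are never
  integrated over s.\<close>

lemma (in prob_space) laplace_fn_expectation:
  assumes G: "AE s in M. laplace_fn (k s) \<and> k s 0 = 1"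
    and meas: "\<And>w. w \<ge> 0 \<Longrightarrow> (\<lambda>s. k s w) \<in> borel_measurable M"
  shows "laplace_fn (\<lambda>w. \<integral>s. k s w \<partial>M)"
proof -
  let ?G = "\<lambda>s. laplace_fn (k s) \<and> k s 0 = 1"
  define H where "H w = (\<integral>s. k s w \<partial>M)" for w
  define Q :: "real set" where "Q = {0..} \<inter> \<rat>"
  have "countable Q" "0 \<in> Q" by (auto simp: Q_def countable_rat intro: countable_Int2)
  then have rQ: "range (from_nat_into Q) = Q" by (intro range_from_nat_into) auto
  define W where "W m = from_nat_into Q ` {..m}" for m
  have WQ: "W m \<subseteq> Q" for m using rQ by (auto simp: W_def)
  have Wc: "card (W m) > 0" "finite (W m)" for m by (auto simp: W_def card_gt_0_iff)
  have k01: "0 \<le> k s w \<and> k s w \<le> 1" if "?G s" "w \<ge> 0" for s w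
    using laplace_fn_nonneg[of "k s" w] laplace_fn_antimono[of "k s" 0 w] that by auto
  have "\<exists>g. laplace_fn g \<and> (\<forall>w\<in>W m. \<bar>g w - H w\<bar> \<le> 1 / real (Suc m))" for m
  proof -
    \<comment> \<open>Greedy selection bounds the sum of squared errors by n card W; dividing by n^2
      leaves card W / n, which this n makes equal to 1 / (m + 1)^2.\<close>
    define n where "n = (Suc m)\<^sup>2 * card (W m)"
    have n: "n > 0" using Wc by (simp add: n_def)
    have W0: "w \<ge> 0" if "w \<in> W m" for w using WQ that by (auto simp: Q_def)
    obtain z where z: "\<forall>i<n. ?G (z i)" 
      "(\<Sum>w\<in>W m. (\<Sum>i<n. k (z i) w - H w)\<^sup>2) \<le> real n * card (W m)"
      using greedy_average[OF Wc(2)[of m] G, of k H n, OF meas[OF W0] k01[OF _ W0] H_def] by blast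
    have "\<bar>(\<Sum>i<n. k (z i) w) / n - H w\<bar> \<le> 1 / real (Suc m)" if w: "w \<in> W m" for w
    proof -
      have "(\<Sum>i<n. k (z i) w - H w)\<^sup>2 \<le> real n * card (W m)"
        using member_le_sum[OF w, of "\<lambda>w. (\<Sum>i<n. k (z i) w - H w)\<^sup>2"] z(2) Wc by simp
      moreover have "(\<Sum>i<n. k (z i) w - H w) = n * ((\<Sum>i<n. k (z i) w) / n - H w)"
        using n by (simp add: sum_subtractf algebra_simps)
      ultimately have "real n * (real n * ((\<Sum>i<n. k (z i) w) / n - H w)\<^sup>2) \<le> real n * card (W m)"
        by (simp add: power_mult_distrib power2_eq_square mult_ac)
      then have "real n * ((\<Sum>i<n. k (z i) w) / n - H w)\<^sup>2 \<le> card (W m)" using n by simp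
      then have "real (card (W m)) * ((real (Suc m))\<^sup>2 * ((\<Sum>i<n. k (z i) w) / n - H w)\<^sup>2) \<le> card (W m) * 1"
        by (simp add: n_def mult_ac)
      then have "(real (Suc m) * ((\<Sum>i<n. k (z i) w) / n - H w))\<^sup>2 \<le> 1"
        using Wc(1)[of m] by (simp add: power_mult_distrib)
      then have "\<bar>real (Suc m) * ((\<Sum>i<n. k (z i) w) / n - H w)\<bar> \<le> 1" by (simp only: abs_square_le_1)
      then have "\<bar>(\<Sum>i<n. k (z i) w) / n - H w\<bar> * real (Suc m) \<le> 1"
        by (simp only: abs_mult abs_of_nat mult.commute)
      then show ?thesis by (subst pos_le_divide_eq) simp_all
    qed
    moreover have "laplace_fn (\<lambda>w. (\<Sum>i<n. k (z i) w) / n)"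
      by (rule laplace_fn_average) (use z n in auto)
    ultimately show ?thesis by blast
  qed
  then obtain g where g: "\<And>m. laplace_fn (g m)" "\<And>m w. w \<in> W m \<Longrightarrow> \<bar>g m w - H w\<bar> \<le> 1 / real (Suc m)"
    by metis
  show ?thesis unfolding H_def[symmetric]
  proof (rule laplace_fn_limit[OF g(1)])
    fix w assume "w \<in> Q"
    then obtain m0 where m0: "w = from_nat_into Q m0" using rQ by (metis rangeE)
    have "eventually (\<lambda>m. norm (g m w - H w) \<le> 1 / real (Suc m)) sequentially"
      using g(2)[of w] m0 by (auto simp: eventually_sequentially W_def intro!: exI[of _ m0])
    then have "(\<lambda>m. g m w - H w) \<longlonglongrightarrow> 0"
      by (rule Lim_null_comparison) (use LIMSEQ_inverse_real_of_nat in \<open>simp add: inverse_eq_divide\<close>)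
    then show "(\<lambda>m. g m w) \<longlonglongrightarrow> H w" by (simp add: LIM_zero_iff)
  next
    show "{0..} \<subseteq> closure Q"
    proof
      fix x :: real assume x: "x \<in> {0..}"
      show "x \<in> closure Q"
        unfolding closure_approachable
      proof (intro allI impI)
        fix e :: real assume "e > 0"
        then obtain q where "q \<in> \<rat>" "x < q" "q < x + e" using Rats_dense_in_real[of x "x + e"] by auto
        then show "\<exists>y\<in>Q. dist y x < e" using x by (intro bexI[of _ q]) (auto simp: Q_def dist_real_def)
      qed
    qed
    show "continuous_on {0..} H"
    proof (rule continuous_on_sequentiallyI)
      fix u :: "nat \<Rightarrow> real" and a assume u: "\<forall>n. u n \<in> {0..}" "a \<in> {0..}" "u \<longlonglongrightarrow> a"
      show "(\<lambda>n. H (u n)) \<longlonglongrightarrow> H a"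
        unfolding H_def
      proof (rule integral_dominated_convergence[where w = "\<lambda>_. 1"])
        show "AE s in M. (\<lambda>n. k s (u n)) \<longlonglongrightarrow> k s a"
        proof (rule eventually_mono[OF G])
          fix s assume s: "?G s"
          show "(\<lambda>n. k s (u n)) \<longlonglongrightarrow> k s a"
            by (rule continuous_on_tendsto_compose[OF laplace_fn_continuous[OF conjunct1[OF s]] u(3,2)])
              (use u(1) in \<open>auto intro!: always_eventually\<close>)
        qed
        show "AE s in M. norm (k s (u n)) \<le> 1" for n
          by (rule eventually_mono[OF G]) (use k01 u in auto)
      qed (use u meas in auto)
    qed
  qed (use \<open>0 \<in> Q\<close> in \<open>auto simp: Q_def\<close>)
qed

text \<open>Reduction to probability measures by size biasing: M is reweighted with h s 0 / H 0 and
  each \<open>h s\<close> is divided by its value at 0. Parameters with h s 0 = 0 get weight 0, so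
  the division is harmless. M may be an infinite measure such as dx/x.\<close>

lemma laplace_fn_mixture:
  assumes meas: "\<And>w. w \<ge> 0 \<Longrightarrow> (\<lambda>s. h s w) \<in> borel_measurable M"
    and G: "AE s in M. laplace_fn (h s)"
    and H0: "\<And>w. w \<ge> 0 \<Longrightarrow> 0 \<le> H w"
    and H: "\<And>w. w \<ge> 0 \<Longrightarrow> ennreal (H w) = (\<integral>\<^sup>+ s. ennreal (h s w) \<partial>M)"
  shows "laplace_fn H"
proof (cases "H 0 = 0")
  case True
  have "H w = 0" if "w \<ge> 0" for w
  proof -
    have "ennreal (H w) \<le> ennreal (H 0)"
      unfolding H[OF that] H[OF order_refl]
      by (rule nn_integral_mono_AE, rule eventually_mono[OF G])
        (use laplace_fn_antimono[OF _ order_refl that] in \<open>auto intro: ennreal_leI\<close>)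
    then show ?thesis using True H0[OF that] by simp
  qed
  then show ?thesis by (intro laplace_fn_cong[OF laplace_fn_zero]) auto
next
  case False
  then have Hp: "H 0 > 0" using H0[of 0] by simp
  note [measurable] = meas meas[OF order_refl]
  define P where "P = density M (\<lambda>s. ennreal (h s 0 / H 0))"
  define k where "k s w = h s w / h s 0" for s w
  have "emeasure P (space P) = (\<integral>\<^sup>+ s. ennreal (1 / H 0) * ennreal (h s 0) \<partial>M)"
    by (simp add: P_def emeasure_density ennreal_mult'[symmetric] Hp less_imp_le)
  also have "\<dots> = ennreal (1 / H 0) * ennreal (H 0)"
    by (subst nn_integral_cmult) (auto simp: H)
  also have "\<dots> = 1" using Hp by (simp add: ennreal_mult[symmetric])
  finally interpret P: prob_space P by (rule prob_spaceI)
  have mk: "(\<lambda>s. k s w) \<in> borel_measurable P" if "w \<ge> 0" for w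
    using meas[OF that] by (simp add: k_def P_def)
  have Gk: "AE s in P. laplace_fn (k s) \<and> k s 0 = 1"
    unfolding P_def
  proof (subst AE_density, simp, rule eventually_mono[OF G], intro impI)
    fix s assume s: "laplace_fn (h s)" "0 < ennreal (h s 0 / H 0)"
    then have "h s 0 > 0" using Hp by (simp add: zero_less_divide_iff)
    then show "laplace_fn (k s) \<and> k s 0 = 1"
      using laplace_fn_cmult[OF s(1), of "1 / h s 0"] by (simp add: k_def[abs_def])
  qed
  have kpos: "AE s in P. 0 \<le> k s w" if "w \<ge> 0" for w
    by (rule eventually_mono[OF Gk]) (use laplace_fn_nonneg[OF _ that] in auto)
  have "(\<integral>s. k s w \<partial>P) = H w / H 0" if w: "w \<ge> 0" for w
  proof -
    have "(\<integral>\<^sup>+ s. ennreal (k s w) \<partial>P) = (\<integral>\<^sup>+ s. ennreal (h s 0 / H 0) * ennreal (k s w) \<partial>M)"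
      unfolding P_def using mk[OF w] by (subst nn_integral_density) (auto simp: P_def)
    also have "\<dots> = (\<integral>\<^sup>+ s. ennreal (1 / H 0) * ennreal (h s w) \<partial>M)"
    proof (rule nn_integral_cong_AE, rule eventually_mono[OF G])
      fix s assume s: "laplace_fn (h s)"
      have "0 \<le> h s w" "h s w \<le> h s 0" using laplace_fn_nonneg[OF s w] laplace_fn_antimono[OF s order_refl w] .
      then show "ennreal (h s 0 / H 0) * ennreal (k s w) = ennreal (1 / H 0) * ennreal (h s w)"
        using Hp by (auto simp: k_def ennreal_mult[symmetric])
    qed
    also have "\<dots> = ennreal (1 / H 0) * ennreal (H w)"
      using meas[OF w] by (subst nn_integral_cmult) (auto simp: H[OF w])
    finally have "(\<integral>\<^sup>+ s. ennreal (k s w) \<partial>P) = ennreal (H w / H 0)"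
      using Hp H0[OF w] by (simp add: ennreal_mult[symmetric])
    then show ?thesis
      by (subst integral_eq_nn_integral) (use mk[OF w] kpos[OF w] Hp H0[OF w] in auto)
  qed
  then have "laplace_fn (\<lambda>w. H w / H 0)"
    by (intro laplace_fn_cong[OF P.laplace_fn_expectation[OF Gk mk]])
  from laplace_fn_cmult[OF this, of "H 0"] show ?thesis using Hp by simp
qed

section \<open>Gamma transforms and their infinite products\<close>

lemma nn_integral_gamma:
  assumes a: "a > 0" and g: "\<gamma> > 0"
  shows "(\<integral>\<^sup>+ t. ennreal (indicator {0..} t * (t powr (\<gamma> - 1) * exp (- a * t))) \<partial>lborel)
    = ennreal (Gamma \<gamma> * a powr (- \<gamma>))"
proof -
  have "(\<integral>\<^sup>+ t. ennreal (indicator {0..} t * (t powr (\<gamma> - 1) / exp t)) \<partial>lborel) = ennreal (Gamma \<gamma>)"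
    by (rule nn_integral_has_integral_lebesgue[OF _ Gamma_integral_real[OF g], unfolded nn_integral_completion]) simp
  then have *: "(\<integral>\<^sup>+ t. ennreal (indicator {0..} t * (t powr (\<gamma> - 1) * exp (- t))) \<partial>lborel) = ennreal (Gamma \<gamma>)"
    by (simp add: exp_minus field_simps)
  have "ennreal (Gamma \<gamma>) =
     ennreal a * (\<integral>\<^sup>+ t. ennreal (indicator {0..} (a * t) * ((a * t) powr (\<gamma> - 1) * exp (- (a * t)))) \<partial>lborel)"
    unfolding *[symmetric] using a by (subst nn_integral_real_affine[where c = a and t = 0]) auto
  also have "(\<integral>\<^sup>+ t. ennreal (indicator {0..} (a * t) * ((a * t) powr (\<gamma> - 1) * exp (- (a * t)))) \<partial>lborel)
     = (\<integral>\<^sup>+ t. ennreal (a powr (\<gamma> - 1)) * ennreal (indicator {0..} t * (t powr (\<gamma> - 1) * exp (- a * t))) \<partial>lborel)"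
    using a by (intro nn_integral_cong)
      (auto simp: ennreal_mult[symmetric] powr_mult indicator_def zero_le_mult_iff)
  also have "\<dots> = ennreal (a powr (\<gamma> - 1)) * (\<integral>\<^sup>+ t. ennreal (indicator {0..} t * (t powr (\<gamma> - 1) * exp (- a * t))) \<partial>lborel)"
    by (rule nn_integral_cmult) auto
  finally have "ennreal (Gamma \<gamma>) = ennreal (a powr \<gamma>) *
      (\<integral>\<^sup>+ t. ennreal (indicator {0..} t * (t powr (\<gamma> - 1) * exp (- a * t))) \<partial>lborel)"
    using a by (simp add: mult.assoc[symmetric] ennreal_mult[symmetric] powr_diff)
  then have "ennreal (a powr (- \<gamma>)) * ennreal (Gamma \<gamma>) = ennreal (a powr (- \<gamma>)) * ennreal (a powr \<gamma>) *
      (\<integral>\<^sup>+ t. ennreal (indicator {0..} t * (t powr (\<gamma> - 1) * exp (- a * t))) \<partial>lborel)"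
    by (simp add: mult.assoc)
  also have "ennreal (a powr (- \<gamma>)) * ennreal (a powr \<gamma>) = 1"
    using a by (simp add: ennreal_mult[symmetric] powr_add[symmetric])
  finally show ?thesis
    using Gamma_real_pos[OF g] by (simp add: ennreal_mult[symmetric] mult.commute)
qed

text \<open>Transform of c times a gamma variable of shape \<gamma>. Shape 0 is a point mass at 0
  and is split off because its density would not be integrable.\<close>

lemma laplace_fn_gamma:
  assumes c: "c \<ge> 0" and g: "\<gamma> \<ge> 0"
  shows "laplace_fn (\<lambda>s. (1 + c * s) powr (- \<gamma>))"
proof (cases "\<gamma> = 0")
  case True
  show ?thesis
    by (rule laplace_fn_cong[OF laplace_fn_exp[of 0]]) (use True c in \<open>auto simp: add_nonneg_eq_0_iff\<close>)
next
  case False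
  with g have g: "\<gamma> > 0" by simp
  have Gp: "Gamma \<gamma> > 0" using g by (rule Gamma_real_pos)
  let ?M = "density lborel (\<lambda>t. ennreal (indicator {0..} t * (t powr (\<gamma> - 1) * exp (- t)) / Gamma \<gamma>))"
  show ?thesis
  proof (rule laplace_fnI[of "\<lambda>t. c * t" ?M])
    show "AE t in ?M. 0 \<le> c * t"
      using c by (subst AE_density) (auto simp: indicator_def intro!: AE_I2)
    fix s :: real assume s: "s \<ge> 0"
    have a: "1 + c * s > 0" using c s by (simp add: add_pos_nonneg)
    have "(\<integral>\<^sup>+ t. ennreal (exp (- s * (c * t))) \<partial>?M) =
       (\<integral>\<^sup>+ t. ennreal (1 / Gamma \<gamma>) * ennreal (indicator {0..} t * (t powr (\<gamma> - 1) * exp (- (1 + c * s) * t))) \<partial>lborel)"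
      using Gp by (subst nn_integral_density)
        (auto simp: ennreal_mult[symmetric] exp_add[symmetric] algebra_simps indicator_def intro!: nn_integral_cong)
    also have "\<dots> = ennreal (1 / Gamma \<gamma>) * ennreal (Gamma \<gamma> * (1 + c * s) powr (- \<gamma>))"
      by (subst nn_integral_cmult) (use nn_integral_gamma[OF a g] in auto)
    also have "\<dots> = ennreal ((1 + c * s) powr (- \<gamma>))"
      using Gp by (simp add: ennreal_mult[symmetric])
    finally show "ennreal ((1 + c * s) powr (- \<gamma>)) = (\<integral>\<^sup>+ t. ennreal (exp (- s * (c * t))) \<partial>?M)" ..
  qed auto
qed

text \<open>The logarithm is constant on each level set of k, so the exponential is a finite product
  of gamma transforms whose shapes are the masses of the level sets.\<close>

lemma laplace_fn_thorin_simple: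
  assumes k: "simple_function M k" and k0: "\<And>x. x \<in> space M \<Longrightarrow> 0 \<le> k x"
    and int: "\<And>s. s \<ge> 0 \<Longrightarrow> integrable M (\<lambda>x. ln (1 + s * k x))"
  shows "laplace_fn (\<lambda>s. exp (- (\<integral>x. ln (1 + s * k x) \<partial>M)))"
proof -
  define C where "C = k ` space M"
  define A where "A c = k -` {c} \<inter> space M" for c :: real
  have C: "finite C" "\<And>c. c \<in> C \<Longrightarrow> c \<ge> 0" using k k0 by (auto simp: C_def simple_function_def)
  have [measurable]: "A c \<in> sets M" for c
    using k by (simp add: A_def simple_functionD)
  have "laplace_fn (\<lambda>s. \<Prod>c\<in>C. (1 + c * s) powr (- measure M (A c)))"
    by (intro laplace_fn_prod laplace_fn_gamma) (use C in auto)
  moreover have "(\<Prod>c\<in>C. (1 + c * s) powr (- measure M (A c))) = exp (- (\<integral>x. ln (1 + s * k x) \<partial>M))"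
    if s: "s \<ge> 0" for s
  proof -
    have ii: "integrable M (\<lambda>x. ln (1 + s * c) * indicator (A c) x)" if "c \<in> C" for c
    proof (rule Bochner_Integration.integrable_bound[OF int[OF s]])
      show "AE x in M. norm (ln (1 + s * c) * indicator (A c) x) \<le> norm (ln (1 + s * k x))"
        by (rule AE_I2) (auto simp: A_def indicator_def)
    qed simp
    have "(\<integral>x. ln (1 + s * k x) \<partial>M) = (\<integral>x. (\<Sum>c\<in>C. ln (1 + s * c) * indicator (A c) x) \<partial>M)"
    proof (rule Bochner_Integration.integral_cong[OF refl])
      fix x assume x: "x \<in> space M"
      have "(\<Sum>c\<in>C. ln (1 + s * c) * indicator (A c) x) = (\<Sum>c\<in>C. if c = k x then ln (1 + s * k x) else 0)"
        by (intro sum.cong refl) (use x in \<open>auto simp: A_def\<close>)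
      then show "ln (1 + s * k x) = (\<Sum>c\<in>C. ln (1 + s * c) * indicator (A c) x)"
        using C(1) x by (simp add: C_def)
    qed
    \<comment> \<open>The level c = 0 may have infinite mass, where \<open>measure\<close> defaults
      to 0; its factor ln 1 = 0 makes this harmless. Positive levels have finite mass by
      integrability.\<close>
    also have "\<dots> = (\<Sum>c\<in>C. ln (1 + s * c) * measure M (A c))"
      by (subst Bochner_Integration.integral_sum[OF ii]) auto
    finally show ?thesis
      using C s by (auto simp: exp_sum sum_negf[symmetric] powr_def mult_ac add_nonneg_eq_0_iff intro!: prod.cong)
  qed
  ultimately show ?thesis by (rule laplace_fn_cong)
qed

text \<open>In the language of Thorin measures \<kappa> is the scale 1/u. Simple functions
  increasing to \<kappa> give finite products of gamma transforms, and their logarithms stay below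
  the integrable one of the limit. This serves twice: for exp (- c x powr r), and for the n-th root
  of a transform.\<close>

lemma laplace_fn_thorin:
  assumes [measurable]: "\<kappa> \<in> borel_measurable M" and \<kappa>0: "\<And>x. x \<in> space M \<Longrightarrow> 0 \<le> \<kappa> x"
    and int: "\<And>s. s \<ge> 0 \<Longrightarrow> integrable M (\<lambda>x. ln (1 + s * \<kappa> x))"
  shows "laplace_fn (\<lambda>s. exp (- (\<integral>x. ln (1 + s * \<kappa> x) \<partial>M)))"
proof -
  obtain f where f: "\<And>i. simple_function M (f i)" "incseq f" "\<And>i x. f i x < top"
      "\<And>x. (SUP i. f i x) = ennreal (\<kappa> x)"
    using borel_measurable_implies_simple_function_sequence'[of "\<lambda>x. ennreal (\<kappa> x)" M] by auto
  define k where "k i x = enn2real (f i x)" for i x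
  have ks: "simple_function M (k i)" for i
    using simple_function_compose1[OF f(1)[of i], of enn2real] by (simp add: k_def[abs_def])
  have [measurable]: "k i \<in> borel_measurable M" for i using ks by (rule borel_measurable_simple_function)
  have k0: "0 \<le> k i x" for i x by (simp add: k_def)
  have kle: "k i x \<le> \<kappa> x" if "x \<in> space M" for i x
  proof -
    have "f i x \<le> ennreal (\<kappa> x)" unfolding f(4)[of x, symmetric] by (rule SUP_upper) simp
    then show ?thesis using \<kappa>0[OF that] f(3)[of i x] by (simp add: k_def enn2real_leI)
  qed
  have klim: "(\<lambda>i. k i x) \<longlonglongrightarrow> \<kappa> x" if "x \<in> space M" for x
  proof -
    have "incseq (\<lambda>i. f i x)" using f(2) by (auto simp: incseq_def le_fun_def)
    from LIMSEQ_SUP[OF this] have "(\<lambda>i. f i x) \<longlonglongrightarrow> ennreal (\<kappa> x)" by (simp add: f(4))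
    from tendsto_enn2real[OF this] show ?thesis using \<kappa>0[OF that] by (simp add: k_def)
  qed
  have lnle: "norm (ln (1 + s * k i x)) \<le> ln (1 + s * \<kappa> x)" if "s \<ge> 0" "x \<in> space M" for s i x
    using kle[OF that(2), of i] k0[of i x] that by (auto simp: mult_left_mono add_pos_nonneg)
  have ki: "integrable M (\<lambda>x. ln (1 + s * k i x))" if "s \<ge> 0" for s i
    by (rule Bochner_Integration.integrable_bound[OF int[OF that]])
      (use lnle[OF that] in \<open>auto intro!: AE_I2 order_trans[OF _ abs_ge_self]\<close>)
  show ?thesis
  proof (rule laplace_fn_limit[where D = "{0..}"])
    show "laplace_fn (\<lambda>s. exp (- (\<integral>x. ln (1 + s * k i x) \<partial>M)))" for i
      by (rule laplace_fn_thorin_simple[OF ks k0 ki])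
    fix s :: real assume "s \<in> {0..}" then have s: "s \<ge> 0" by simp
    have "(\<lambda>i. \<integral>x. ln (1 + s * k i x) \<partial>M) \<longlonglongrightarrow> (\<integral>x. ln (1 + s * \<kappa> x) \<partial>M)"
    proof (rule integral_dominated_convergence[where w = "\<lambda>x. ln (1 + s * \<kappa> x)"])
      show "AE x in M. (\<lambda>i. ln (1 + s * k i x)) \<longlonglongrightarrow> ln (1 + s * \<kappa> x)"
      proof (rule AE_I2)
        fix x assume x: "x \<in> space M"
        have "1 + s * \<kappa> x > 0" using s \<kappa>0[OF x] by (simp add: add_pos_nonneg)
        then show "(\<lambda>i. ln (1 + s * k i x)) \<longlonglongrightarrow> ln (1 + s * \<kappa> x)"
          by (intro tendsto_intros klim x) auto
      qed
      show "AE x in M. norm (ln (1 + s * k i x)) \<le> ln (1 + s * \<kappa> x)" for i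
        by (rule AE_I2) (rule lnle[OF s])
    qed (use int s in auto)
    then show "(\<lambda>i. exp (- (\<integral>x. ln (1 + s * k i x) \<partial>M))) \<longlonglongrightarrow> exp (- (\<integral>x. ln (1 + s * \<kappa> x) \<partial>M))"
      by (intro tendsto_exp tendsto_minus)
  next
    have "continuous_on {0..} (\<lambda>s. \<integral>x. ln (1 + s * \<kappa> x) \<partial>M)"
    proof (rule continuous_on_sequentiallyI)
      fix u :: "nat \<Rightarrow> real" and a assume u: "\<forall>n. u n \<in> {0..}" "a \<in> {0..}" "u \<longlonglongrightarrow> a"
      obtain B where B: "\<And>n. u n \<le> B" "B \<ge> 0"
        using convergent_imp_Bseq[of u] u(3) by (force simp: convergent_def Bseq_def abs_le_iff)
      show "(\<lambda>n. \<integral>x. ln (1 + u n * \<kappa> x) \<partial>M) \<longlonglongrightarrow> (\<integral>x. ln (1 + a * \<kappa> x) \<partial>M)"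
      proof (rule integral_dominated_convergence[where w = "\<lambda>x. ln (1 + B * \<kappa> x)"])
        show "AE x in M. (\<lambda>n. ln (1 + u n * \<kappa> x)) \<longlonglongrightarrow> ln (1 + a * \<kappa> x)"
        proof (rule AE_I2)
          fix x assume x: "x \<in> space M"
          have "1 + a * \<kappa> x > 0" using u \<kappa>0[OF x] by (simp add: add_pos_nonneg)
          then show "(\<lambda>n. ln (1 + u n * \<kappa> x)) \<longlonglongrightarrow> ln (1 + a * \<kappa> x)"
            by (intro tendsto_intros u(3)) auto
        qed
        show "AE x in M. norm (ln (1 + u n * \<kappa> x)) \<le> ln (1 + B * \<kappa> x)" for n
          by (rule AE_I2) (use u(1) B \<kappa>0 in \<open>auto simp: mult_right_mono add_pos_nonneg\<close>)
      qed (use int[OF B(2)] in auto)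
    qed
    then show "continuous_on {0..} (\<lambda>s. exp (- (\<integral>x. ln (1 + s * \<kappa> x) \<partial>M)))"
      by (intro continuous_intros)
  qed (auto simp: closure_subset)
qed

section \<open>Hyperbolically completely monotone functions\<close>

text \<open>Kept on the whole real line with density zero off x > 0, so that functions stay Borel
  functions of a real and positivity becomes an almost everywhere statement.\<close>

definition haar :: "real measure" where
  "haar = density lborel (\<lambda>x. ennreal (indicator {0<..} x / x))"

lemma sets_haar[measurable_cong, simp]: "sets haar = sets borel"
  by (simp add: haar_def)

lemma space_haar[simp]: "space haar = UNIV"
  by (simp add: haar_def)

interpretation haar: sigma_finite_measure haar
  unfolding haar_def
  by (subst sigma_finite_measure.sigma_finite_iff_density_finite[OF sigma_finite_lborel]) auto

lemma AE_haar: "AE x in haar. x > 0"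
  unfolding haar_def by (subst AE_density) (auto simp: indicator_def intro!: AE_I2)

lemma nn_integral_haar:
  "f \<in> borel_measurable borel \<Longrightarrow> (\<integral>\<^sup>+ x. f x \<partial>haar) = (\<integral>\<^sup>+ x. ennreal (indicator {0<..} x / x) * f x \<partial>lborel)"
  unfolding haar_def by (subst nn_integral_density) auto

lemma nn_integral_haar_cong:
  "(\<And>x. x > 0 \<Longrightarrow> f x = g x) \<Longrightarrow> (\<integral>\<^sup>+ x. f x \<partial>haar) = (\<integral>\<^sup>+ x. g x \<partial>haar)"
  by (rule nn_integral_cong_AE, rule eventually_mono[OF AE_haar]) auto

lemma nn_integral_haar_scale:
  assumes [measurable]: "f \<in> borel_measurable borel" and c: "c > 0"
  shows "(\<integral>\<^sup>+ x. f (c * x) \<partial>haar) = (\<integral>\<^sup>+ x. f x \<partial>haar)"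
proof -
  have "(\<integral>\<^sup>+ x. f x \<partial>haar) = ennreal c * (\<integral>\<^sup>+ x. ennreal (indicator {0<..} (c * x) / (c * x)) * f (c * x) \<partial>lborel)"
    using c by (subst nn_integral_haar, simp, subst nn_integral_real_affine[where c = c and t = 0]) auto
  also have "\<dots> = (\<integral>\<^sup>+ x. ennreal c * (ennreal (indicator {0<..} (c * x) / (c * x)) * f (c * x)) \<partial>lborel)"
    by (rule nn_integral_cmult[symmetric]) simp
  also have "\<dots> = (\<integral>\<^sup>+ x. ennreal (indicator {0<..} x / x) * f (c * x) \<partial>lborel)"
    using c by (intro nn_integral_cong)
      (auto simp: mult.assoc[symmetric] ennreal_mult[symmetric] indicator_def zero_less_mult_iff)
  finally show ?thesis by (subst nn_integral_haar) auto
qed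

text \<open>Substitution x = exp t. The substitution rule works on compact intervals, so it is
  applied on [-n, n] and n is sent to infinity by monotone convergence.\<close>

lemma nn_integral_haar_exp:
  assumes [measurable]: "f \<in> borel_measurable borel"
  shows "(\<integral>\<^sup>+ x. f x \<partial>haar) = (\<integral>\<^sup>+ t. f (exp t) \<partial>lborel)"
proof -
  define F where "F x = ennreal (indicator {0<..} x / x) * f x" for x
  have [measurable]: "F \<in> borel_measurable borel" by (simp add: F_def[abs_def])
  have eq: "(\<integral>\<^sup>+ x. F x * indicator {exp (- real n)..exp (real n)} x \<partial>lborel) =
      (\<integral>\<^sup>+ t. f (exp t) * indicator {- real n..real n} t \<partial>lborel)" for n
  proof (cases "n = 0")
    case False
    have "(\<integral>\<^sup>+ x. F x * indicator {exp (- real n)..exp (real n)} x \<partial>lborel) =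
      (\<integral>\<^sup>+ t. F (exp t) * ennreal (exp t) * indicator {- real n..real n} t \<partial>lborel)"
      by (rule nn_integral_substitution_aux) (use False in \<open>auto intro!: derivative_eq_intros continuous_intros\<close>)
    also have "\<dots> = (\<integral>\<^sup>+ t. f (exp t) * indicator {- real n..real n} t \<partial>lborel)"
    proof (intro nn_integral_cong)
      fix t :: real
      have "F (exp t) * ennreal (exp t) = (ennreal (1 / exp t) * ennreal (exp t)) * f (exp t)"
        by (simp add: F_def mult_ac)
      also have "ennreal (1 / exp t) * ennreal (exp t) = 1" by (simp add: ennreal_mult[symmetric])
      finally show "F (exp t) * ennreal (exp t) * indicator {- real n..real n} t = f (exp t) * indicator {- real n..real n} t"
        by simp
    qed
    finally show ?thesis .
  next
    \<comment> \<open>Both intervals are single points, hence null; the substitution rule asks for a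
      proper interval.\<close>
    case True
    have "(\<integral>\<^sup>+ x. g x * indicator {c} x \<partial>lborel) = (\<integral>\<^sup>+ (x :: real). 0 \<partial>lborel)" for g :: "real \<Rightarrow> ennreal" and c :: real
      using AE_lborel_singleton[of c] by (intro nn_integral_cong_AE) (auto elim!: eventually_mono)
    with True show ?thesis by simp
  qed
  have sup: "(SUP n. c * indicator (A n) x) = c * indicator (\<Union>n. A n) x"
    if "incseq A" for A :: "nat \<Rightarrow> real set" and c :: ennreal and x
  proof (rule antisym)
    show "(SUP n. c * indicator (A n) x) \<le> c * indicator (\<Union>n. A n) x"
      by (intro SUP_least mult_left_mono) (auto simp: indicator_def)
    show "c * indicator (\<Union>n. A n) x \<le> (SUP n. c * indicator (A n) x)"
    proof (cases "x \<in> (\<Union>n. A n)")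
      case True
      then obtain n where "x \<in> A n" by auto
      then show ?thesis using True by (intro SUP_upper2[of n]) auto
    qed auto
  qed
  have mono: "incseq (\<lambda>n. {exp (- real n)..exp (real n)})" "incseq (\<lambda>n. {- real n..real n})"
    by (auto simp: incseq_def)
  have inc: "incseq (\<lambda>n x. c x * indicator (A n) x)"
    if "incseq A" for A :: "nat \<Rightarrow> real set" and c :: "real \<Rightarrow> ennreal"
    using that unfolding incseq_def le_fun_def
    by (auto intro!: mult_left_mono simp: indicator_def)
  have U1: "(\<Union>n. {exp (- real n)..exp (real n)}) = {0<..}"
  proof (intro equalityI subsetI)
    fix x :: real assume "x \<in> {0<..}"
    then have x: "x > 0" by simp
    obtain n where "\<bar>ln x\<bar> \<le> real n" using real_arch_simple by blast
    then have "exp (- real n) \<le> exp (ln x)" "exp (ln x) \<le> exp (real n)" by (auto simp del: exp_ln)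
    then show "x \<in> (\<Union>n. {exp (- real n)..exp (real n)})" using x by auto
  next
    fix x :: real assume "x \<in> (\<Union>n. {exp (- real n)..exp (real n)})"
    then obtain n where "exp (- real n) \<le> x" by auto
    then show "x \<in> {0<..}" using less_le_trans[OF exp_gt_zero] by auto
  qed
  have U2: "(\<Union>n. {- real n..real n}) = UNIV"
  proof (intro equalityI subsetI)
    fix x :: real
    obtain n where "\<bar>x\<bar> \<le> real n" using real_arch_simple by blast
    then show "x \<in> (\<Union>n. {- real n..real n})" by (intro UN_I[of n]) auto
  qed auto
  have "(\<integral>\<^sup>+ x. f x \<partial>haar) = (\<integral>\<^sup>+ x. (SUP n. F x * indicator {exp (- real n)..exp (real n)} x) \<partial>lborel)"
    by (subst nn_integral_haar, simp, intro nn_integral_cong, subst sup[OF mono(1)], subst U1)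
      (auto simp: F_def indicator_def)
  also have "\<dots> = (SUP n. \<integral>\<^sup>+ x. F x * indicator {exp (- real n)..exp (real n)} x \<partial>lborel)"
    by (rule nn_integral_monotone_convergence_SUP[OF inc[OF mono(1)]]) measurable
  also have "\<dots> = (SUP n. \<integral>\<^sup>+ t. f (exp t) * indicator {- real n..real n} t \<partial>lborel)"
    by (simp add: eq)
  also have "\<dots> = (\<integral>\<^sup>+ t. (SUP n. f (exp t) * indicator {- real n..real n} t) \<partial>lborel)"
    by (rule nn_integral_monotone_convergence_SUP[OF inc[OF mono(2)], symmetric]) measurable
  also have "\<dots> = (\<integral>\<^sup>+ t. f (exp t) \<partial>lborel)"
    by (intro nn_integral_cong, subst sup[OF mono(2)], subst U2) auto
  finally show ?thesis .
qed

lemma nn_integral_haar_inverse: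
  assumes [measurable]: "f \<in> borel_measurable borel"
  shows "(\<integral>\<^sup>+ x. f (1 / x) \<partial>haar) = (\<integral>\<^sup>+ x. f x \<partial>haar)"
proof -
  have "(\<integral>\<^sup>+ t. f (exp t) \<partial>lborel) = (\<integral>\<^sup>+ t. f (exp (- t)) \<partial>lborel)"
    by (subst nn_integral_real_affine[where c = "-1" and t = 0]) auto
  then show ?thesis by (simp add: nn_integral_haar_exp exp_minus inverse_eq_divide)
qed

lemma nn_integral_haar_const: "c > 0 \<Longrightarrow> (\<integral>\<^sup>+ x. ennreal c \<partial>haar) = \<infinity>"
  by (subst nn_integral_haar_exp) (auto simp: ennreal_mult_top)

lemma emeasure_lborel_atLeast: "emeasure lborel {a :: real..} = \<infinity>"
proof -
  have "of_nat n \<le> emeasure lborel {a..}" for n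
    using emeasure_mono[of "{a..a + real n}" "{a..}" lborel] by (simp add: ennreal_of_nat_eq_real_of_nat)
  then have "(SUP n. of_nat n) \<le> emeasure lborel {a..}" by (rule SUP_least)
  then show ?thesis by (simp add: ennreal_SUP_of_nat_eq_top top_unique)
qed

lemma nn_integral_haar_exp_inverse: "(\<integral>\<^sup>+ x. ennreal (exp (- 1 / x)) \<partial>haar) = \<infinity>"
proof -
  have "\<infinity> = (\<integral>\<^sup>+ t. ennreal (exp (- 1)) * indicator {0::real..} t \<partial>lborel)"
    by (subst nn_integral_cmult_indicator) (auto simp: ennreal_mult_top emeasure_lborel_atLeast)
  also have "\<dots> \<le> (\<integral>\<^sup>+ t. ennreal (exp (- 1 / exp t)) \<partial>lborel)"
    by (rule nn_integral_mono) (auto simp: indicator_def field_simps)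
  finally show ?thesis by (subst nn_integral_haar_exp) (auto simp: top_unique)
qed

text \<open>Scaling by B. The degenerate case is included because both representing measures in
  \<open>hcm_conv_inner\<close> may charge 0; then both sides are infinite, the right one because
  exp (- 1 / x) tends to 1 at infinity.\<close>

lemma nn_integral_haar_bessel:
  assumes "A > 0 \<and> B > 0 \<or> A = 0 \<and> B = 0"
  shows "(\<integral>\<^sup>+ x. ennreal (exp (- A * x - B / x)) \<partial>haar) = (\<integral>\<^sup>+ x. ennreal (exp (- (A * B) * x - 1 / x)) \<partial>haar)"
proof (cases "B = 0")
  case True
  with assms show ?thesis
    using nn_integral_haar_const[of 1] nn_integral_haar_exp_inverse by auto
next
  case False
  with assms have B: "B > 0" by auto
  have "(\<integral>\<^sup>+ x. ennreal (exp (- A * x - B / x)) \<partial>haar) = (\<integral>\<^sup>+ x. ennreal (exp (- A * (B * x) - B / (B * x))) \<partial>haar)"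
    using B by (intro nn_integral_haar_scale[symmetric]) auto
  then show ?thesis using B by (simp add: mult_ac)
qed

text \<open>With \<open>p = u\<^sup>2\<close> and \<open>x = u v\<close>, the variable \<open>u (v + 1 / v)\<close> of the HCM condition is \<open>x + p / x\<close>; it is
  shifted by its minimum \<open>2 u\<close> so that the representing measure becomes finite.\<close>

definition hcm :: "(real \<Rightarrow> real) \<Rightarrow> bool" where
  "hcm f \<longleftrightarrow> (\<forall>x>0. 0 \<le> f x) \<and>
     (\<forall>p>0. \<exists>h. laplace_fn h \<and> (\<forall>x>0. f x * f (p / x) = h (x + p / x - 2 * sqrt p)))"

section \<open>Elementary operations on HCM functions\<close>

lemma hcm_cong:
  assumes f: "hcm f" and eq: "\<And>x. x > 0 \<Longrightarrow> f x = g x"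
  shows "hcm g"
proof -
  have "g x * g (p / x) = f x * f (p / x)" if "x > 0" "p > 0" for x p :: real
    using that by (simp add: eq)
  then show ?thesis using f eq unfolding hcm_def by metis
qed

lemma sum_ge_two_sqrt:
  fixes p x :: real assumes "p > 0" "x > 0" shows "x + p / x - 2 * sqrt p \<ge> 0"
proof -
  have "x + p / x - 2 * sqrt p = (sqrt x - sqrt (p / x))\<^sup>2"
    using assms by (simp add: power2_diff real_sqrt_mult[symmetric] real_sqrt_divide[symmetric])
  then show ?thesis by simp
qed

lemma hcm_inverse:
  assumes "hcm f" shows "hcm (\<lambda>x. f (1 / x))"
  unfolding hcm_def
proof (intro conjI allI impI)
  fix p :: real assume p: "p > 0"
  then obtain h where h: "laplace_fn h" "\<And>x. x > 0 \<Longrightarrow> f x * f (1 / p / x) = h (x + 1 / p / x - 2 * sqrt (1 / p))"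
    using assms unfolding hcm_def by (metis zero_less_divide_1_iff)
  have "f (1 / x) * f (1 / (p / x)) = h (1 / p * (x + p / x - 2 * sqrt p))" if "x > 0" for x
  proof -
    have "1 / x + x / p - 2 * (sqrt p / p) = 1 / p * (x + p / x - 2 * sqrt p)"
      using p that by (simp add: field_simps)
    moreover have "sqrt (1 / p) = sqrt p / p" using p by (simp add: real_sqrt_divide field_simps)
    ultimately show ?thesis using h(2)[of "1 / x"] that by simp
  qed
  then show "\<exists>h. laplace_fn h \<and> (\<forall>x>0. f (1 / x) * f (1 / (p / x)) = h (x + p / x - 2 * sqrt p))"
    using laplace_fn_scale[OF h(1), of "1 / p"] p by (intro exI[of _ "\<lambda>s. h (1 / p * s)"]) auto
qed (use assms in \<open>auto simp: hcm_def\<close>)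

text \<open>The factor contributes the constant c^2 p powr a to the product. Passing between a
  density for dx and one for dx/x, which is a factor x, therefore does not affect the HCM
  property.\<close>

lemma hcm_powr_mult:
  assumes "hcm f" "c \<ge> 0" shows "hcm (\<lambda>x. c * x powr a * f x)"
  unfolding hcm_def
proof (intro conjI allI impI)
  fix p :: real assume p: "p > 0"
  then obtain h where h: "laplace_fn h" "\<And>x. x > 0 \<Longrightarrow> f x * f (p / x) = h (x + p / x - 2 * sqrt p)"
    using assms unfolding hcm_def by metis
  have "c * x powr a * f x * (c * (p / x) powr a * f (p / x)) = (c\<^sup>2 * p powr a) * h (x + p / x - 2 * sqrt p)"
    if "x > 0" for x
  proof -
    have "x powr a * (p / x) powr a = p powr a" using that p by (simp add: powr_mult[symmetric])
    then have "c * x powr a * f x * (c * (p / x) powr a * f (p / x)) = c\<^sup>2 * p powr a * (f x * f (p / x))"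
      by (simp add: power2_eq_square mult_ac)
    then show ?thesis using h(2)[OF that] by simp
  qed
  then show "\<exists>h. laplace_fn h \<and> (\<forall>x>0. c * x powr a * f x * (c * (p / x) powr a * f (p / x)) = h (x + p / x - 2 * sqrt p))"
    using laplace_fn_cmult[OF h(1), of "c\<^sup>2 * p powr a"] by (intro exI[of _ "\<lambda>s. c\<^sup>2 * p powr a * h s"]) auto
qed (use assms in \<open>auto simp: hcm_def\<close>)

text \<open>The density exp (2 u l) undoes the shift by the minimum 2 u. The resulting measure may
  be infinite, which \<open>HCM_function\<close> allows.\<close>

lemma hcm_imp_HCM_integral:
  assumes f: "hcm f" and u: "u > 0"
  shows "\<exists>K :: real measure. sets K = sets (restrict_space borel {0..}) \<and>
        (\<forall>v>0. ennreal (f (u * v) * f (u / v)) =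
                (\<integral>\<^sup>+ l. ennreal (exp (- l * u * (v + inverse v))) \<partial>K))"
proof -
  obtain h where h: "laplace_fn h" "\<And>x. x > 0 \<Longrightarrow> f x * f (u\<^sup>2 / x) = h (x + u\<^sup>2 / x - 2 * sqrt (u\<^sup>2))"
    using f u unfolding hcm_def by (metis zero_less_power)
  obtain K where sK[measurable_cong]: "sets K = sets borel" and K: "AE l in K. 0 \<le> l"
    "\<And>s. s \<ge> 0 \<Longrightarrow> ennreal (h s) = (\<integral>\<^sup>+ l. ennreal (exp (- s * l)) \<partial>K)"
    using laplace_fnE[OF h(1)] by metis
  let ?D = "density K (\<lambda>l. ennreal (exp (2 * u * l)))"
  show ?thesis
  proof (intro exI[of _ "restrict_space ?D {0..}"] conjI allI impI)
    show "sets (restrict_space ?D {0..}) = sets (restrict_space borel {0..})"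
      by (simp add: sets_restrict_space sK)
    fix v :: real assume v: "v > 0"
    have s: "u * v + u / v - 2 * u \<ge> 0"
      using sum_ge_two_sqrt[of "u\<^sup>2" "u * v"] u v by (simp add: power2_eq_square)
    have "f (u * v) * f (u / v) = h (u * v + u / v - 2 * u)"
      using h(2)[of "u * v"] u v by (simp add: power2_eq_square)
    then have "ennreal (f (u * v) * f (u / v)) = (\<integral>\<^sup>+ l. ennreal (exp (- (u * v + u / v - 2 * u) * l)) \<partial>K)"
      using K(2)[OF s] by simp
    also have "\<dots> = (\<integral>\<^sup>+ l. ennreal (exp (2 * u * l)) * (ennreal (exp (- l * u * (v + inverse v))) * indicator {0..} l) \<partial>K)"
      by (rule nn_integral_cong_AE, rule eventually_mono[OF K(1)])
        (auto simp: ennreal_mult[symmetric] exp_add[symmetric] algebra_simps inverse_eq_divide)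
    also have "\<dots> = (\<integral>\<^sup>+ l. ennreal (exp (- l * u * (v + inverse v))) * indicator {0..} l \<partial>?D)"
      by (rule nn_integral_density[symmetric]) auto
    also have "\<dots> = (\<integral>\<^sup>+ l. ennreal (exp (- l * u * (v + inverse v))) \<partial>restrict_space ?D {0..})"
      by (rule nn_integral_restrict_space[symmetric]) (auto simp: sets_eq_imp_space_eq[OF sK])
    finally show "ennreal (f (u * v) * f (u / v)) = (\<integral>\<^sup>+ l. ennreal (exp (- l * u * (v + inverse v))) \<partial>restrict_space ?D {0..})" .
  qed
qed

lemma hcm_imp_HCM_function:
  assumes "hcm f" shows "HCM_function f"
  unfolding HCM_function_def
  by (intro conjI allI impI hcm_imp_HCM_integral[OF assms]) (use assms in \<open>auto simp: hcm_def\<close>)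

text \<open>The contribution of all \<open>x y = p\<close> to \<open>c a * c (q / a)\<close>, where \<open>c\<close> is the convolution of \<open>f\<close> and \<open>g\<close>.\<close>

lemma hcm_conv_inner:
  assumes f: "hcm f" and g: "hcm g" and p: "p > 0" and q: "q > 0"
  obtains M :: "(real \<times> real \<times> real) measure" and \<Lambda> where
    "\<Lambda> \<in> borel_measurable M" "AE z in M. 0 \<le> \<Lambda> z"
    "\<And>a. a > 0 \<Longrightarrow> (\<integral>\<^sup>+ x. ennreal (f (a * x) * f (q / a * (p / x)) * (g x * g (p / x))) \<partial>haar) =
       (\<integral>\<^sup>+ z. ennreal (exp (- (a + q / a - 2 * sqrt q) * \<Lambda> z)) \<partial>M)"
proof -
  have "q * p > 0" using p q by simp
  then obtain hf where hf: "laplace_fn hf" "\<And>x. x > 0 \<Longrightarrow> f x * f (q * p / x) = hf (x + q * p / x - 2 * sqrt (q * p))"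
    using f unfolding hcm_def by metis
  obtain hg where hg: "laplace_fn hg" "\<And>x. x > 0 \<Longrightarrow> g x * g (p / x) = hg (x + p / x - 2 * sqrt p)"
    using g p unfolding hcm_def by metis
  obtain K where fK: "finite_measure K" and sK[measurable_cong]: "sets K = sets borel" and K: "AE l in K. 0 \<le> l"
    "\<And>s. s \<ge> 0 \<Longrightarrow> ennreal (hf s) = (\<integral>\<^sup>+ l. ennreal (exp (- s * l)) \<partial>K)"
    using laplace_fnE[OF hf(1)] by metis
  obtain L where fL: "finite_measure L" and sL[measurable_cong]: "sets L = sets borel" and L: "AE l in L. 0 \<le> l"
    "\<And>s. s \<ge> 0 \<Longrightarrow> ennreal (hg s) = (\<integral>\<^sup>+ l. ennreal (exp (- s * l)) \<partial>L)"
    using laplace_fnE[OF hg(1)] by metis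
  interpret K: finite_measure K by fact
  interpret L: finite_measure L by fact
  interpret Kh: pair_sigma_finite haar K ..
  interpret Lh: pair_sigma_finite haar L ..
  interpret LhP: sigma_finite_measure "L \<Otimes>\<^sub>M haar"
    using sigma_finite_pair_measure[of L haar] L.sigma_finite_measure_axioms haar.sigma_finite_measure_axioms by auto
  \<comment> \<open>After scaling, the exponent is governed by A B = p (l^2 q + m^2 + l m (a + b)).
    Writing a + b = s + 2 sqrt q, the part free of s is collected in D, and s is left with the
    factor p l m x, which becomes \<Lambda>.\<close>
  define D where "D l m x = exp (2 * l * sqrt (q * p) + 2 * m * sqrt p - p * (l\<^sup>2 * q + m\<^sup>2 + 2 * l * m * sqrt q) * x - 1 / x)" for l m x :: real
  let ?M = "density (K \<Otimes>\<^sub>M (L \<Otimes>\<^sub>M haar)) (\<lambda>(l, m, x). ennreal (D l m x))"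
  let ?\<Lambda> = "\<lambda>(l, m, x). if 0 \<le> l \<and> 0 \<le> m \<and> 0 < x then p * l * m * x else 0"
  have [measurable]: "(\<lambda>(l, m, x). ennreal (D l m x)) \<in> borel_measurable (K \<Otimes>\<^sub>M (L \<Otimes>\<^sub>M haar))"
    unfolding D_def by measurable
  have m\<Lambda>[measurable]: "?\<Lambda> \<in> borel_measurable (K \<Otimes>\<^sub>M (L \<Otimes>\<^sub>M haar))"
    by measurable
  show ?thesis
  proof (rule that[of ?\<Lambda> ?M])
    show "?\<Lambda> \<in> borel_measurable ?M" using m\<Lambda> by simp
    show "AE z in ?M. 0 \<le> ?\<Lambda> z" using p by (auto intro!: AE_I2)
    fix a :: real assume a: "a > 0"
    define b where "b = q / a"
    have b: "b > 0" "a * b = q" using a q by (auto simp: b_def)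
    define s where "s = a + b - 2 * sqrt q"
    define G where "G z = (case z of (l, m, x) \<Rightarrow> ennreal (D l m x)) * ennreal (exp (- s * ?\<Lambda> z))" for z
    have [measurable]: "G \<in> borel_measurable (K \<Otimes>\<^sub>M (L \<Otimes>\<^sub>M haar))"
      unfolding G_def[abs_def] by measurable
    have "(\<integral>\<^sup>+ x. ennreal (f (a * x) * f (b * (p / x)) * (g x * g (p / x))) \<partial>haar)
      = (\<integral>\<^sup>+ x. (\<integral>\<^sup>+ l. \<integral>\<^sup>+ m. ennreal (exp (2 * l * sqrt (q * p) + 2 * m * sqrt p - (l * a + m) * x - p * (l * b + m) / x)) \<partial>L \<partial>K) \<partial>haar)"
    proof (rule nn_integral_haar_cong)
      fix x :: real assume x: "x > 0"
      have 1: "b * (p / x) = q * p / (a * x)" using b(1) a by (simp add: b(2)[symmetric])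
      have s1: "a * x + q * p / (a * x) - 2 * sqrt (q * p) \<ge> 0" using sum_ge_two_sqrt[of "q * p" "a * x"] a p q x by auto
      have s2: "x + p / x - 2 * sqrt p \<ge> 0" using sum_ge_two_sqrt[of p x] p x by auto
      have "ennreal (f (a * x) * f (b * (p / x)) * (g x * g (p / x))) =
         ennreal (hf (a * x + q * p / (a * x) - 2 * sqrt (q * p))) * ennreal (hg (x + p / x - 2 * sqrt p))"
        unfolding 1 using hf(2)[of "a * x"] hg(2)[OF x] a x
          laplace_fn_nonneg[OF hf(1) s1] laplace_fn_nonneg[OF hg(1) s2] by (simp add: ennreal_mult)
      also have "\<dots> = (\<integral>\<^sup>+ l. \<integral>\<^sup>+ m. ennreal (exp (- (a * x + q * p / (a * x) - 2 * sqrt (q * p)) * l)) * ennreal (exp (- (x + p / x - 2 * sqrt p) * m)) \<partial>L \<partial>K)"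
        by (simp add: nn_integral_cmult nn_integral_multc K(2)[OF s1] L(2)[OF s2])
      also have "\<dots> = (\<integral>\<^sup>+ l. \<integral>\<^sup>+ m. ennreal (exp (2 * l * sqrt (q * p) + 2 * m * sqrt p - (l * a + m) * x - p * (l * b + m) / x)) \<partial>L \<partial>K)"
        unfolding 1[symmetric] by (intro nn_integral_cong)
          (auto simp: ennreal_mult[symmetric] exp_add[symmetric] algebra_simps add_divide_distrib diff_divide_distrib)
      finally show "ennreal (f (a * x) * f (b * (p / x)) * (g x * g (p / x))) = \<dots>" .
    qed
    also have "\<dots> = (\<integral>\<^sup>+ l. \<integral>\<^sup>+ x. \<integral>\<^sup>+ m. ennreal (exp (2 * l * sqrt (q * p) + 2 * m * sqrt p - (l * a + m) * x - p * (l * b + m) / x)) \<partial>L \<partial>haar \<partial>K)"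
      by (rule Kh.Fubini'[symmetric]) measurable
    also have "\<dots> = (\<integral>\<^sup>+ l. \<integral>\<^sup>+ m. \<integral>\<^sup>+ x. ennreal (exp (2 * l * sqrt (q * p) + 2 * m * sqrt p - (l * a + m) * x - p * (l * b + m) / x)) \<partial>haar \<partial>L \<partial>K)"
      by (intro nn_integral_cong Lh.Fubini'[symmetric]) measurable
    also have "\<dots> = (\<integral>\<^sup>+ l. \<integral>\<^sup>+ m. \<integral>\<^sup>+ x. ennreal (D l m x) * ennreal (exp (- s * (p * l * m * x))) \<partial>haar \<partial>L \<partial>K)"
    proof (rule nn_integral_cong_AE, rule eventually_mono[OF K(1)])
      fix l :: real assume l: "0 \<le> l"
      show "(\<integral>\<^sup>+ m. \<integral>\<^sup>+ x. ennreal (exp (2 * l * sqrt (q * p) + 2 * m * sqrt p - (l * a + m) * x - p * (l * b + m) / x)) \<partial>haar \<partial>L)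
        = (\<integral>\<^sup>+ m. \<integral>\<^sup>+ x. ennreal (D l m x) * ennreal (exp (- s * (p * l * m * x))) \<partial>haar \<partial>L)"
      proof (rule nn_integral_cong_AE, rule eventually_mono[OF L(1)])
        fix m :: real assume m: "0 \<le> m"
        let ?A = "l * a + m" and ?B = "p * (l * b + m)" and ?c = "exp (2 * l * sqrt (q * p) + 2 * m * sqrt p)"
        have AB: "?A > 0 \<and> ?B > 0 \<or> ?A = 0 \<and> ?B = 0"
          using l m a b p by (cases "l = 0"; cases "m = 0") (auto simp: add_nonneg_pos add_pos_nonneg)
        have ABe: "?A * ?B = p * (l\<^sup>2 * q + m\<^sup>2 + l * m * (a + b))"
          by (simp add: b(2)[symmetric] power2_eq_square algebra_simps)
        have "(\<integral>\<^sup>+ x. ennreal (exp (2 * l * sqrt (q * p) + 2 * m * sqrt p - ?A * x - ?B / x)) \<partial>haar)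
          = ennreal ?c * (\<integral>\<^sup>+ x. ennreal (exp (- ?A * x - ?B / x)) \<partial>haar)"
          by (subst nn_integral_cmult[symmetric]) (auto simp: ennreal_mult[symmetric] exp_add[symmetric] algebra_simps)
        also have "(\<integral>\<^sup>+ x. ennreal (exp (- ?A * x - ?B / x)) \<partial>haar) = (\<integral>\<^sup>+ x. ennreal (exp (- (?A * ?B) * x - 1 / x)) \<partial>haar)"
          by (rule nn_integral_haar_bessel[OF AB])
        also have "ennreal ?c * \<dots> = (\<integral>\<^sup>+ x. ennreal ?c * ennreal (exp (- (?A * ?B) * x - 1 / x)) \<partial>haar)"
          by (rule nn_integral_cmult[symmetric]) simp
        also have "\<dots> = (\<integral>\<^sup>+ x. ennreal (D l m x) * ennreal (exp (- s * (p * l * m * x))) \<partial>haar)"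
          unfolding ABe
          by (intro nn_integral_cong) (simp add: D_def s_def ennreal_mult[symmetric] exp_add[symmetric] algebra_simps)
        finally show "(\<integral>\<^sup>+ x. ennreal (exp (2 * l * sqrt (q * p) + 2 * m * sqrt p - ?A * x - ?B / x)) \<partial>haar)
          = (\<integral>\<^sup>+ x. ennreal (D l m x) * ennreal (exp (- s * (p * l * m * x))) \<partial>haar)" .
      qed
    qed
    also have "\<dots> = (\<integral>\<^sup>+ l. \<integral>\<^sup>+ m. \<integral>\<^sup>+ x. ennreal (D l m x) * ennreal (exp (- s * ?\<Lambda> (l, m, x))) \<partial>haar \<partial>L \<partial>K)"
      by (intro nn_integral_cong_AE eventually_mono[OF K(1)] eventually_mono[OF L(1)] nn_integral_haar_cong) auto
    also have "\<dots> = (\<integral>\<^sup>+ l. \<integral>\<^sup>+ m. \<integral>\<^sup>+ x. G (l, m, x) \<partial>haar \<partial>L \<partial>K)"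
      by (simp add: G_def)
    also have "\<dots> = (\<integral>\<^sup>+ l. \<integral>\<^sup>+ y. G (l, y) \<partial>(L \<Otimes>\<^sub>M haar) \<partial>K)"
    proof (rule nn_integral_cong)
      fix l
      have "(\<lambda>y. G (l, y)) \<in> borel_measurable (L \<Otimes>\<^sub>M haar)" if "l \<in> space K"
        using that by measurable
      then show "(\<integral>\<^sup>+ m. \<integral>\<^sup>+ x. G (l, m, x) \<partial>haar \<partial>L) = (\<integral>\<^sup>+ y. G (l, y) \<partial>(L \<Otimes>\<^sub>M haar))"
        by (intro haar.nn_integral_fst) (simp add: sets_eq_imp_space_eq[OF sK])
    qed
    also have "\<dots> = (\<integral>\<^sup>+ z. G z \<partial>(K \<Otimes>\<^sub>M (L \<Otimes>\<^sub>M haar)))"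
      by (rule LhP.nn_integral_fst) measurable
    also have "\<dots> = (\<integral>\<^sup>+ z. ennreal (exp (- s * ?\<Lambda> z)) \<partial>?M)"
      unfolding G_def by (rule nn_integral_density[symmetric]) measurable
    finally show "(\<integral>\<^sup>+ x. ennreal (f (a * x) * f (q / a * (p / x)) * (g x * g (p / x))) \<partial>haar) =
       (\<integral>\<^sup>+ z. ennreal (exp (- (a + q / a - 2 * sqrt q) * ?\<Lambda> z)) \<partial>?M)"
      by (simp add: b_def s_def)
  qed
qed

text \<open>Put y = p / x in the double integral for the product of c a and c (q / a). By
  \<open>hcm_conv_inner\<close> the integral over x at fixed p is a Laplace transform in a + q / a -
  2 sqrt q, and the remaining integral over p is a mixture.\<close>

lemma hcm_conv:
  assumes f: "hcm f" and g: "hcm g"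
    and [measurable]: "f \<in> borel_measurable borel" "g \<in> borel_measurable borel"
    and c0: "\<And>x. x > 0 \<Longrightarrow> 0 \<le> c x"
    and c: "\<And>x. x > 0 \<Longrightarrow> ennreal (c x) = (\<integral>\<^sup>+ y. ennreal (f (x * y) * g y) \<partial>haar)"
  shows "hcm c"
  unfolding hcm_def
proof (intro conjI allI impI)
  fix q :: real assume q: "q > 0"
  have f0: "0 \<le> f x" and g0: "0 \<le> g x" if "x > 0" for x using f g that by (auto simp: hcm_def)
  define I where "I a p = (\<integral>\<^sup>+ x. ennreal (f (a * x) * f (q / a * (p / x)) * (g x * g (p / x))) \<partial>haar)" for a p
  have [measurable]: "I a \<in> borel_measurable borel" for a
    unfolding I_def by measurable
  have cc: "ennreal (c a * c (q / a)) = (\<integral>\<^sup>+ p. I a p \<partial>haar)" if a: "a > 0" for a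
  proof -
    interpret hh: pair_sigma_finite haar haar ..
    define b where "b = q / a"
    have b: "b > 0" using a q by (simp add: b_def)
    have "ennreal (c a * c b) = (\<integral>\<^sup>+ x. ennreal (f (a * x) * g x) \<partial>haar) * ennreal (c b)"
      using c0 c a b by (simp add: ennreal_mult)
    also have "\<dots> = (\<integral>\<^sup>+ x. ennreal (f (a * x) * g x) * ennreal (c b) \<partial>haar)"
      by (rule nn_integral_multc[symmetric]) measurable
    also have "\<dots> = (\<integral>\<^sup>+ x. (\<integral>\<^sup>+ p. ennreal (f (a * x) * f (b * (p / x)) * (g x * g (p / x))) \<partial>haar) \<partial>haar)"
    proof (rule nn_integral_haar_cong)
      fix x :: real assume x: "x > 0"
      have "ennreal (c b) = (\<integral>\<^sup>+ p. ennreal (f (b * (1 / x * p)) * g (1 / x * p)) \<partial>haar)"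
        unfolding c[OF b] by (rule nn_integral_haar_scale[symmetric]) (use x in auto)
      then have "ennreal (f (a * x) * g x) * ennreal (c b) =
          (\<integral>\<^sup>+ p. ennreal (f (a * x) * g x) * ennreal (f (b * (1 / x * p)) * g (1 / x * p)) \<partial>haar)"
        by (simp add: nn_integral_cmult)
      also have "\<dots> = (\<integral>\<^sup>+ p. ennreal (f (a * x) * f (b * (p / x)) * (g x * g (p / x))) \<partial>haar)"
        by (rule nn_integral_haar_cong) (use a b x f0 g0 in \<open>auto simp: ennreal_mult[symmetric] mult_ac\<close>)
      finally show "ennreal (f (a * x) * g x) * ennreal (c b) = \<dots>" .
    qed
    also have "\<dots> = (\<integral>\<^sup>+ p. I a p \<partial>haar)"
      unfolding I_def b_def by (rule hh.Fubini'[symmetric]) measurable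
    finally show ?thesis by (simp add: b_def)
  qed
  \<comment> \<open>The larger root of a + q / a = t + 2 sqrt q. It picks a definite a for each
    value t \<ge> 0 of the shifted variable, through which alone the integrals depend on a.\<close>
  define A where "A t = ((t + 2 * sqrt q) + sqrt ((t + 2 * sqrt q)\<^sup>2 - 4 * q)) / 2" for t
  have A: "A t > 0" "A t + q / A t - 2 * sqrt q = t" if t: "t \<ge> 0" for t
  proof -
    let ?w = "t + 2 * sqrt q"
    have sq: "sqrt q > 0" "sqrt q * sqrt q = q" using q by auto
    have "?w\<^sup>2 - 4 * q = t\<^sup>2 + 4 * t * sqrt q" using sq(2) by (simp add: power2_eq_square algebra_simps)
    then have d: "?w\<^sup>2 - 4 * q \<ge> 0" using t sq by simp
    have "?w > 0" using t sq(1) by linarith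
    then show Ap: "A t > 0" using d by (simp add: A_def add_pos_nonneg)
    have "(2 * A t - ?w)\<^sup>2 = ?w\<^sup>2 - 4 * q"
    proof -
      have "2 * A t - ?w = sqrt (?w\<^sup>2 - 4 * q)" by (simp add: A_def field_simps)
      then show ?thesis using d by simp
    qed
    then have "A t * A t + q = ?w * A t" by (simp add: power2_eq_square algebra_simps)
    then show "A t + q / A t - 2 * sqrt q = t" using Ap by (simp add: field_simps)
  qed
  have inner: "\<exists>(M :: (real \<times> real \<times> real) measure) \<Lambda>. \<Lambda> \<in> borel_measurable M \<and> (AE z in M. 0 \<le> \<Lambda> z) \<and>
     (\<forall>a>0. I a p = (\<integral>\<^sup>+ z. ennreal (exp (- (a + q / a - 2 * sqrt q) * \<Lambda> z)) \<partial>M))" if "p > 0" for p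
    unfolding I_def
    by (rule hcm_conv_inner[OF f g that q]) (intro exI conjI allI impI, assumption+)
  have Ieq: "I a p = I (A (a + q / a - 2 * sqrt q)) p" if "a > 0" "p > 0" for a p
    using inner[OF that(2)] A[OF sum_ge_two_sqrt[OF q that(1)]] that(1) by force
  define H where "H t = c (A t) * c (q / A t)" for t
  define h where "h p t = enn2real (I (A t) p)" for p t
  have ccH: "c a * c (q / a) = H (a + q / a - 2 * sqrt q)" if a: "a > 0" for a
  proof -
    let ?t = "a + q / a - 2 * sqrt q"
    have At: "A ?t > 0" using A(1)[OF sum_ge_two_sqrt[OF q a]] .
    have "ennreal (c a * c (q / a)) = ennreal (H ?t)"
      unfolding H_def cc[OF a] cc[OF At] by (rule nn_integral_haar_cong) (rule Ieq[OF a])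
    then show ?thesis using c0 a At q by (subst (asm) ennreal_inj) (auto simp: H_def)
  qed
  have H0: "H t \<ge> 0" if "t \<ge> 0" for t using A[OF that] c0 q by (auto simp: H_def)
  \<comment> \<open>At t = 0 the inner integrals are largest, and their integral over p is a real
    number; so for almost every p they are finite at all t simultaneously and may be replaced by
    reals.\<close>
  have fin: "AE p in haar. p > 0 \<and> I (A 0) p < \<infinity>"
  proof -
    have "(\<integral>\<^sup>+ p. I (A 0) p \<partial>haar) \<noteq> \<infinity>" using cc[OF A(1)[OF order_refl]] by (metis ennreal_neq_top infinity_ennreal_def)
    from nn_integral_noteq_infinite[OF _ this] have "AE p in haar. I (A 0) p \<noteq> \<infinity>" by simp
    with AE_haar show ?thesis by eventually_elim (auto simp: less_top)
  qed
  have Ile: "I (A t) p \<le> I (A 0) p" if pt: "p > 0" "t \<ge> 0" for p t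
  proof -
    obtain M :: "(real \<times> real \<times> real) measure" and \<Lambda> where M: "AE z in M. 0 \<le> \<Lambda> z"
      "\<forall>a>0. I a p = (\<integral>\<^sup>+ z. ennreal (exp (- (a + q / a - 2 * sqrt q) * \<Lambda> z)) \<partial>M)"
      using inner[OF pt(1)] by blast
    have "I (A t) p = (\<integral>\<^sup>+ z. ennreal (exp (- t * \<Lambda> z)) \<partial>M)" "I (A 0) p = (\<integral>\<^sup>+ z. ennreal (exp (- 0 * \<Lambda> z)) \<partial>M)"
      using M(2)[rule_format, OF A(1)[OF pt(2)], unfolded A(2)[OF pt(2)]]
        M(2)[rule_format, OF A(1)[OF order_refl], unfolded A(2)[OF order_refl]] .
    then show ?thesis
      by (simp only:) (rule nn_integral_mono_AE, rule eventually_mono[OF M(1)], use pt in \<open>auto intro!: ennreal_leI\<close>)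
  qed
  have "laplace_fn H"
  proof (rule laplace_fn_mixture[where M = haar and h = h])
    show "AE p in haar. laplace_fn (h p)"
    proof (rule eventually_mono[OF fin])
      fix p assume p: "p > 0 \<and> I (A 0) p < \<infinity>"
      then obtain M :: "(real \<times> real \<times> real) measure" and \<Lambda> where M: "\<Lambda> \<in> borel_measurable M" "AE z in M. 0 \<le> \<Lambda> z"
        "\<forall>a>0. I a p = (\<integral>\<^sup>+ z. ennreal (exp (- (a + q / a - 2 * sqrt q) * \<Lambda> z)) \<partial>M)"
        using inner[of p] by blast
      show "laplace_fn (h p)"
      proof (rule laplace_fnI[OF M(1,2)])
        fix t :: real assume t: "t \<ge> 0"
        have "ennreal (h p t) = I (A t) p"
          using le_less_trans[OF Ile[OF conjunct1[OF p] t] conjunct2[OF p]] by (simp add: h_def)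
        then show "ennreal (h p t) = (\<integral>\<^sup>+ z. ennreal (exp (- t * \<Lambda> z)) \<partial>M)"
          using M(3)[rule_format, OF A(1)[OF t], unfolded A(2)[OF t]] by simp
      qed (simp add: h_def)
    qed
    fix t :: real assume t: "t \<ge> 0"
    show "0 \<le> H t" by (rule H0[OF t])
    have "ennreal (H t) = (\<integral>\<^sup>+ p. I (A t) p \<partial>haar)" unfolding H_def by (rule cc[OF A(1)[OF t]])
    also have "\<dots> = (\<integral>\<^sup>+ p. ennreal (h p t) \<partial>haar)"
      by (rule nn_integral_cong_AE, rule eventually_mono[OF fin])
        (use le_less_trans[OF Ile[OF _ t]] in \<open>auto simp: h_def\<close>)
    finally show "ennreal (H t) = (\<integral>\<^sup>+ p. ennreal (h p t) \<partial>haar)" .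
  qed (simp add: h_def)
  with ccH show "\<exists>h. laplace_fn h \<and> (\<forall>x>0. c x * c (q / x) = h (x + q / x - 2 * sqrt q))" by blast
qed (rule c0)

section \<open>Powers as integrals of logarithms, and generalized gamma densities\<close>

lemma nn_integral_ln_powr_finite:
  assumes r: "0 < r" "r < (1::real)"
  shows "(\<integral>\<^sup>+ t. ennreal (t powr r * ln (1 + 1 / t)) \<partial>haar) < \<infinity>"
proof -
  \<comment> \<open>Any exponent strictly between 0 and r would do: near 0 the logarithm is at most
    a multiple of t powr (- \<open>?b\<close>), which leaves the integrable t powr (r / 2 -
    1).\<close>
  let ?b = "r / 2"
  have 1: "(\<integral>\<^sup>+ t. ennreal (indicator {0..1} t * t powr (r / 2 - 1)) \<partial>lborel) < \<infinity>"
    using nn_integral_has_integral_lebesgue[OF _ has_integral_powr_from_0[of "r / 2 - 1" 1], unfolded nn_integral_completion] r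
    by simp
  have 2: "(\<integral>\<^sup>+ t. ennreal (indicator {1..} t * t powr (r - 2)) \<partial>lborel) < \<infinity>"
    using nn_integral_has_integral_lebesgue[OF _ has_integral_powr_to_inf[of "r - 2" 1], unfolded nn_integral_completion] r
    by simp
  have "(\<integral>\<^sup>+ t. ennreal (t powr r * ln (1 + 1 / t)) \<partial>haar)
     \<le> (\<integral>\<^sup>+ t. ennreal (2 powr ?b / ?b) * ennreal (indicator {0..1} t * t powr (r / 2 - 1)) + ennreal (indicator {1..} t * t powr (r - 2)) \<partial>lborel)"
    unfolding haar_def
  proof (subst nn_integral_density, simp, simp, rule nn_integral_mono)
    fix t :: real
    show "ennreal (indicat_real {0<..} t / t) * ennreal (t powr r * ln (1 + 1 / t))
       \<le> ennreal (2 powr ?b / ?b) * ennreal (indicator {0..1} t * t powr (r / 2 - 1)) + ennreal (indicator {1..} t * t powr (r - 2))"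
    proof (cases "t > 0")
      case t: True
      have e: "ennreal (indicat_real {0<..} t / t) * ennreal (t powr r * ln (1 + 1 / t)) = ennreal (t powr (r - 1) * ln (1 + 1 / t))"
        using t by (simp add: ennreal_mult[symmetric] powr_diff)
      show ?thesis
      proof (cases "t \<le> 1")
        case True
        have "ln (1 + 1 / t) \<le> (1 + 1 / t) powr ?b / ?b" using t r by (intro ln_powr_bound) auto
        also have "\<dots> \<le> (2 / t) powr ?b / ?b"
          using t r True by (intro divide_right_mono powr_mono2) (auto simp: field_simps)
        also have "\<dots> = 2 powr ?b / ?b * t powr (- ?b)" using t by (simp add: powr_divide powr_minus field_simps)
        finally have "t powr (r - 1) * ln (1 + 1 / t) \<le> t powr (r - 1) * (2 powr ?b / ?b * t powr (- ?b))"
          by (rule mult_left_mono) simp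
        also have "\<dots> = 2 powr ?b / ?b * t powr (r / 2 - 1)"
          using t by (simp add: powr_add[symmetric])
        finally have "ennreal (t powr (r - 1) * ln (1 + 1 / t)) \<le> ennreal (2 powr ?b / ?b * t powr (r / 2 - 1))"
          by (rule ennreal_leI)
        also have "\<dots> = ennreal (2 powr ?b / ?b) * ennreal (indicator {0..1} t * t powr (r / 2 - 1))"
          using True t r by (subst ennreal_mult[symmetric]) auto
        finally show ?thesis unfolding e by (rule order_trans) simp
      next
        case False
        have "ln (1 + 1 / t) \<le> 1 / t" using t by (intro ln_add_one_self_le_self) auto
        then have "t powr (r - 1) * ln (1 + 1 / t) \<le> t powr (r - 1) * (1 / t)" by (rule mult_left_mono) simp
        also have "\<dots> = t powr (r - 2)" using t by (simp add: powr_diff power2_eq_square)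
        finally have "ennreal (t powr (r - 1) * ln (1 + 1 / t)) \<le> ennreal (indicator {1..} t * t powr (r - 2))"
          using False by (intro ennreal_leI) simp
        then show ?thesis unfolding e by (rule order_trans) simp
      qed
    qed simp
  qed
  also have "\<dots> = ennreal (2 powr ?b / ?b) * (\<integral>\<^sup>+ t. ennreal (indicator {0..1} t * t powr (r / 2 - 1)) \<partial>lborel)
      + (\<integral>\<^sup>+ t. ennreal (indicator {1..} t * t powr (r - 2)) \<partial>lborel)"
    by (subst nn_integral_add) (auto simp: nn_integral_cmult)
  also have "\<dots> < \<infinity>" using 1 2 by (auto simp: ennreal_mult_less_top)
  finally show ?thesis .
qed

text \<open>Under t -> x t the integral of ln (1 + x / t) t powr r dt/t scales as x powr r, so M is
  t powr r dt/t up to a factor. The constant C enters only through 0 < C < \<infinity>, since the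
  density is divided by it.\<close>

lemma powr_log_representation:
  assumes r: "0 < r" "r < (1::real)" and c: "c > 0"
  shows "\<exists>M :: real measure. sets M = sets borel \<and>
    (\<forall>x\<ge>0. integrable M (\<lambda>t. if t > 0 then ln (1 + x / t) else 0) \<and>
      (\<integral>t. (if t > 0 then ln (1 + x / t) else 0) \<partial>M) = c * x powr r)"
proof -
  define C where "C = enn2real (\<integral>\<^sup>+ t. ennreal (t powr r * ln (1 + 1 / t)) \<partial>haar)"
  have C: "(\<integral>\<^sup>+ t. ennreal (t powr r * ln (1 + 1 / t)) \<partial>haar) = ennreal C"
    using nn_integral_ln_powr_finite[OF r] by (simp add: C_def less_top)
  have "C \<noteq> 0"
  proof
    assume "C = 0"
    with C have "AE t in haar. ennreal (t powr r * ln (1 + 1 / t)) = 0" by (simp add: nn_integral_0_iff_AE)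
    with AE_haar have "AE t in haar. False"
    proof eventually_elim
      case (elim t)
      then have "ln (1 + 1 / t) > 0" by (intro ln_gt_zero) auto
      with elim show ?case by (auto simp: ennreal_eq_0_iff mult_le_0_iff)
    qed
    then have "(\<integral>\<^sup>+ x. ennreal 1 \<partial>haar) = (\<integral>\<^sup>+ x. 0 \<partial>haar)" by (intro nn_integral_cong_AE) auto
    then show False using nn_integral_haar_const[of 1] by simp
  qed
  then have Cp: "C > 0" by (simp add: C_def less_le)
  define M where "M = density haar (\<lambda>t. ennreal (c / C * t powr r))"
  have sM: "sets M = sets borel" by (simp add: M_def)
  let ?F = "\<lambda>x t. if t > 0 then ln (1 + x / t) else 0 :: real"
  have F0: "0 \<le> ?F x t" if "x \<ge> 0" for x t using that by auto
  have nn: "(\<integral>\<^sup>+ t. ennreal (?F x t) \<partial>M) = ennreal (c * x powr r)" if x: "x \<ge> 0" for x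
  proof (cases "x = 0")
    case True
    have "(\<integral>\<^sup>+ t. ennreal (?F x t) \<partial>M) = (\<integral>\<^sup>+ t. 0 \<partial>M)"
      unfolding True by (intro nn_integral_cong) auto
    then show ?thesis using True by simp
  next
    case False
    with x have x: "x > 0" by simp
    have "(\<integral>\<^sup>+ t. ennreal (?F x t) \<partial>M) = (\<integral>\<^sup>+ t. ennreal (c / C * t powr r) * ennreal (?F x t) \<partial>haar)"
      unfolding M_def by (rule nn_integral_density) auto
    also have "\<dots> = (\<integral>\<^sup>+ t. ennreal (c / C * (x * t) powr r) * ennreal (?F x (x * t)) \<partial>haar)"
      by (rule nn_integral_haar_scale[symmetric, OF _ x]) auto
    also have "\<dots> = (\<integral>\<^sup>+ t. ennreal (c / C * x powr r) * ennreal (t powr r * ln (1 + 1 / t)) \<partial>haar)"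
      by (rule nn_integral_haar_cong) (use x c Cp in \<open>auto simp: ennreal_mult[symmetric] powr_mult\<close>)
    also have "\<dots> = ennreal (c / C * x powr r) * ennreal C"
      by (subst nn_integral_cmult) (auto simp: C)
    also have "\<dots> = ennreal (c * x powr r)"
      using c Cp by (simp add: ennreal_mult[symmetric])
    finally show ?thesis .
  qed
  show ?thesis
  proof (intro exI[of _ M] conjI allI impI sM)
    fix x :: real assume x: "x \<ge> 0"
    have mF: "?F x \<in> borel_measurable M" by (simp add: M_def)
    show "integrable M (?F x)"
      by (rule integrableI_nonneg[OF mF]) (use F0[OF x] nn[OF x] in auto)
    show "(\<integral>t. ?F x t \<partial>M) = c * x powr r"
      by (subst integral_eq_nn_integral[OF mF]) (use F0[OF x] nn[OF x] c in auto)
  qed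
qed

text \<open>For r < 1 the exponent is an integral of logarithms, and (1 + x / t) (1 + p / (x t)) is
  affine in s = x + p / x - 2 sqrt p. Factoring out its value (1 + sqrt p / t)^2 at s = 0 leaves 1 +
  s \<kappa> t, so the product is a constant times the transform of a generalized gamma convolution
  in s. For r = 1 the exponent itself is affine in s.\<close>

lemma hcm_exp_powr_pos:
  assumes r: "0 < r" "r \<le> 1" and c: "c > 0"
  shows "hcm (\<lambda>x. exp (- c * x powr r))"
  unfolding hcm_def
proof (intro conjI allI impI)
  fix p :: real assume p: "p > 0"
  show "\<exists>h. laplace_fn h \<and> (\<forall>x>0. exp (- c * x powr r) * exp (- c * (p / x) powr r) = h (x + p / x - 2 * sqrt p))"
  proof (cases "r = 1")
    case True
    have "laplace_fn (\<lambda>s. exp (- c * (2 * sqrt p)) * exp (- c * s))"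
      by (intro laplace_fn_cmult laplace_fn_exp) (use c in auto)
    then show ?thesis using True p
      by (intro exI[of _ "\<lambda>s. exp (- c * (2 * sqrt p)) * exp (- c * s)"])
        (auto simp: exp_add[symmetric] algebra_simps)
  next
    case False
    with r have r: "0 < r" "r < 1" by auto
    obtain M :: "real measure" where [measurable_cong]: "sets M = sets borel"
      and int: "\<And>x. x \<ge> 0 \<Longrightarrow> integrable M (\<lambda>t. if t > 0 then ln (1 + x / t) else 0)"
      and eq: "\<And>x. x \<ge> 0 \<Longrightarrow> (\<integral>t. (if t > 0 then ln (1 + x / t) else 0) \<partial>M) = c * x powr r"
      using powr_log_representation[OF r c] by auto
    define \<kappa> where "\<kappa> t = (if t > 0 then (1 / t) / (1 + sqrt p / t)\<^sup>2 else 0)" for t :: real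
    have [measurable]: "\<kappa> \<in> borel_measurable borel" unfolding \<kappa>_def[abs_def] by measurable
    have \<kappa>0: "0 \<le> \<kappa> t" for t by (simp add: \<kappa>_def)
    have \<kappa>1: "\<kappa> t \<le> 1 / t" if "t > 0" for t
    proof -
      have "1 \<le> (1 + sqrt p / t)\<^sup>2" using that p by (intro one_le_power) auto
      then have "(1 / t) / (1 + sqrt p / t)\<^sup>2 \<le> (1 / t) / 1" using that by (intro divide_left_mono) auto
      then show ?thesis using that by (simp add: \<kappa>_def)
    qed
    have int\<kappa>: "integrable M (\<lambda>t. ln (1 + s * \<kappa> t))" if s: "s \<ge> 0" for s
    proof (rule Bochner_Integration.integrable_bound[OF int[OF s]])
      show "AE t in M. norm (ln (1 + s * \<kappa> t)) \<le> norm (if t > 0 then ln (1 + s / t) else 0)"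
      proof (rule AE_I2)
        fix t
        show "norm (ln (1 + s * \<kappa> t)) \<le> norm (if t > 0 then ln (1 + s / t) else 0)"
        proof (cases "t > 0")
          case True
          have "s * \<kappa> t \<le> s / t" using mult_left_mono[OF \<kappa>1[OF True] s] by simp
          moreover have "s * \<kappa> t \<ge> 0" using s \<kappa>0 by simp
          ultimately show ?thesis using True by simp
        qed (simp add: \<kappa>_def)
      qed
    qed simp
    define h where "h s = exp (- 2 * c * sqrt p powr r) * exp (- (\<integral>t. ln (1 + s * \<kappa> t) \<partial>M))" for s
    have "laplace_fn h" unfolding h_def
      by (intro laplace_fn_cmult laplace_fn_thorin int\<kappa> \<kappa>0) auto
    moreover have "exp (- c * x powr r) * exp (- c * (p / x) powr r) = h (x + p / x - 2 * sqrt p)" if x: "x > 0" for x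
    proof -
      let ?s = "x + p / x - 2 * sqrt p" and ?F = "\<lambda>x t. if t > 0 then ln (1 + x / t) else 0 :: real"
      have s: "?s \<ge> 0" by (rule sum_ge_two_sqrt[OF p x])
      have pt: "?F x t + ?F (p / x) t = 2 * ?F (sqrt p) t + ln (1 + ?s * \<kappa> t)" for t
      proof (cases "t > 0")
        case True
        have pos: "1 + x / t > 0" "1 + p / x / t > 0" "1 + sqrt p / t > 0" "1 + ?s * \<kappa> t > 0"
          using True x p s \<kappa>0[of t] by (auto intro!: add_pos_nonneg)
        have "(1 + sqrt p / t)\<^sup>2 * (1 + ?s * \<kappa> t) = (1 + sqrt p / t)\<^sup>2 + ?s * (1 / t)"
          using pos(3) True by (simp add: \<kappa>_def distrib_left)
        also have "\<dots> = (1 + x / t) * (1 + p / x / t)"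
          using True x p by (simp add: power2_eq_square field_simps)
        finally have "ln ((1 + x / t) * (1 + p / x / t)) = ln ((1 + sqrt p / t)\<^sup>2 * (1 + ?s * \<kappa> t))" by simp
        then show ?thesis using True pos by (simp add: ln_mult ln_realpow)
      qed (simp add: \<kappa>_def)
      have "c * x powr r + c * (p / x) powr r = (\<integral>t. ?F x t + ?F (p / x) t \<partial>M)"
        using x p by (subst Bochner_Integration.integral_add[OF int int]) (auto simp: eq)
      also have "\<dots> = 2 * (\<integral>t. ?F (sqrt p) t \<partial>M) + (\<integral>t. ln (1 + ?s * \<kappa> t) \<partial>M)"
        unfolding pt using p
        by (subst Bochner_Integration.integral_add[OF _ int\<kappa>[OF s]])
          (auto intro!: integrable_mult_right int simp del: integrable_mult_right_iff)
      finally have "c * x powr r + c * (p / x) powr r = 2 * c * sqrt p powr r + (\<integral>t. ln (1 + ?s * \<kappa> t) \<partial>M)"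
        using p by (simp add: eq)
      then show ?thesis by (simp add: h_def exp_add[symmetric])
    qed
    ultimately show ?thesis by blast
  qed
qed simp

lemma hcm_exp_powr:
  assumes r: "0 < \<bar>r\<bar>" "\<bar>r\<bar> \<le> 1" and c: "c > 0"
  shows "hcm (\<lambda>x. exp (- c * x powr r))"
proof (cases "r > 0")
  case True
  with r c show ?thesis by (intro hcm_exp_powr_pos) auto
next
  case False
  with r have "hcm (\<lambda>x. exp (- c * (1 / x) powr (- r)))" (is "hcm ?f")
    by (intro hcm_inverse[OF hcm_exp_powr_pos] c) auto
  moreover have "?f x = exp (- c * x powr r)" if "x > 0" for x :: real
    using that by (simp add: powr_divide powr_minus)
  ultimately show ?thesis by (rule hcm_cong)
qed

lemma hcm_gen_gamma_density:
  assumes r: "0 < \<bar>r\<bar>" "\<bar>r\<bar> \<le> 1" and "c2 > 0" "c1 > 0"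
  shows "hcm (\<lambda>x. c1 * x powr a * exp (- c2 * x powr r))"
  using assms by (intro hcm_powr_mult hcm_exp_powr) auto

section \<open>Functions preserving the upper half-plane\<close>

lemma Re_of_real_mult: "Re (of_real r * z) = r * Re z"
  by simp

lemma typically_real_kernel_pos:
  assumes "-1 < \<zeta>" "\<zeta> < (1::real)" "-1 \<le> c" "c \<le> 1"
  shows "1 - 2 * \<zeta> * c + \<zeta>\<^sup>2 > 0"
proof -
  have "\<bar>\<zeta> * c\<bar> \<le> \<bar>\<zeta>\<bar>" using assms by (simp add: abs_mult mult_left_le)
  then have "1 - 2 * \<zeta> * c + \<zeta>\<^sup>2 \<ge> (1 - \<bar>\<zeta>\<bar>)\<^sup>2" by (simp add: power2_eq_square algebra_simps abs_le_iff)
  moreover have "(1 - \<bar>\<zeta>\<bar>)\<^sup>2 > 0" using assms by simp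
  ultimately show ?thesis by linarith
qed

text \<open>Cauchy's formula at \<open>\<zeta>\<close> for \<open>P z (1 - \<zeta>\<^sup>2) / (1 - \<zeta> z)\<close> with \<open>P z = (1 - z\<^sup>2) F (\<rho> z) / z\<close>: on the unit
  circle \<open>P (cis t) = - 2 \<i> sin t F (\<rho> cis t)\<close>, and the other factors combine to the Poisson kernel.\<close>

lemma typically_real_poisson:
  assumes F: "F holomorphic_on ball 0 1" and F0: "F 0 = 0"
    and \<rho>: "0 < \<rho>" "\<rho> < 1" and \<zeta>: "-1 < \<zeta>" "\<zeta> < (1::real)"
  shows "((\<lambda>t. 2 * sin (2 * pi * t) * Im (F (of_real \<rho> * exp (2 * of_real pi * \<i> * of_real t))) /
      (1 - 2 * \<zeta> * cos (2 * pi * t) + \<zeta>\<^sup>2)) has_integral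
    Re (if \<zeta> = 0 then of_real \<rho> * deriv F 0 else F (of_real (\<rho> * \<zeta>)) / of_real \<zeta>)) {0..1}"
proof -
  \<comment> \<open>The singularity of F (\<rho> z) / z at 0 is removable as F 0 = 0, with the
    derivative as value. Since \<rho> < 1, Q is holomorphic beyond the closed unit disc, so that
    Cauchy's formula may be used on the unit circle.\<close>
  define Q where "Q z = (if z = 0 then of_real \<rho> * deriv F 0 else F (of_real \<rho> * z) / z)" for z
  define R where "R = ball (0::complex) (1 / \<rho>)"
  have sub: "of_real \<rho> * z \<in> ball 0 1" if "z \<in> R" for z
    using that \<rho> by (simp add: R_def norm_mult field_simps)
  have FR: "(\<lambda>z. F (of_real \<rho> * z)) holomorphic_on R"
    by (rule holomorphic_on_compose_gen[OF _ F, unfolded o_def]) (use sub in \<open>auto intro!: holomorphic_intros\<close>)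
  have d0: "deriv (\<lambda>z. F (of_real \<rho> * z)) 0 = of_real \<rho> * deriv F 0"
  proof (rule DERIV_imp_deriv)
    have "(F has_field_derivative deriv F 0) (at (of_real \<rho> * 0))"
      using holomorphic_derivI[OF F open_ball, of 0] by simp
    moreover have "((\<lambda>z. of_real \<rho> * z) has_field_derivative of_real \<rho>) (at (0 :: complex))"
      by (auto intro!: derivative_eq_intros)
    ultimately have "((\<lambda>z. F (of_real \<rho> * z)) has_field_derivative deriv F 0 * of_real \<rho>) (at 0)"
      by (rule DERIV_chain2[where f = F])
    then show "((\<lambda>z. F (of_real \<rho> * z)) has_field_derivative of_real \<rho> * deriv F 0) (at 0)"
      by (simp only: mult.commute)
  qed
  have Qhol: "Q holomorphic_on R"
  proof -
    have "(\<lambda>z. if z = 0 then deriv (\<lambda>z. F (of_real \<rho> * z)) 0 else (F (of_real \<rho> * z) - F (of_real \<rho> * 0)) / (z - 0)) holomorphic_on R"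
      using pole_lemma_open[OF FR, of 0] by (simp add: R_def)
    moreover have "Q = (\<lambda>z. if z = 0 then deriv (\<lambda>z. F (of_real \<rho> * z)) 0 else (F (of_real \<rho> * z) - F (of_real \<rho> * 0)) / (z - 0))"
      unfolding d0 by (simp add: fun_eq_iff Q_def F0)
    ultimately show ?thesis by metis
  qed
  have "1 < 1 / \<rho>" using \<rho> by simp
  then have cb: "cball 0 1 \<subseteq> R" unfolding R_def by (intro cball_subset_ball_iff[THEN iffD2] disjI1) auto
  define G where "G z = Q z * (1 - z\<^sup>2) * (1 - (of_real \<zeta>)\<^sup>2) / (1 - of_real \<zeta> * z)" for z
  have nz: "1 - of_real \<zeta> * z \<noteq> 0" if "z \<in> cball 0 1" for z :: complex
  proof
    assume "1 - of_real \<zeta> * z = 0"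
    then have "norm (of_real \<zeta> * z) = 1" by (metis norm_one right_minus_eq)
    moreover have "norm (of_real \<zeta> * z) \<le> \<bar>\<zeta>\<bar> * 1" unfolding norm_mult norm_of_real
      using that by (intro mult_left_mono) auto
    ultimately show False using \<zeta> by auto
  qed
  have Ghol: "G holomorphic_on cball 0 1"
    unfolding G_def[abs_def] using nz
    by (intro holomorphic_intros holomorphic_on_subset[OF Qhol cb]) auto
  have zn: "norm (of_real \<zeta> - 0 :: complex) < 1" using \<zeta> by auto
  let ?e = "\<lambda>t. exp (2 * of_real pi * \<i> * of_real t)"
  have den: "1 - 2 * \<zeta> * cos x + \<zeta>\<^sup>2 > 0" for x
    by (rule typically_real_kernel_pos[OF \<zeta> cos_ge_minus_one cos_le_one])
  have ce: "circlepath 0 1 t = ?e t" for t by (simp add: circlepath)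
  have "((\<lambda>u. G u / (u - of_real \<zeta>)) has_contour_integral (2 * of_real pi * \<i> * G (of_real \<zeta>))) (circlepath 0 1)"
    by (rule Cauchy_integral_circlepath_simple[OF Ghol zn])
  then have "((\<lambda>t. G (?e t) / (?e t - of_real \<zeta>) * (2 * of_real pi * \<i> * ?e t)) has_integral
      (2 * of_real pi * \<i> * G (of_real \<zeta>))) {0..1}"
    unfolding has_contour_integral_def
    by (rule has_integral_eq[rotated]) (simp add: vector_derivative_circlepath01 ce)
  from has_integral_mult_right[OF this, of "1 / (2 * of_real pi * \<i>)"]
  have "((\<lambda>t. G (?e t) / (?e t - of_real \<zeta>) * ?e t) has_integral G (of_real \<zeta>)) {0..1}"
    by (simp add: field_simps)
  from has_integral_linear[OF this bounded_linear_Re]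
  have I: "((\<lambda>t. Re (G (?e t) / (?e t - of_real \<zeta>) * ?e t)) has_integral Re (G (of_real \<zeta>))) {0..1}"
    by (simp add: o_def)
  have pt: "Re (G (?e t) / (?e t - of_real \<zeta>) * ?e t) =
    (1 - \<zeta>\<^sup>2) * (2 * sin (2 * pi * t) * Im (F (of_real \<rho> * ?e t)) / (1 - 2 * \<zeta> * cos (2 * pi * t) + \<zeta>\<^sup>2))" for t
  proof -
    define z where "z = ?e t"
    let ?x = "2 * pi * t"
    let ?D = "1 - 2 * \<zeta> * cos ?x + \<zeta>\<^sup>2"
    have zc: "z = cis ?x" by (simp add: z_def cis_conv_exp mult_ac)
    have z1: "norm z = 1" "z \<noteq> 0" by (auto simp: zc)
    have zz: "z * cnj z = 1" by (simp add: zc cis_cnj cis_mult)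
    \<comment> \<open>On the unit circle z - \<zeta> = z (1 - \<zeta> cnj z), so the denominators of
      Cauchy's formula and of G multiply to z times the squared modulus of 1 - \<zeta> z, the
      denominator of the Poisson kernel.\<close>
    have D: "(z - of_real \<zeta>) * (1 - of_real \<zeta> * z) = z * of_real ?D"
    proof -
      have "(z - of_real \<zeta>) * (1 - of_real \<zeta> * z) = z * ((1 - of_real \<zeta> * cnj z) * (1 - of_real \<zeta> * z))"
      proof -
        have "z * ((1 - of_real \<zeta> * cnj z) * (1 - of_real \<zeta> * z)) = (z - of_real \<zeta> * (z * cnj z)) * (1 - of_real \<zeta> * z)"
          by (simp add: algebra_simps)
        then show ?thesis unfolding zz mult_1_right by (rule sym)
      qed
      also have "(1 - of_real \<zeta> * cnj z) * (1 - of_real \<zeta> * z) = 1 - of_real \<zeta> * (z + cnj z) + (of_real \<zeta>)\<^sup>2 * (z * cnj z)"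
        by (simp add: algebra_simps power2_eq_square)
      also have "\<dots> = of_real ?D"
        unfolding zz complex_add_cnj by (simp add: zc)
      finally show ?thesis .
    qed
    have Dnz: "?D \<noteq> 0" using den[of ?x] by simp
    have nz1: "1 - of_real \<zeta> * z \<noteq> 0" using nz z1 by simp
    have "z * of_real ?D \<noteq> 0" using Dnz z1 by (simp only: mult_eq_0_iff of_real_eq_0_iff) simp
    then have nz2: "z - of_real \<zeta> \<noteq> 0" using D by (metis mult_zero_left)
    have "Q z * (1 - z\<^sup>2) = F (of_real \<rho> * z) * (cnj z - z)"
    proof -
      have "z * Q z = F (of_real \<rho> * z)" using z1 by (simp add: Q_def)
      then have "F (of_real \<rho> * z) * (cnj z - z) = Q z * (z * cnj z - z * z)" by (simp add: algebra_simps)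
      then show ?thesis by (simp add: zz power2_eq_square)
    qed
    also have "cnj z - z = - 2 * \<i> * sin ?x" by (simp add: zc complex_eq_iff)
    finally have Qe: "Q z * (1 - z\<^sup>2) = - 2 * \<i> * sin ?x * F (of_real \<rho> * z)" by (simp add: mult_ac)
    have "G z / (z - of_real \<zeta>) * z = Q z * (1 - z\<^sup>2) * (1 - (of_real \<zeta>)\<^sup>2) * z / ((z - of_real \<zeta>) * (1 - of_real \<zeta> * z))"
      using nz1 nz2 by (simp add: G_def)
    also have "\<dots> = (- 2 * \<i> * sin ?x * F (of_real \<rho> * z)) * (1 - (of_real \<zeta>)\<^sup>2) / of_real ?D"
      unfolding D Qe using z1 by simp
    also have "\<dots> = of_real ((1 - \<zeta>\<^sup>2) * (2 * sin ?x) / ?D) * (- \<i> * F (of_real \<rho> * z))"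
      by simp
    also have "Re \<dots> = (1 - \<zeta>\<^sup>2) * (2 * sin ?x) / ?D * Im (F (of_real \<rho> * z))"
      unfolding Re_of_real_mult by simp
    finally show ?thesis unfolding z_def by simp
  qed
  have zpos: "1 - \<zeta>\<^sup>2 > 0" using \<zeta> by (simp add: abs_square_less_1 abs_less_iff)
  have "Re (G (of_real \<zeta>)) = (1 - \<zeta>\<^sup>2) * Re (Q (of_real \<zeta>))"
  proof -
    have "1 - (of_real \<zeta>)\<^sup>2 \<noteq> (0::complex)" using zpos by (metis less_irrefl of_real_1 of_real_diff of_real_eq_0_iff of_real_power)
    then have "G (of_real \<zeta>) = of_real (1 - \<zeta>\<^sup>2) * Q (of_real \<zeta>)"
      by (simp add: G_def power2_eq_square mult_ac)
    then show ?thesis by simp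
  qed
  with I pt have "((\<lambda>t. (1 - \<zeta>\<^sup>2) * (2 * sin (2 * pi * t) * Im (F (of_real \<rho> * ?e t)) / (1 - 2 * \<zeta> * cos (2 * pi * t) + \<zeta>\<^sup>2))) has_integral (1 - \<zeta>\<^sup>2) * Re (Q (of_real \<zeta>))) {0..1}"
    by simp
  from has_integral_mult_right[OF this, of "1 / (1 - \<zeta>\<^sup>2)"]
  have R: "((\<lambda>t. 2 * sin (2 * pi * t) * Im (F (of_real \<rho> * ?e t)) / (1 - 2 * \<zeta> * cos (2 * pi * t) + \<zeta>\<^sup>2)) has_integral Re (Q (of_real \<zeta>))) {0..1}"
    using zpos by simp
  have "Q (of_real \<zeta>) = (if \<zeta> = 0 then of_real \<rho> * deriv F 0 else F (of_real (\<rho> * \<zeta>)) / of_real \<zeta>)"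
    by (simp add: Q_def)
  with R show ?thesis by (simp only:)
qed

text \<open>Since Im F has the sign of Im z, the densities sin t Im F (\<rho> cis t) of
  \<open>typically_real_poisson\<close> are nonnegative, and \<zeta> = 0 shows that their mass is
  \<rho> F'(0), up to a fixed factor. Normalised and pushed forward under cos they are probability
  measures on [-1, 1], and Helly provides a limit as \<rho> tends to 1.\<close>

lemma typically_real_representation:
  assumes F: "F holomorphic_on ball 0 1" and F0: "F 0 = 0"
    and real: "\<And>x :: real. \<bar>x\<bar> < 1 \<Longrightarrow> F (of_real x) = of_real (Re (F (of_real x)))"
    and up: "\<And>z. norm z < 1 \<Longrightarrow> Im z > 0 \<Longrightarrow> Im (F z) \<ge> 0"
    and dn: "\<And>z. norm z < 1 \<Longrightarrow> Im z < 0 \<Longrightarrow> Im (F z) \<le> 0"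
  obtains m \<tau> where "m \<ge> (0::real)" "real_distribution \<tau>" "AE c in \<tau>. c \<in> {-1..1}"
    "\<And>\<zeta>. -1 < \<zeta> \<Longrightarrow> \<zeta> < 1 \<Longrightarrow> Re (F (of_real \<zeta>)) = m * (\<integral>c. \<zeta> / (1 - 2 * \<zeta> * c + \<zeta>\<^sup>2) \<partial>\<tau>)"
proof -
  let ?e = "\<lambda>t. exp (2 * of_real pi * \<i> * of_real t) :: complex"
  define \<rho> where "\<rho> n = 1 - 1 / (real n + 2)" for n :: nat
  have \<rho>: "0 < \<rho> n" "\<rho> n < 1" for n by (auto simp: \<rho>_def)
  have \<rho>lim: "\<rho> \<longlonglongrightarrow> 1" unfolding \<rho>_def by real_asymp
  define w where "w n t = 2 * sin (2 * pi * t) * Im (F (of_real (\<rho> n) * ?e t))" for n t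
  define D where "D = Re (deriv F 0)"
  define q where "q n \<zeta> = (if \<zeta> = 0 then \<rho> n * D else Re (F (of_real (\<rho> n * \<zeta>))) / \<zeta>)" for n \<zeta>
  have ec: "?e t = cis (2 * pi * t)" for t by (simp add: cis_conv_exp mult_ac)
  have inball: "of_real (\<rho> n) * ?e t \<in> ball 0 1" for n t
    using \<rho>[of n] by (simp add: ec norm_mult)
  have w0: "w n t \<ge> 0" for n t
  proof -
    let ?z = "of_real (\<rho> n) * ?e t"
    have im: "Im ?z = \<rho> n * sin (2 * pi * t)" by (simp add: ec)
    have nz: "norm ?z < 1" using inball[of n t] by simp
    consider "sin (2 * pi * t) > 0" | "sin (2 * pi * t) = 0" | "sin (2 * pi * t) < 0" by linarith
    then show ?thesis
    proof cases
      case 1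
      then have "Im (F ?z) \<ge> 0" using up[OF nz] \<rho>[of n] im by simp
      then show ?thesis using 1 by (simp add: w_def)
    next
      case 3
      then have "Im (F ?z) \<le> 0" using dn[OF nz] \<rho>[of n] im by (simp add: mult_pos_neg)
      then show ?thesis using 3 by (simp add: w_def mult_nonpos_nonpos mult_neg_pos)
    qed (simp add: w_def)
  qed
  have wcont: "continuous_on UNIV (w n)" for n
  proof -
    have "continuous_on UNIV (\<lambda>t. F (of_real (\<rho> n) * ?e t))"
      by (rule continuous_on_compose2[OF holomorphic_on_imp_continuous_on[OF F]])
        (use inball in \<open>auto intro!: continuous_intros\<close>)
    then show ?thesis unfolding w_def[abs_def] by (intro continuous_intros) auto
  qed
  then have [measurable]: "w n \<in> borel_measurable borel" for n by (rule borel_measurable_continuous_onI)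
  have poisson: "((\<lambda>t. w n t / (1 - 2 * \<zeta> * cos (2 * pi * t) + \<zeta>\<^sup>2)) has_integral q n \<zeta>) {0..1}"
    if "-1 < \<zeta>" "\<zeta> < 1" for n \<zeta>
    using typically_real_poisson[OF F F0 \<rho>[of n] that]
    by (cases "\<zeta> = 0") (simp_all add: w_def q_def D_def)
  have nnp: "(\<integral>\<^sup>+ t. ennreal (indicator {0..1} t * (w n t / (1 - 2 * \<zeta> * cos (2 * pi * t) + \<zeta>\<^sup>2))) \<partial>lborel) = ennreal (q n \<zeta>)"
    and q0: "q n \<zeta> \<ge> 0"
    if "-1 < \<zeta>" "\<zeta> < 1" for n \<zeta>
  proof -
    have 0: "0 \<le> w n t / (1 - 2 * \<zeta> * cos (2 * pi * t) + \<zeta>\<^sup>2)" for t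
      using w0[of n t] typically_real_kernel_pos[OF that, of "cos (2 * pi * t)"] by simp
    show "(\<integral>\<^sup>+ t. ennreal (indicator {0..1} t * (w n t / (1 - 2 * \<zeta> * cos (2 * pi * t) + \<zeta>\<^sup>2))) \<partial>lborel) = ennreal (q n \<zeta>)"
      by (rule nn_integral_has_integral_lebesgue[OF 0 poisson[OF that], unfolded nn_integral_completion])
    show "q n \<zeta> \<ge> 0" by (rule has_integral_nonneg[OF poisson[OF that]]) (rule 0)
  qed
  have D0: "D \<ge> 0" using q0[of 0 0] \<rho>[of 0] by (simp add: q_def zero_le_mult_iff)
  have qlim: "(\<lambda>n. q n \<zeta>) \<longlonglongrightarrow> Re (F (of_real \<zeta>)) / \<zeta>" if "-1 < \<zeta>" "\<zeta> < 1" "\<zeta> \<noteq> 0" for \<zeta>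
  proof -
    have "(\<lambda>n. of_real (\<rho> n * \<zeta>) :: complex) \<longlonglongrightarrow> of_real (1 * \<zeta>)"
      by (intro tendsto_intros \<rho>lim)
    moreover have "\<rho> n * \<bar>\<zeta>\<bar> < 1" for n
    proof -
      have "\<rho> n * \<bar>\<zeta>\<bar> \<le> 1 * \<bar>\<zeta>\<bar>" using \<rho>[of n] by (intro mult_right_mono) auto
      also have "\<dots> < 1" using that by auto
      finally show ?thesis .
    qed
    ultimately have "(\<lambda>n. F (of_real (\<rho> n * \<zeta>))) \<longlonglongrightarrow> F (of_real \<zeta>)"
      using that by (intro continuous_on_tendsto_compose[OF holomorphic_on_imp_continuous_on[OF F]])
        (use \<rho> in \<open>auto simp: norm_mult abs_mult abs_of_pos intro!: always_eventually\<close>)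
    then have "(\<lambda>n. Re (F (of_real (\<rho> n * \<zeta>))) / \<zeta>) \<longlonglongrightarrow> Re (F (of_real \<zeta>)) / \<zeta>"
      using that by (intro tendsto_intros) auto
    then show ?thesis using that by (simp add: q_def)
  qed
  show ?thesis
  proof (cases "D = 0")
    \<comment> \<open>F'(0) = 0 leaves nothing to normalise. The densities then vanish almost
      everywhere and F has real part 0 on the real axis, so m = 0 with an arbitrary \<tau> on
      [-1, 1] serves.\<close>
    case True
    have qz: "q n \<zeta> = 0" if z: "-1 < \<zeta>" "\<zeta> < 1" for n \<zeta>
    proof -
      have "(\<integral>\<^sup>+ t. ennreal (indicator {0..1} t * w n t) \<partial>lborel) = 0"
        using nnp[of 0 n] True by (simp add: q_def)
      then have "AE t in lborel. indicator {0..1} t * w n t \<le> 0"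
        by (subst (asm) nn_integral_0_iff_AE) (auto simp: ennreal_eq_0_iff)
      then have "AE t in lborel. ennreal (indicator {0..1} t * (w n t / (1 - 2 * \<zeta> * cos (2 * pi * t) + \<zeta>\<^sup>2))) = 0"
      proof eventually_elim
        case (elim t)
        then have "indicator {0..1} t * w n t = 0" using w0[of n t] by (auto simp: indicator_def split: if_splits)
        then show ?case by auto
      qed
      then have "ennreal (q n \<zeta>) = (\<integral>\<^sup>+ (t :: real). 0 \<partial>lborel)"
        unfolding nnp[OF z, symmetric] by (rule nn_integral_cong_AE)
      then show ?thesis using q0[OF z, of n] by simp
    qed
    have "Re (F (of_real \<zeta>)) = 0" if "-1 < \<zeta>" "\<zeta> < 1" for \<zeta>
      using qlim[OF that] qz[OF that] F0 by (cases "\<zeta> = 0") (auto simp: LIMSEQ_const_iff)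
    moreover have "real_distribution (return borel (0::real))"
    proof -
      interpret prob_space "return borel (0::real)" by (rule prob_space_return) auto
      show ?thesis by unfold_locales auto
    qed
    moreover have "AE c in return borel (0::real). c \<in> {-1..1}" by (subst AE_return) auto
    ultimately show ?thesis by (intro that[of 0 "return borel 0"]) auto
  next
    case False
    with D0 have Dp: "D > 0" by simp
    define m where "m n = \<rho> n * D" for n
    have mp: "m n > 0" for n using Dp \<rho> by (simp add: m_def)
    define \<mu> where "\<mu> n = density lborel (\<lambda>t. ennreal (indicator {0..1} t * w n t / m n))" for n
    have "emeasure (\<mu> n) (space (\<mu> n)) = 1" for n
    proof -
      have "emeasure (\<mu> n) (space (\<mu> n)) = (\<integral>\<^sup>+ t. ennreal (1 / m n) * ennreal (indicator {0..1} t * w n t) \<partial>lborel)"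
        unfolding \<mu>_def using mp[of n] w0[of n]
        by (subst emeasure_density) (auto simp: ennreal_mult[symmetric] intro!: nn_integral_cong)
      also have "\<dots> = ennreal (1 / m n) * ennreal (m n)"
        using nnp[of 0 n] by (subst nn_integral_cmult) (auto simp: q_def m_def)
      finally show ?thesis using mp[of n] by (simp add: ennreal_mult[symmetric])
    qed
    then have pm: "prob_space (\<mu> n)" for n by (rule prob_spaceI)
    define \<sigma> where "\<sigma> n = distr (\<mu> n) borel (\<lambda>t. cos (2 * pi * t))" for n
    have [measurable_cong]: "sets (\<mu> n) = sets borel" for n by (simp add: \<mu>_def)
    have rd: "real_distribution (\<sigma> n)" for n
      unfolding \<sigma>_def by (rule prob_space.real_distribution_distr[OF pm]) simp
    have supp: "AE c in \<sigma> n. c \<in> {-1..1}" for n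
      unfolding \<sigma>_def by (subst AE_distr_iff) auto
    obtain r \<tau> where r: "strict_mono (r :: nat \<Rightarrow> nat)" and \<tau>: "real_distribution \<tau>"
      and \<tau>s: "AE x in \<tau>. x \<in> {-1..1}"
      and conv: "\<And>f :: real \<Rightarrow> real. continuous_on {-1..1} f \<Longrightarrow>
       (\<lambda>n. \<integral>x. f (max (-1) (min 1 x)) \<partial>\<sigma> (r n)) \<longlonglongrightarrow> (\<integral>x. f (max (-1) (min 1 x)) \<partial>\<tau>)"
      by (rule helly_compact[of \<sigma> "-1" 1, OF rd supp]) auto
    interpret T: real_distribution \<tau> by (rule \<tau>)
    show ?thesis
    proof (rule that[OF D0 \<tau> \<tau>s])
      fix \<zeta> :: real assume z: "-1 < \<zeta>" "\<zeta> < 1"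
      define k where "k c = 1 / (1 - 2 * \<zeta> * c + \<zeta>\<^sup>2)" for c
      have kpos: "k c \<ge> 0" if "c \<in> {-1..1}" for c
        using typically_real_kernel_pos[OF z, of c] that by (simp add: k_def)
      have [measurable]: "k \<in> borel_measurable borel" unfolding k_def[abs_def] by measurable
      have kc: "continuous_on {-1..1} k"
        unfolding k_def[abs_def] using typically_real_kernel_pos[OF z]
        by (intro continuous_intros) force
      have 1: "(\<integral>x. k (max (-1) (min 1 x)) \<partial>\<sigma> n) = q n \<zeta> / m n" for n
      proof -
        have "(\<integral>x. k (max (-1) (min 1 x)) \<partial>\<sigma> n) = (\<integral>t. k (cos (2 * pi * t)) \<partial>\<mu> n)"
          unfolding \<sigma>_def by (subst integral_distr) (auto simp: min_absorb2 max_absorb2)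
        also have "\<dots> = enn2real (\<integral>\<^sup>+ t. ennreal (k (cos (2 * pi * t))) \<partial>\<mu> n)"
          by (rule integral_eq_nn_integral) (auto intro!: AE_I2 kpos)
        also have "(\<integral>\<^sup>+ t. ennreal (k (cos (2 * pi * t))) \<partial>\<mu> n) =
            (\<integral>\<^sup>+ t. ennreal (indicator {0..1} t * w n t / m n) * ennreal (k (cos (2 * pi * t))) \<partial>lborel)"
          unfolding \<mu>_def by (rule nn_integral_density) auto
        also have "\<dots> = (\<integral>\<^sup>+ t. ennreal (1 / m n) * ennreal (indicator {0..1} t * (w n t / (1 - 2 * \<zeta> * cos (2 * pi * t) + \<zeta>\<^sup>2))) \<partial>lborel)"
          using mp[of n] w0[of n] kpos typically_real_kernel_pos[OF z]
          by (intro nn_integral_cong) (simp add: ennreal_mult[symmetric] k_def)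
        also have "\<dots> = ennreal (1 / m n) * ennreal (q n \<zeta>)"
          by (subst nn_integral_cmult, measurable, subst nnp[OF z], rule refl)
        also have "\<dots> = ennreal (q n \<zeta> / m n)"
          using mp[of n] q0[OF z, of n] by (simp add: ennreal_mult[symmetric])
        finally show ?thesis using mp[of n] q0[OF z, of n] by simp
      qed
      have 2: "(\<integral>x. k (max (-1) (min 1 x)) \<partial>\<tau>) = (\<integral>x. k x \<partial>\<tau>)"
        by (rule integral_cong_AE) (auto intro!: eventually_mono[OF \<tau>s] simp: min_absorb2 max_absorb2)
      have lim1: "(\<lambda>n. q (r n) \<zeta> / m (r n)) \<longlonglongrightarrow> (\<integral>x. k x \<partial>\<tau>)"
        using conv[OF kc] unfolding 1 2 .
      show "Re (F (of_real \<zeta>)) = D * (\<integral>c. \<zeta> / (1 - 2 * \<zeta> * c + \<zeta>\<^sup>2) \<partial>\<tau>)"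
      proof (cases "\<zeta> = 0")
        case False
        have "(\<lambda>n. q n \<zeta> / m n) \<longlonglongrightarrow> Re (F (of_real \<zeta>)) / \<zeta> / (1 * D)"
          unfolding m_def by (intro tendsto_intros qlim z False \<rho>lim) (use Dp in auto)
        from LIMSEQ_subseq_LIMSEQ[OF this r] lim1
        have "Re (F (of_real \<zeta>)) / \<zeta> / (1 * D) = (\<integral>x. k x \<partial>\<tau>)"
          by (intro LIMSEQ_unique) (auto simp: o_def)
        then have "Re (F (of_real \<zeta>)) = D * (\<zeta> * (\<integral>x. k x \<partial>\<tau>))" using False Dp by (simp add: field_simps)
        also have "\<zeta> * (\<integral>x. k x \<partial>\<tau>) = (\<integral>x. \<zeta> * k x \<partial>\<tau>)" by simp
        finally show ?thesis by (simp add: k_def)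
      qed (simp add: F0)
    qed
  qed
qed

section \<open>From the unit disc to the slit plane\<close>

definition slit :: "complex set" where "slit = - \<real>\<^sub>\<le>\<^sub>0"

lemma slit_iff: "z \<in> slit \<longleftrightarrow> z \<notin> \<real>\<^sub>\<le>\<^sub>0"
  by (simp add: slit_def)

lemma slit_alt: "slit = - (complex_of_real ` {..0})"
  by (auto simp: slit_def nonpos_Reals_def)

lemma slit_open: "open slit"
  unfolding slit_def by (intro open_Compl closed_nonpos_Reals_complex)

text \<open>The square of the Cayley transform (1 + z) / (1 - z) maps the disc into the slit plane,
  preserves the sign of the imaginary part, maps (-1, 1) to positive reals and sends 0 to 1; hence
  the normalisation at 1. On the real line its inverse is \<zeta> = (sqrt s - 1) / (sqrt s + 1),
  which turns the kernel of the disc into the one stated.\<close>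

lemma pick_representation:
  assumes H: "H holomorphic_on slit"
    and real: "\<And>x :: real. x > 0 \<Longrightarrow> H (of_real x) = of_real (Re (H (of_real x)))"
    and up: "\<And>z. Im z > 0 \<Longrightarrow> Im (H z) \<ge> 0" and dn: "\<And>z. Im z < 0 \<Longrightarrow> Im (H z) \<le> 0"
  shows "\<exists>m \<tau>. m \<ge> (0::real) \<and> real_distribution \<tau> \<and> (AE c in \<tau>. c \<in> {-1..1}) \<and>
    (\<forall>s>0. Re (H (of_real s)) - Re (H 1) = m * (\<integral>c. (s - 1) / (2 * ((1 - c) * s + (1 + c))) \<partial>\<tau>))"
proof -
  define g where "g z = ((1 + z) / (1 - z))\<^sup>2" for z :: complex
  define F where "F z = H (g z) - H 1" for z
  have re: "Re ((1 + z) / (1 - z)) > 0" "Im z > 0 \<Longrightarrow> Im ((1 + z) / (1 - z)) > 0" "Im z < 0 \<Longrightarrow> Im ((1 + z) / (1 - z)) < 0" "1 - z \<noteq> 0"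
    if "norm z < 1" for z :: complex
  proof -
    have n: "(Re z)\<^sup>2 + (Im z)\<^sup>2 < 1" using that by (simp add: norm_complex_def real_sqrt_lt_1_iff)
    show nz: "1 - z \<noteq> 0" using that by auto
    then have d: "(1 - Re z)\<^sup>2 + (Im z)\<^sup>2 > 0" by (auto simp: complex_eq_iff sum_power2_gt_zero_iff)
    have "Re ((1 + z) / (1 - z)) = (1 - ((Re z)\<^sup>2 + (Im z)\<^sup>2)) / ((1 - Re z)\<^sup>2 + (Im z)\<^sup>2)"
      by (simp add: Re_divide power2_eq_square algebra_simps)
    then show "Re ((1 + z) / (1 - z)) > 0" using n d by simp
    have im: "Im ((1 + z) / (1 - z)) = 2 * Im z / ((1 - Re z)\<^sup>2 + (Im z)\<^sup>2)"
      by (simp add: Im_divide power2_eq_square algebra_simps)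
    show "Im z > 0 \<Longrightarrow> Im ((1 + z) / (1 - z)) > 0" "Im z < 0 \<Longrightarrow> Im ((1 + z) / (1 - z)) < 0"
      unfolding im using d by (auto simp: zero_less_divide_iff divide_less_0_iff)
  qed
  have gs: "g z \<in> slit" if z: "norm z < 1" for z
  proof -
    have "g z \<notin> \<real>\<^sub>\<le>\<^sub>0"
    proof
      assume "g z \<in> \<real>\<^sub>\<le>\<^sub>0"
      \<comment> \<open>Principal roots of nonpositive reals are purely imaginary, whereas the
        Cayley transform is the principal root of \<open>g z\<close> and has positive real
        part.\<close>
      then have "Re (csqrt (g z)) = 0"
        by (auto elim!: nonpos_Reals_cases)
      moreover have "csqrt (g z) = (1 + z) / (1 - z)"
        unfolding g_def by (rule csqrt_square) (use re(1)[OF z] in auto)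
      ultimately show False using re(1)[OF z] by simp
    qed
    then show ?thesis by (simp add: slit_iff)
  qed
  have gim: "Im (g z) = 2 * Re ((1 + z) / (1 - z)) * Im ((1 + z) / (1 - z))" for z
    by (simp only: g_def Im_power2)
  have Fhol: "F holomorphic_on ball 0 1"
    unfolding F_def[abs_def] g_def
    by (intro holomorphic_intros holomorphic_on_compose_gen[OF _ H, unfolded o_def])
      (use re(4) gs in \<open>auto simp: g_def\<close>)
  have gre: "g (of_real x) = of_real (((1 + x) / (1 - x))\<^sup>2)" for x :: real
    by (simp add: g_def)
  have H1: "Im (H 1) = 0" using arg_cong[OF real[of 1], of Im] by simp
  have Freal: "F (of_real x) = of_real (Re (F (of_real x)))" if "\<bar>x\<bar> < 1" for x :: real
  proof -
    have "((1 + x) / (1 - x))\<^sup>2 > 0" using that by (auto simp: zero_less_power2 abs_less_iff)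
    from arg_cong[OF real[OF this], of Im] have "Im (H (g (of_real x))) = 0" by (simp add: gre)
    then show ?thesis using H1 by (simp add: F_def complex_eq_iff)
  qed
  have Fup: "Im (F z) \<ge> 0" if "norm z < 1" "Im z > 0" for z
    using up[of "g z"] re(1,2)[OF that(1)] that(2) H1 by (simp add: F_def gim)
  have Fdn: "Im (F z) \<le> 0" if "norm z < 1" "Im z < 0" for z
    using dn[of "g z"] re(1,3)[OF that(1)] that(2) H1 by (simp add: F_def gim mult_pos_neg)
  have F0: "F 0 = 0" by (simp add: F_def g_def)
  obtain m \<tau> where m: "m \<ge> (0::real)" "real_distribution \<tau>" "AE c in \<tau>. c \<in> {-1..1}"
    "\<And>\<zeta>. -1 < \<zeta> \<Longrightarrow> \<zeta> < 1 \<Longrightarrow> Re (F (of_real \<zeta>)) = m * (\<integral>c. \<zeta> / (1 - 2 * \<zeta> * c + \<zeta>\<^sup>2) \<partial>\<tau>)"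
    by (rule typically_real_representation[OF Fhol F0 Freal Fup Fdn]) (auto intro: that)
  show ?thesis
  proof (intro exI[of _ m] exI[of _ \<tau>] conjI m(1-3) allI impI)
    fix s :: real assume s: "s > 0"
    define q where "q = sqrt s"
    have q: "q > 0" "q * q = s" using s by (auto simp: q_def)
    define \<zeta> where "\<zeta> = (q - 1) / (q + 1)"
    have z: "-1 < \<zeta>" "\<zeta> < 1" using q by (auto simp: \<zeta>_def field_simps)
    have "(1 + \<zeta>) / (1 - \<zeta>) = q" using q by (simp add: \<zeta>_def field_simps)
    then have "Re (F (of_real \<zeta>)) = Re (H (of_real s)) - Re (H 1)"
      using q by (simp add: F_def gre power2_eq_square)
    moreover have "\<zeta> / (1 - 2 * \<zeta> * c + \<zeta>\<^sup>2) = (s - 1) / (2 * ((1 - c) * s + (1 + c)))" for c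
    proof -
      have zq: "(q + 1) * \<zeta> = q - 1" using q by (simp add: \<zeta>_def)
      have "(q + 1) * (q + 1) * (1 - 2 * \<zeta> * c + \<zeta>\<^sup>2) =
          (q + 1) * (q + 1) - 2 * c * ((q + 1) * \<zeta>) * (q + 1) + ((q + 1) * \<zeta>) * ((q + 1) * \<zeta>)"
        by (simp add: power2_eq_square algebra_simps)
      also have "\<dots> = (q + 1) * (q + 1) - 2 * c * (q - 1) * (q + 1) + (q - 1) * (q - 1)"
        unfolding zq ..
      also have "\<dots> = 2 * ((1 - c) * s + (1 + c))" by (simp add: q(2)[symmetric] algebra_simps)
      finally have D: "(q + 1) * (q + 1) * (1 - 2 * \<zeta> * c + \<zeta>\<^sup>2) = 2 * ((1 - c) * s + (1 + c))" .
      have N: "(q + 1) * (q + 1) * \<zeta> = s - 1"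
        unfolding mult.assoc zq by (simp add: q(2)[symmetric] algebra_simps)
      have "\<zeta> / (1 - 2 * \<zeta> * c + \<zeta>\<^sup>2) = ((q + 1) * (q + 1) * \<zeta>) / ((q + 1) * (q + 1) * (1 - 2 * \<zeta> * c + \<zeta>\<^sup>2))"
        using q by simp
      then show ?thesis unfolding D N .
    qed
    ultimately show "Re (H (of_real s)) - Re (H 1) = m * (\<integral>c. (s - 1) / (2 * ((1 - c) * s + (1 + c))) \<partial>\<tau>)"
      using m(4)[OF z] by simp
  qed
qed

section \<open>Continuation to the slit plane\<close>

text \<open>With w = v + 1 / v, the point v solves v^2 - w v + 1 = 0; the other root is 1 / v and
  gives the same product, so \<psi> may be computed from either root. Two formulas for a root, V and
  V', are holomorphic where w^2 - 4, respectively 4 - w^2, avoids the closed negative half-axis.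
  Together they miss only w = 2 in the domain, where continuity removes the singularity.\<close>

lemma slit_symmetric_function:
  fixes \<phi> :: "complex \<Rightarrow> complex"
  assumes \<phi>: "\<phi> holomorphic_on slit" and u: "u > 0"
  shows "\<exists>\<psi>. \<psi> holomorphic_on {w. \<not> (Im w = 0 \<and> Re w \<le> -2)} \<and>
    (\<forall>v. v \<noteq> 0 \<longrightarrow> \<psi> (v + inverse v) = \<phi> (of_real u * v) * \<phi> (of_real u * inverse v))"
proof -
  define W where "W = {w. \<not> (Im w = 0 \<and> Re w \<le> -2)}"
  have "open W"
  proof -
    have "W = {w. Im w \<noteq> 0} \<union> {w. Re w > -2}" by (auto simp: W_def)
    then show ?thesis by (auto intro!: open_Un open_Collect_neq open_Collect_less continuous_intros)
  qed
  define E where "E v = \<phi> (of_real u * v) * \<phi> (of_real u * inverse v)" for v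
  define V where "V w = (w + csqrt (w\<^sup>2 - 4)) / 2" for w
  define V' where "V' w = (w + \<i> * csqrt (4 - w\<^sup>2)) / 2" for w
  have slit_mult: "of_real u * v \<in> slit" if "v \<in> slit" for v
  proof (rule ccontr)
    assume "\<not> ?thesis"
    then obtain x where x: "of_real u * v = of_real x" "x \<le> 0" by (auto simp: slit_alt)
    then have "v = of_real (x / u)" using u by (simp add: field_simps)
    moreover have "x / u \<in> {..0}" using x u by (simp add: divide_nonpos_pos)
    ultimately have "v \<in> complex_of_real ` {..0}" by blast
    then show False using that by (simp add: slit_alt)
  qed
  have root: "E v = E v'" if "v * v - w * v + 1 = 0" "v' * v' - w * v' + 1 = 0" for v v' w
  proof -
    have nz: "v \<noteq> 0" "v' \<noteq> 0" using that by auto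
    have "(v - v') * (v * v' - 1) = (v * v - w * v + 1) * v' - (v' * v' - w * v' + 1) * v"
      by (simp add: algebra_simps)
    then have "v = v' \<or> v * v' = 1" using that by auto
    then show ?thesis
    proof
      assume "v * v' = 1"
      then have "v' = inverse v" "v = inverse v'" using nz by (auto simp: field_simps)
      then show ?thesis unfolding E_def by (metis mult.commute)
    qed simp
  qed
  have Vroot: "V w * V w - w * V w + 1 = 0" for w
  proof -
    have "V w * V w - w * V w + 1 = ((csqrt (w\<^sup>2 - 4))\<^sup>2 - w\<^sup>2) / 4 + 1"
      unfolding V_def by (simp add: power2_eq_square field_simps del: power2_csqrt)
    then show ?thesis by simp
  qed
  have V'root: "V' w * V' w - w * V' w + 1 = 0" for w
  proof -
    have "V' w * V' w - w * V' w + 1 = (- (csqrt (4 - w\<^sup>2))\<^sup>2 - w\<^sup>2) / 4 + 1"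
      unfolding V'_def by (simp add: power2_eq_square field_simps del: power2_csqrt)
    then show ?thesis by simp
  qed
  \<comment> \<open>A negative real v gives v + 1 / v \<le> -2, which is why the domain of \<psi>
    leaves out the ray below -2.\<close>
  have inslit: "v \<in> slit" "inverse v \<in> slit" if w: "w \<in> W" and v: "v * v - w * v + 1 = 0" for v w
  proof -
    have nz: "v \<noteq> 0" using v by auto
    have wv: "w = v + inverse v" using v nz by (simp add: field_simps)
    have no: False if "v = of_real x" "x \<le> 0" for x
    proof -
      have x: "x < 0" using that nz by (auto simp: less_le)
      have "w = of_real (x + inverse x)" using wv that by simp
      then have "Im w = 0" "Re w = x + inverse x"
        by (simp_all only: Im_complex_of_real Re_complex_of_real)
      moreover have "x + inverse x \<le> -2"
        using sum_ge_two_sqrt[of 1 "-x"] x by (simp add: field_simps)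
      ultimately show False using w by (simp add: W_def)
    qed
    then show "v \<in> slit" by (auto simp: slit_alt)
    show "inverse v \<in> slit"
    proof (rule ccontr)
      assume "inverse v \<notin> slit"
      then obtain x where x: "inverse v = of_real x" "x \<le> 0" by (auto simp: slit_alt)
      then have "v = of_real (inverse x)" by (metis inverse_inverse_eq of_real_inverse)
      with no[of "inverse x"] x show False by simp
    qed
  qed
  define \<psi> where "\<psi> w = E (V w)" for w
  have hol1: "\<psi> holomorphic_on {w \<in> W. w\<^sup>2 - 4 \<notin> \<real>\<^sub>\<le>\<^sub>0}"
  proof -
    have Vh: "V holomorphic_on {w \<in> W. w\<^sup>2 - 4 \<notin> \<real>\<^sub>\<le>\<^sub>0}"
      unfolding V_def[abs_def] by (intro holomorphic_intros) auto
    have "V w \<noteq> 0" for w using Vroot[of w] by auto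
    then show ?thesis
      unfolding \<psi>_def[abs_def] E_def
      by (intro holomorphic_intros holomorphic_on_compose_gen[OF _ \<phi>, unfolded o_def] Vh)
        (use slit_mult inslit Vroot in auto)
  qed
  have hol2: "\<psi> holomorphic_on {w \<in> W. 4 - w\<^sup>2 \<notin> \<real>\<^sub>\<le>\<^sub>0}"
  proof -
    have V'h: "V' holomorphic_on {w \<in> W. 4 - w\<^sup>2 \<notin> \<real>\<^sub>\<le>\<^sub>0}"
      unfolding V'_def[abs_def] by (intro holomorphic_intros) auto
    have "V' w \<noteq> 0" for w using V'root[of w] by auto
    then have "(\<lambda>w. E (V' w)) holomorphic_on {w \<in> W. 4 - w\<^sup>2 \<notin> \<real>\<^sub>\<le>\<^sub>0}"
      unfolding E_def
      by (intro holomorphic_intros holomorphic_on_compose_gen[OF _ \<phi>, unfolded o_def] V'h)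
        (use slit_mult inslit V'root in auto)
    moreover have "\<psi> = (\<lambda>w. E (V' w))" using root[OF Vroot V'root] by (auto simp: \<psi>_def)
    ultimately show ?thesis by simp
  qed
  have opens: "open {w \<in> W. w\<^sup>2 - 4 \<notin> \<real>\<^sub>\<le>\<^sub>0}" "open {w \<in> W. 4 - w\<^sup>2 \<notin> \<real>\<^sub>\<le>\<^sub>0}"
  proof -
    have "open ((\<lambda>w :: complex. w\<^sup>2 - 4) -` slit)" "open ((\<lambda>w :: complex. 4 - w\<^sup>2) -` slit)"
      by (intro open_vimage slit_open continuous_intros)+
    from open_Int[OF \<open>open W\<close> this(1)] open_Int[OF \<open>open W\<close> this(2)]
    show "open {w \<in> W. w\<^sup>2 - 4 \<notin> \<real>\<^sub>\<le>\<^sub>0}" "open {w \<in> W. 4 - w\<^sup>2 \<notin> \<real>\<^sub>\<le>\<^sub>0}"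
      unfolding vimage_def Int_def slit_iff mem_Collect_eq .
  qed
  have cover: "W - {2} \<subseteq> {w \<in> W. w\<^sup>2 - 4 \<notin> \<real>\<^sub>\<le>\<^sub>0} \<union> {w \<in> W. 4 - w\<^sup>2 \<notin> \<real>\<^sub>\<le>\<^sub>0}"
  proof
    fix w assume w: "w \<in> W - {2}"
    show "w \<in> {w \<in> W. w\<^sup>2 - 4 \<notin> \<real>\<^sub>\<le>\<^sub>0} \<union> {w \<in> W. 4 - w\<^sup>2 \<notin> \<real>\<^sub>\<le>\<^sub>0}"
    proof (rule ccontr)
      assume "\<not> ?thesis"
      then have "w\<^sup>2 - 4 \<in> \<real>\<^sub>\<le>\<^sub>0" "4 - w\<^sup>2 \<in> \<real>\<^sub>\<le>\<^sub>0" using w by auto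
      then have "w\<^sup>2 - 4 = 0" by (auto simp: complex_nonpos_Reals_iff complex_eq_iff)
      then have "(w - 2) * (w + 2) = 0" by (simp add: power2_eq_square algebra_simps)
      then have "w = -2" using w by (auto simp: add_eq_0_iff2)
      then show False using w by (simp add: W_def)
    qed
  qed
  have hol: "\<psi> holomorphic_on W - {2}"
    by (rule holomorphic_on_subset[OF holomorphic_on_Un[OF hol1 hol2 opens] cover])
  have "isCont \<psi> 2"
  proof -
    have "isCont (\<lambda>w. csqrt (w\<^sup>2 - 4)) (2::complex)"
    proof -
      have "((\<lambda>w. csqrt (w\<^sup>2 - 4)) \<longlongrightarrow> 0) (at (2::complex))"
      proof (rule tendsto_norm_zero_cancel)
        have "((\<lambda>w :: complex. sqrt (norm (w\<^sup>2 - 4))) \<longlongrightarrow> sqrt (norm ((2::complex)\<^sup>2 - 4))) (at 2)"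
          by (intro tendsto_intros)
        then show "((\<lambda>w. norm (csqrt (w\<^sup>2 - 4))) \<longlongrightarrow> 0) (at (2::complex))" by (simp add: norm_csqrt)
      qed
      then show ?thesis by (simp add: isCont_def)
    qed
    then have V2: "isCont V 2" unfolding V_def[abs_def] by (intro continuous_intros) auto
    have "V 2 = 1" by (simp add: V_def)
    have us: "of_real u \<in> slit" using u by (auto simp: slit_alt)
    have \<phi>u: "isCont \<phi> (of_real u)"
      using holomorphic_on_imp_continuous_on[OF \<phi>] us slit_open by (simp add: continuous_on_eq_continuous_at)
    have "isCont (\<lambda>w. of_real u * V w) 2" "isCont (\<lambda>w. of_real u * inverse (V w)) 2"
      using V2 \<open>V 2 = 1\<close> by (auto intro!: continuous_mult continuous_const continuous_at_within_inverse)
    from isCont_o2[OF this(1), of \<phi>] isCont_o2[OF this(2), of \<phi>] show ?thesis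
      unfolding \<psi>_def[abs_def] E_def using \<phi>u \<open>V 2 = 1\<close> by (intro continuous_mult) auto
  qed
  have "continuous_on W \<psi>"
  proof (rule continuous_at_imp_continuous_on, rule ballI)
    fix w assume w: "w \<in> W"
    show "isCont \<psi> w"
    proof (cases "w = 2")
      case False
      have "open (W - {2})" using \<open>open W\<close> by (simp add: open_Diff)
      with holomorphic_on_imp_continuous_on[OF hol] w False show ?thesis
        by (simp add: continuous_on_eq_continuous_at)
    qed (use \<open>isCont \<psi> 2\<close> in simp)
  qed
  then have "\<psi> holomorphic_on W"
    by (rule no_isolated_singularity[OF _ hol \<open>open W\<close>]) simp
  moreover have "\<psi> (v + inverse v) = \<phi> (of_real u * v) * \<phi> (of_real u * inverse v)" if "v \<noteq> 0" for v
    unfolding \<psi>_def E_def[symmetric] by (rule root[OF Vroot]) (use that in \<open>simp add: algebra_simps\<close>)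
  ultimately show ?thesis unfolding W_def by blast
qed

text \<open>Expand exp (c l x) inside the integral. All terms are nonnegative, so sum and integral
  may be exchanged, and the finite value h 0 at x = T forces every coefficient to be finite.\<close>

lemma laplace_fn_power_series:
  assumes h: "laplace_fn h" and c: "c \<ge> 0" and T: "T > 0"
  obtains b where "\<And>n. b n \<ge> 0" "\<And>x. 0 \<le> x \<Longrightarrow> x \<le> T \<Longrightarrow> (\<lambda>n. b n * x ^ n) sums h (c * (T - x))"
proof -
  obtain K where sK[measurable_cong]: "sets K = sets borel" and K: "AE l in K. 0 \<le> l"
    "\<And>s. s \<ge> 0 \<Longrightarrow> ennreal (h s) = (\<integral>\<^sup>+ l. ennreal (exp (- s * l)) \<partial>K)"
    using laplace_fnE[OF h] by metis
  define b' where "b' n = (\<integral>\<^sup>+ l. ennreal ((c * l) ^ n / fact n * exp (- (c * T) * l)) \<partial>K)" for n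
  have sum: "ennreal (h (c * (T - x))) = (\<Sum>n. b' n * ennreal (x ^ n))" if x: "0 \<le> x" "x \<le> T" for x
  proof -
    have s: "c * (T - x) \<ge> 0" using c x by simp
    have "ennreal (h (c * (T - x))) = (\<integral>\<^sup>+ l. (\<Sum>n. ennreal ((c * l) ^ n / fact n * exp (- (c * T) * l)) * ennreal (x ^ n)) \<partial>K)"
      unfolding K(2)[OF s]
    proof (rule nn_integral_cong_AE, rule eventually_mono[OF K(1)])
      fix l :: real assume l: "0 \<le> l"
      have "(\<lambda>n. exp (- (c * T) * l) * ((c * l * x) ^ n /\<^sub>R fact n)) sums (exp (- (c * T) * l) * exp (c * l * x))"
        by (intro sums_mult exp_converges)
      then have S: "(\<lambda>n. (c * l) ^ n / fact n * exp (- (c * T) * l) * x ^ n) sums exp (- (c * (T - x)) * l)"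
        by (simp add: exp_add[symmetric] algebra_simps power_mult_distrib divide_inverse)
      have nn: "0 \<le> (c * l) ^ n / fact n * exp (- (c * T) * l) * x ^ n" for n
        using c l x by auto
      have *: "(\<Sum>n. ennreal ((c * l) ^ n / fact n * exp (- (c * T) * l) * x ^ n)) = ennreal (exp (- (c * (T - x)) * l))"
        using suminf_ennreal2[OF nn sums_summable[OF S]] unfolding sums_unique[OF S, symmetric] .
      show "ennreal (exp (- (c * (T - x)) * l)) = (\<Sum>n. ennreal ((c * l) ^ n / fact n * exp (- (c * T) * l)) * ennreal (x ^ n))"
      proof -
        have "ennreal ((c * l) ^ n / fact n * exp (- (c * T) * l)) * ennreal (x ^ n) =
            ennreal ((c * l) ^ n / fact n * exp (- (c * T) * l) * x ^ n)" for n
          by (rule ennreal_mult[symmetric]) (use c l x in auto)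
        with * show ?thesis by simp
      qed
    qed
    also have "\<dots> = (\<Sum>n. \<integral>\<^sup>+ l. ennreal ((c * l) ^ n / fact n * exp (- (c * T) * l)) * ennreal (x ^ n) \<partial>K)"
      by (rule nn_integral_suminf) measurable
    also have "\<dots> = (\<Sum>n. b' n * ennreal (x ^ n))"
      unfolding b'_def by (intro suminf_cong nn_integral_multc) measurable
    finally show ?thesis .
  qed
  define b where "b n = enn2real (b' n)" for n
  have b'b: "b' n = ennreal (b n)" for n
  proof -
    have "b' n * ennreal (T ^ n) \<le> (\<Sum>n. b' n * ennreal (T ^ n))"
      using sum_le_suminf[of "\<lambda>n. b' n * ennreal (T ^ n)" "{n}"] by simp
    also have "\<dots> < top" unfolding sum[OF less_imp_le[OF T] order_refl, symmetric] by simp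
    finally have "b' n \<noteq> top" using T by (auto simp: ennreal_top_mult)
    then show ?thesis by (simp add: b_def less_top)
  qed
  show ?thesis
  proof (rule that[of b])
    show b0: "b n \<ge> 0" for n by (simp add: b_def)
    fix x :: real assume x: "0 \<le> x" "x \<le> T"
    have "(\<lambda>n. ennreal (b n * x ^ n)) sums ennreal (h (c * (T - x)))"
      unfolding sum[OF x] using x by (simp add: b'b ennreal_mult b0 summable_sums)
    then show "(\<lambda>n. b n * x ^ n) sums h (c * (T - x))"
      using x c laplace_fn_nonneg[OF h] b0 by (subst (asm) sums_ennreal) auto
  qed
qed

text \<open>The Taylor coefficients at a point \<open>w\<^sub>0 > 2\<close> alternate in sign since the function is completely
  monotone on \<open>[2, \<infinity>)\<close>; as the Taylor series converges down to \<open>-2\<close>, monotonicity persists there.\<close>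

lemma laplace_fn_continuation_antimono:
  assumes \<psi>: "\<psi> holomorphic_on {w. \<not> (Im w = 0 \<and> Re w \<le> -2)}"
    and h: "laplace_fn h" and c: "c \<ge> 0"
    and eq: "\<And>w :: real. w \<ge> 2 \<Longrightarrow> \<psi> (of_real w) = of_real (h (c * (w - 2)))"
    and w: "-2 < w" "w \<le> w'"
  shows "Re (\<psi> (of_real w')) \<le> Re (\<psi> (of_real w))"
proof -
  \<comment> \<open>Any base point to the right of both w' and 2 would do.\<close>
  define w0 where "w0 = max w' 2 + 1"
  have w0: "w0 > 2" "w0 > w'" by (auto simp: w0_def)
  obtain b where b: "\<And>n. b n \<ge> 0" "\<And>x. 0 \<le> x \<Longrightarrow> x \<le> w0 - 2 \<Longrightarrow> (\<lambda>n. b n * x ^ n) sums h (c * (w0 - 2 - x))"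
    using laplace_fn_power_series[OF h c, of "w0 - 2"] w0 by auto
  \<comment> \<open>Reflection at w0 turns alternating Taylor coefficients into nonnegative ones.
    The radius w0 + 2 used below is the distance from w0 to the cut.\<close>
  define g where "g z = \<psi> (of_real w0 - z)" for z
  have gh: "g holomorphic_on ball 0 (w0 + 2)"
    unfolding g_def[abs_def]
  proof (rule holomorphic_on_compose_gen[OF _ \<psi>, unfolded o_def])
    show "(\<lambda>z. of_real w0 - z) ` ball 0 (w0 + 2) \<subseteq> {w. \<not> (Im w = 0 \<and> Re w \<le> -2)}"
    proof clarsimp
      fix z :: complex assume z: "norm z < w0 + 2" "w0 - Re z \<le> - 2"
      then show False using complex_Re_le_cmod[of z] by linarith
    qed
  qed (intro holomorphic_intros)
  have gx: "(\<lambda>n. of_real (b n) * of_real x ^ n) sums g (of_real x)" if "0 \<le> x" "x \<le> w0 - 2" for x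
  proof -
    have "g (of_real x) = \<psi> (of_real (w0 - x))" by (simp add: g_def)
    also have "\<dots> = of_real (h (c * (w0 - x - 2)))" by (rule eq) (use that in auto)
    finally have "g (of_real x) = of_real (h (c * (w0 - 2 - x)))" by (simp add: algebra_simps)
    then show ?thesis
      using sums_of_real[OF b(2)[OF that], where 'a = complex] by simp
  qed
  define B where "B z = (\<Sum>n. of_real (b n) * z ^ n)" for z :: complex
  have Bs: "(\<lambda>n. of_real (b n) * z ^ n) sums B z" if "norm z < w0 - 2" for z
    unfolding B_def
  proof (rule summable_sums, rule summable_norm_cancel)
    show "summable (\<lambda>n. norm (of_real (b n) * z ^ n))"
      using sums_summable[OF b(2)[of "norm z"]] that b(1) by (simp add: norm_mult norm_power)
  qed
  have Bh: "B holomorphic_on ball 0 (w0 - 2)"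
    by (rule power_series_holomorphic[where a = "\<lambda>n. of_real (b n)"]) (use Bs in auto)
  \<comment> \<open>The series B is known to equal g only on [0, w0 - 2]. The identity theorem makes
    it the Taylor series of g, which then converges on the larger disc.\<close>
  have gB: "g z - B z = 0" if z: "z \<in> ball 0 (w0 - 2)" for z
  proof (rule analytic_continuation[where f = "\<lambda>z. g z - B z" and S = "ball 0 (w0 - 2)" and U = "of_real ` {0<..<w0 - 2}" and \<xi> = 0, OF _ open_ball])
    show "(\<lambda>z. g z - B z) holomorphic_on ball 0 (w0 - 2)"
      by (intro holomorphic_intros Bh holomorphic_on_subset[OF gh]) auto
    show "0 islimpt complex_of_real ` {0<..<w0 - 2}"
      unfolding islimpt_approachable
    proof (intro allI impI)
      fix e :: real assume e: "e > 0"
      let ?x = "min e (w0 - 2) / 2"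
      have "?x > 0" "?x < w0 - 2" "?x < e" using e w0 by (auto simp: min_def)
      then show "\<exists>x'\<in>complex_of_real ` {0<..<w0 - 2}. x' \<noteq> 0 \<and> dist x' 0 < e"
        by (intro bexI[of _ "of_real ?x"] imageI) (auto simp: norm_divide)
    qed
    fix z :: complex assume "z \<in> of_real ` {0<..<w0 - 2}"
    then obtain x where x: "z = of_real x" "0 < x" "x < w0 - 2" by auto
    have "(\<lambda>n. of_real (b n) * z ^ n) sums g z" "(\<lambda>n. of_real (b n) * z ^ n) sums B z"
      using gx[of x] Bs[of z] x by auto
    then show "g z - B z = 0" using sums_unique2 by force
  qed (use w0 z in \<open>auto simp: dist_norm\<close>)
  have "g has_fps_expansion Abs_fps (\<lambda>n. of_real (b n))"
  proof (rule has_fps_expansionI)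
    have "eventually (\<lambda>z. z \<in> ball 0 (w0 - 2)) (nhds (0 :: complex))"
      using w0 by (intro eventually_nhds_in_open) auto
    then show "eventually (\<lambda>u. (\<lambda>n. fps_nth (Abs_fps (\<lambda>n. of_real (b n))) n * u ^ n) sums g u) (nhds 0)"
      by eventually_elim (use gB Bs in force)
  qed
  from fps_nth_fps_expansion[OF this] have coef: "(deriv ^^ n) g 0 / fact n = of_real (b n)" for n
    by simp
  have gs: "(\<lambda>n. b n * x ^ n) sums Re (g (of_real x))" if "0 \<le> x" "x < w0 + 2" for x
  proof -
    have "(\<lambda>n. (deriv ^^ n) g 0 / fact n * (of_real x - 0) ^ n) sums g (of_real x)"
      by (rule holomorphic_power_series[OF gh]) (use that in auto)
    then have "(\<lambda>n. of_real (b n * x ^ n)) sums g (of_real x)" by (simp add: coef)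
    from sums_Re[OF this] show ?thesis by simp
  qed
  have "Re (g (of_real (w0 - w'))) \<le> Re (g (of_real (w0 - w)))"
    by (rule sums_le[OF _ gs gs]) (use w w0 b(1) in \<open>auto intro!: mult_left_mono power_mono\<close>)
  then show ?thesis by (simp add: g_def)
qed

section \<open>Growth of the modulus along circles and the half-plane property\<close>

lemma slit_cnj:
  assumes \<phi>: "\<phi> holomorphic_on slit"
    and real: "\<And>x :: real. x > 0 \<Longrightarrow> \<phi> (of_real x) = of_real (f x)" and z: "z \<in> slit"
  shows "\<phi> (cnj z) = cnj (\<phi> z)"
proof -
  have cs: "cnj ` slit = slit"
  proof -
    have "cnj w \<in> slit \<longleftrightarrow> w \<in> slit" for w by (simp add: slit_iff complex_nonpos_Reals_iff)
    then show ?thesis by (auto intro!: image_eqI[where f = cnj and x = "cnj _", OF complex_cnj_cnj[symmetric]])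
  qed
  have "cnj (\<phi> (cnj z)) - \<phi> z = 0"
  proof (rule analytic_continuation[where f = "\<lambda>z. cnj (\<phi> (cnj z)) - \<phi> z" and S = slit and U = "of_real ` {0<..}" and \<xi> = 1, OF _ slit_open])
    have "(cnj \<circ> \<phi> \<circ> cnj) holomorphic_on slit"
      by (rule holomorphic_on_compose_cnj_cnj) (use \<phi> cs slit_open in auto)
    then show "(\<lambda>z. cnj (\<phi> (cnj z)) - \<phi> z) holomorphic_on slit"
      by (intro holomorphic_intros \<phi>) (simp add: o_def)
    show "connected slit"
      unfolding slit_alt by (intro starlike_imp_connected starlike_slotted_complex_plane_left)
    show "complex_of_real ` {0<..} \<subseteq> slit" "1 \<in> slit" by (auto simp: slit_iff)
    show "1 islimpt complex_of_real ` {0<..}"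
      unfolding islimpt_approachable
    proof (intro allI impI)
      fix e :: real assume e: "e > 0"
      then show "\<exists>x'\<in>complex_of_real ` {0<..}. x' \<noteq> 1 \<and> dist x' 1 < e"
        by (intro bexI[of _ "of_real (1 + e / 2)"] imageI) (auto simp: dist_norm norm_divide)
    qed
    show "cnj (\<phi> (cnj z)) - \<phi> z = 0" if "z \<in> complex_of_real ` {0<..}" for z
      using that real by auto
  qed (use z in auto)
  then show ?thesis by (metis complex_cnj_cnj right_minus_eq)
qed

text \<open>For v = cis t the two factors of \<psi> are complex conjugates by reflection, so \<psi>
  (2 cos t) is the squared modulus, and 2 cos t decreases but stays above -2 on [0, pi). Zeros are
  excluded by comparison with t = 0, where the value is f u > 0.\<close>

lemma hcm_modulus_mono:
  assumes \<phi>: "\<phi> holomorphic_on slit" and f: "hcm f" and fpos: "\<And>x. x > 0 \<Longrightarrow> f x > 0"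
    and real: "\<And>x :: real. x > 0 \<Longrightarrow> \<phi> (of_real x) = of_real (f x)" and u: "u > 0"
    and t: "0 \<le> t" "t \<le> t'" "t' < pi"
  shows "(norm (\<phi> (of_real u * cis t)))\<^sup>2 \<le> (norm (\<phi> (of_real u * cis t')))\<^sup>2"
    and "\<phi> (of_real u * cis t) \<noteq> 0"
proof -
  obtain \<psi> where \<psi>: "\<psi> holomorphic_on {w. \<not> (Im w = 0 \<and> Re w \<le> -2)}"
    "\<And>v. v \<noteq> 0 \<Longrightarrow> \<psi> (v + inverse v) = \<phi> (of_real u * v) * \<phi> (of_real u * inverse v)"
    using slit_symmetric_function[OF \<phi> u] by auto
  obtain h where h: "laplace_fn h" "\<And>x. x > 0 \<Longrightarrow> f x * f (u\<^sup>2 / x) = h (x + u\<^sup>2 / x - 2 * sqrt (u\<^sup>2))"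
    using f[unfolded hcm_def, THEN conjunct2, rule_format, of "u\<^sup>2"] u by auto
  have \<psi>h: "\<psi> (of_real w) = of_real (h (u * (w - 2)))" if w: "w \<ge> 2" for w
  proof -
    \<comment> \<open>The larger root of v + 1 / v = w, real because w \<ge> 2.\<close>
    define v where "v = (w + sqrt (w\<^sup>2 - 4)) / 2"
    have d: "w\<^sup>2 - 4 \<ge> 0" using power_mono[OF w, of 2] by simp
    have v: "v > 0" using w d by (simp add: v_def add_pos_nonneg)
    have "(2 * v - w)\<^sup>2 = w\<^sup>2 - 4"
    proof -
      have "2 * v - w = sqrt (w\<^sup>2 - 4)" by (simp add: v_def field_simps)
      then show ?thesis using d by simp
    qed
    then have "v * v + 1 = w * v" by (simp add: power2_eq_square algebra_simps)
    then have vw: "v + inverse v = w" using v by (simp add: field_simps)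
    have "\<psi> (of_real w) = \<psi> (of_real v + inverse (of_real v))"
      unfolding vw[symmetric] by simp
    also have "\<dots> = \<phi> (of_real (u * v)) * \<phi> (of_real (u * inverse v))"
      using \<psi>(2)[of "of_real v"] v by simp
    also have "\<dots> = of_real (f (u * v) * f (u * inverse v))"
      using real[of "u * v"] real[of "u * inverse v"] u v by simp
    also have "f (u * v) * f (u * inverse v) = h (u * v + u * inverse v - 2 * u)"
      using h(2)[of "u * v"] u v by (simp add: power2_eq_square inverse_eq_divide)
    also have "u * v + u * inverse v - 2 * u = u * (w - 2)"
      by (simp add: vw[symmetric] algebra_simps)
    finally show ?thesis .
  qed
  have slit': "of_real u * cis t \<in> slit" if "0 \<le> t" "t < pi" for t
  proof (rule ccontr)
    assume "\<not> ?thesis"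
    then have *: "u * sin t = 0" "u * cos t \<le> 0" by (auto simp: slit_iff complex_nonpos_Reals_iff)
    then have "sin t = 0" "cos t \<le> 0" using u by (auto simp: mult_le_0_iff)
    then have "t = 0" using that sin_gt_zero[of t] by force
    then show False using \<open>cos t \<le> 0\<close> by simp
  qed
  have mod: "\<psi> (of_real (2 * cos t)) = of_real ((norm (\<phi> (of_real u * cis t)))\<^sup>2)" if "0 \<le> t" "t < pi" for t
  proof -
    have "of_real (2 * cos t) = cis t + inverse (cis t)"
      by (simp add: complex_eq_iff)
    then have "\<psi> (of_real (2 * cos t)) = \<phi> (of_real u * cis t) * \<phi> (of_real u * inverse (cis t))"
      using \<psi>(2)[of "cis t"] by simp
    also have "of_real u * inverse (cis t) = cnj (of_real u * cis t)"
      by (simp add: cis_cnj)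
    also have "\<phi> \<dots> = cnj (\<phi> (of_real u * cis t))"
      by (rule slit_cnj[OF \<phi> real slit'[OF that]])
    finally show ?thesis unfolding complex_norm_square .
  qed
  have mono: "(norm (\<phi> (of_real u * cis t)))\<^sup>2 \<le> (norm (\<phi> (of_real u * cis t')))\<^sup>2" if t: "0 \<le> t" "t \<le> t'" "t' < pi" for t t'
  proof -
    have "cos t' \<le> cos t" using t by (simp add: cos_mono_le_eq)
    moreover have "cos t' > -1" using t cos_monotone_0_pi[of t' pi] by simp
    ultimately have "Re (\<psi> (of_real (2 * cos t))) \<le> Re (\<psi> (of_real (2 * cos t')))"
      using u by (intro laplace_fn_continuation_antimono[OF \<psi>(1) h(1) _ \<psi>h]) auto
    then show ?thesis using mod[of t] mod[of t'] t by simp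
  qed
  show "(norm (\<phi> (of_real u * cis t)))\<^sup>2 \<le> (norm (\<phi> (of_real u * cis t')))\<^sup>2"
    by (rule mono[OF t])
  have "(norm (\<phi> (of_real u * cis 0)))\<^sup>2 \<le> (norm (\<phi> (of_real u * cis t)))\<^sup>2"
    by (rule mono) (use t in auto)
  then show "\<phi> (of_real u * cis t) \<noteq> 0"
    using fpos[OF u] real[OF u] by auto
qed

text \<open>Along z = u cis t the logarithmic derivative in t of the squared modulus of \<phi> is 2
  Re (\<i> z \<phi>' z / \<phi> z) = 2 Im (H z). Growth of the modulus with t is therefore exactly
  the sign condition on H.\<close>

lemma hcm_pick:
  assumes \<phi>: "\<phi> holomorphic_on slit" and f: "hcm f" and fpos: "\<And>x. x > 0 \<Longrightarrow> f x > 0"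
    and real: "\<And>x :: real. x > 0 \<Longrightarrow> \<phi> (of_real x) = of_real (f x)"
  defines "H \<equiv> \<lambda>z. - z * deriv \<phi> z / \<phi> z"
  shows "H holomorphic_on slit" "\<And>z. Im z > 0 \<Longrightarrow> Im (H z) \<ge> 0" "\<And>z. z \<in> slit \<Longrightarrow> H (cnj z) = cnj (H z)"
proof -
  have polar: "\<exists>u t. u > 0 \<and> 0 \<le> t \<and> t < pi \<and> z = of_real u * cis t" if "z \<in> slit" "Im z \<ge> 0" for z
  proof -
    have z: "z \<noteq> 0" "z \<notin> \<real>\<^sub>\<le>\<^sub>0" using that by (auto simp: slit_iff)
    have "Arg z \<ge> 0" using that(2) by (simp add: Arg_less_0)
    moreover have "Arg z < pi" using z Arg_le_pi[of z] Arg_eq_pi[of z] by (auto simp: less_le complex_nonpos_Reals_iff)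
    ultimately show ?thesis using z(1) by (intro exI[of _ "norm z"] exI[of _ "Arg z"]) (auto simp: cis_Arg sgn_div_norm scaleR_conv_of_real)
  qed
  have nz: "\<phi> z \<noteq> 0" if z: "z \<in> slit" for z
  proof (cases "Im z \<ge> 0")
    case True
    from polar[OF z True] hcm_modulus_mono(2)[OF \<phi> f fpos real] show ?thesis by blast
  next
    case False
    have "cnj z \<in> slit" using z by (simp add: slit_iff complex_nonpos_Reals_iff)
    from polar[OF this] False hcm_modulus_mono(2)[OF \<phi> f fpos real] have "\<phi> (cnj z) \<noteq> 0" by force
    then show ?thesis using slit_cnj[OF \<phi> real z] by simp
  qed
  have d\<phi>: "deriv \<phi> holomorphic_on slit" by (rule holomorphic_deriv[OF \<phi> slit_open])
  show Hh: "H holomorphic_on slit"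
    unfolding H_def by (intro holomorphic_intros \<phi> d\<phi> nz)
  have Hreal: "H (of_real x) = of_real (Re (H (of_real x)))" if x: "x > 0" for x :: real
  proof -
    have xs: "of_real x \<in> slit" using x by (simp add: slit_iff)
    have "(\<phi> has_field_derivative deriv \<phi> (of_real x)) (at (of_real x))"
      by (rule holomorphic_derivI[OF \<phi> slit_open xs])
    then have "((\<lambda>y. \<phi> (of_real y)) has_vector_derivative deriv \<phi> (of_real x)) (at x)"
      by (rule has_vector_derivative_real_field)
    then have "((\<lambda>y. Im (\<phi> (of_real y))) has_vector_derivative Im (deriv \<phi> (of_real x))) (at x)"
      by (rule bounded_linear.has_vector_derivative[OF bounded_linear_Im])
    then have "((\<lambda>y :: real. 0) has_real_derivative Im (deriv \<phi> (of_real x))) (at x)"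
      unfolding has_real_derivative_iff_has_vector_derivative
      by (rule has_vector_derivative_transform_within_open[of _ _ _ "{0<..}"]) (use x real in auto)
    then have "Im (deriv \<phi> (of_real x)) = 0" using DERIV_unique[OF _ DERIV_const] by blast
    then have "deriv \<phi> (of_real x) = of_real (Re (deriv \<phi> (of_real x)))" by (simp add: complex_eq_iff)
    then obtain d where "deriv \<phi> (of_real x) = of_real d" by blast
    then show ?thesis by (simp add: H_def real[OF x])
  qed
  then show "H (cnj z) = cnj (H z)" if "z \<in> slit" for z by (rule slit_cnj[OF Hh _ that])
  fix z assume z: "Im z > 0"
  have zs: "z \<in> slit" using z by (auto simp: slit_iff complex_nonpos_Reals_iff)
  obtain u t where ut: "u > 0" "0 \<le> t" "t < pi" "z = of_real u * cis t" using polar[OF zs] z by auto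
  have t0: "t > 0" using ut z by (cases "t = 0") auto
  define g where "g t = \<phi> (of_real u * cis t)" for t
  define g' where "g' = deriv \<phi> z * (\<i> * z)"
  have dg: "(g has_vector_derivative g') (at t)"
  proof -
    have "((\<lambda>t. of_real u * cis t) has_vector_derivative \<i> * z) (at t)"
      unfolding cis_conv_exp ut(4)
      by (auto intro!: derivative_eq_intros has_vector_derivative_real_field simp: cis_conv_exp)
    moreover have "(\<phi> has_field_derivative deriv \<phi> z) (at (of_real u * cis t))"
      using holomorphic_derivI[OF \<phi> slit_open zs] ut(4) by simp
    ultimately have "((\<phi> \<circ> (\<lambda>t. of_real u * cis t)) has_vector_derivative \<i> * z * deriv \<phi> z) (at t)"
      by (rule field_vector_diff_chain_at)
    then show ?thesis by (simp add: g_def[abs_def] g'_def o_def mult_ac)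
  qed
  have N: "((\<lambda>t. (norm (g t))\<^sup>2) has_real_derivative 2 * Re (cnj (g t) * g')) (at t)"
  proof -
    have dR: "((\<lambda>t. Re (g t)) has_real_derivative Re g') (at t)" "((\<lambda>t. Im (g t)) has_real_derivative Im g') (at t)"
      unfolding has_real_derivative_iff_has_vector_derivative
      by (rule bounded_linear.has_vector_derivative[OF bounded_linear_Re dg]
          bounded_linear.has_vector_derivative[OF bounded_linear_Im dg])+
    have "((\<lambda>t. (Re (g t))\<^sup>2 + (Im (g t))\<^sup>2) has_real_derivative 2 * Re (cnj (g t) * g')) (at t)"
      using DERIV_add[OF DERIV_power[OF dR(1), of 2] DERIV_power[OF dR(2), of 2]] by (simp add: algebra_simps)
    then show ?thesis by (simp add: cmod_power2)
  qed
  have "2 * Re (cnj (g t) * g') \<ge> 0"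
  proof (rule mono_on_imp_deriv_nonneg[OF _ N])
    show "mono_on {0<..<pi} (\<lambda>t. (norm (g t))\<^sup>2)"
      unfolding g_def using hcm_modulus_mono(1)[OF \<phi> f fpos real ut(1)] by (auto simp: mono_on_def)
  qed (use t0 ut in auto)
  moreover have "cnj (g t) * g' = (g' / g t) * of_real ((norm (g t))\<^sup>2)"
    using nz[OF zs] ut(4) unfolding complex_norm_square by (simp add: g_def)
  then have "Re (cnj (g t) * g') = Re (g' / g t) * (norm (g t))\<^sup>2"
    using Re_of_real_mult[of "(norm (g t))\<^sup>2" "g' / g t"] by (simp only: mult.commute)
  ultimately have "Re (g' / g t) * (norm (g t))\<^sup>2 \<ge> 0" by linarith
  moreover have "(norm (g t))\<^sup>2 > 0" using nz[OF zs] ut(4) by (simp add: g_def)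
  ultimately have "Re (g' / g t) \<ge> 0" by (simp only: zero_le_mult_iff) auto
  also have "g' / g t = - \<i> * H z" using ut(4) by (simp add: g_def g'_def H_def)
  finally show "Im (H z) \<ge> 0" by simp
qed

section \<open>The Thorin measure\<close>

lemma pick_kernel_bound:
  assumes "t > 0" "-1 \<le> c" "c \<le> (1::real)"
  shows "(1 - c) * t + (1 + c) \<ge> 2 * min t 1"
proof -
  have "(1 - c) * min t 1 + (1 + c) * min t 1 \<le> (1 - c) * t + (1 + c) * 1"
    using assms by (intro add_mono mult_left_mono) auto
  then show ?thesis by (simp add: algebra_simps)
qed

text \<open>As s decreases to 0, the integrand (1 - s) / (2 ((1 - c) s + (1 + c))) increases to 1 /
  (2 (1 + c)). Monotone convergence and the limit 0 of Hr give the integral for Hr 1; its finiteness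
  excludes mass at c = -1. If m = 0 nothing is known about \<tau>, hence the disjunction.\<close>

lemma pick_origin:
  fixes Hr :: "real \<Rightarrow> real"
  assumes m: "m \<ge> 0" and \<tau>: "real_distribution \<tau>" and supp: "AE c in \<tau>. c \<in> {-1..1}"
    and H: "\<And>s. s > 0 \<Longrightarrow> Hr s - Hr 1 = m * (\<integral>c. (s - 1) / (2 * ((1 - c) * s + (1 + c))) \<partial>\<tau>)"
    and H0: "(\<lambda>n. Hr (1 / real (n + 2))) \<longlonglongrightarrow> 0"
  shows "m = 0 \<or> (AE c in \<tau>. -1 < c)"
    and "(\<integral>\<^sup>+ c. ennreal (m / (2 * (1 + c))) \<partial>\<tau>) = ennreal (Hr 1)"
    and "Hr 1 \<ge> 0"
proof -
  interpret T: real_distribution \<tau> by (rule \<tau>)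
  define s where "s n = 1 / real (n + 2)" for n
  have s: "0 < s n" "s n < 1" for n by (auto simp: s_def)
  define a where "a n c = m * (1 - s n) / (2 * ((1 - c) * s n + (1 + c)))" for n c
  have [measurable]: "a n \<in> borel_measurable borel" for n unfolding a_def[abs_def] by measurable
  have D: "(1 - c) * s n + (1 + c) \<ge> 2 * s n" if "c \<in> {-1..1}" for n c
    using pick_kernel_bound[of "s n" c] s[of n] that by (simp add: min_def split: if_splits)
  have Dp: "(1 - c) * s n + (1 + c) > 0" if "c \<in> {-1..1}" for n c
    using D[OF that, of n] s[of n] by linarith
  have a0: "0 \<le> a n c" if "c \<in> {-1..1}" for n c
    using Dp[OF that, of n] m s[of n] by (simp add: a_def)
  have inta: "integrable \<tau> (a n)" for n
  proof (rule T.integrable_const_bound[where B = "m * (1 - s n) / (2 * (2 * s n))"])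
    show "AE c in \<tau>. norm (a n c) \<le> m * (1 - s n) / (2 * (2 * s n))"
    proof (rule eventually_mono[OF supp])
      fix c :: real assume c: "c \<in> {-1..1}"
      have "a n c \<le> m * (1 - s n) / (2 * (2 * s n))"
        unfolding a_def using D[OF c, of n] s[of n] m by (intro divide_left_mono mult_left_mono mult_pos_pos) auto
      then show "norm (a n c) \<le> m * (1 - s n) / (2 * (2 * s n))" using a0[OF c, of n] by simp
    qed
  qed measurable
  have aH: "(\<integral>c. a n c \<partial>\<tau>) = Hr 1 - Hr (s n)" for n
  proof -
    have "(\<integral>c. a n c \<partial>\<tau>) = (\<integral>c. - m * ((s n - 1) / (2 * ((1 - c) * s n + (1 + c)))) \<partial>\<tau>)"
      by (intro Bochner_Integration.integral_cong refl) (simp add: a_def minus_divide_left algebra_simps)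
    also have "\<dots> = - m * (\<integral>c. (s n - 1) / (2 * ((1 - c) * s n + (1 + c))) \<partial>\<tau>)"
      by (rule integral_mult_right_zero)
    also have "\<dots> = Hr 1 - Hr (s n)" unfolding mult_minus_left H[OF s(1), symmetric] by simp
    finally show ?thesis .
  qed
  have anH: "(\<integral>\<^sup>+ c. ennreal (a n c) \<partial>\<tau>) = ennreal (Hr 1 - Hr (s n))" for n
  proof -
    have "(\<integral>\<^sup>+ c. ennreal (a n c) \<partial>\<tau>) = ennreal (\<integral>c. a n c \<partial>\<tau>)"
      by (rule nn_integral_eq_integral[OF inta]) (rule eventually_mono[OF supp a0])
    also note aH
    finally show ?thesis .
  qed
  \<comment> \<open>Monotone convergence asks for monotonicity at every c, so the integrand is set
    to 0 outside [-1, 1].\<close>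
  define b where "b n c = (if c \<in> {-1..1} then ennreal (a n c) else 0)" for n c
  have [measurable]: "b n \<in> borel_measurable borel" for n unfolding b_def[abs_def] by measurable
  have bH: "(\<integral>\<^sup>+ c. b n c \<partial>\<tau>) = ennreal (Hr 1 - Hr (s n))" for n
    unfolding anH[symmetric] by (rule nn_integral_cong_AE, rule eventually_mono[OF supp]) (simp add: b_def)
  have inc: "incseq b"
    unfolding incseq_def le_fun_def
  proof (intro allI impI)
    fix i j :: nat and c :: real assume ij: "i \<le> j"
    show "b i c \<le> b j c"
    proof (cases "c \<in> {-1..1}")
      case c: True
      have sj: "s j \<le> s i" using ij by (auto simp: s_def intro!: divide_left_mono)
      have "(1 - s i) * ((1 - c) * s j + (1 + c)) \<le> (1 - s j) * ((1 - c) * s i + (1 + c))"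
      proof -
        have "(1 - s j) * ((1 - c) * s i + (1 + c)) - (1 - s i) * ((1 - c) * s j + (1 + c)) = 2 * (s i - s j)"
          by (simp add: algebra_simps)
        also have "\<dots> \<ge> 0" using sj by simp
        finally show ?thesis by (simp only: diff_ge_0_iff_ge)
      qed
      then have "(1 - s i) / ((1 - c) * s i + (1 + c)) \<le> (1 - s j) / ((1 - c) * s j + (1 + c))"
        using Dp[OF c, of i] Dp[OF c, of j] by (simp add: divide_le_eq le_divide_eq mult_ac)
      then have "m / 2 * ((1 - s i) / ((1 - c) * s i + (1 + c))) \<le> m / 2 * ((1 - s j) / ((1 - c) * s j + (1 + c)))"
        using m by (intro mult_left_mono) auto
      then have "a i c \<le> a j c" by (simp add: a_def)
      then show ?thesis using c by (simp add: b_def ennreal_leI)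
    qed (auto simp: b_def)
  qed
  have lim: "(\<lambda>n. ennreal (Hr 1 - Hr (s n))) \<longlonglongrightarrow> ennreal (Hr 1 - 0)"
    using H0 unfolding s_def[symmetric] by (intro tendsto_ennrealI tendsto_diff tendsto_const)
  have "(\<lambda>n. \<integral>\<^sup>+ c. b n c \<partial>\<tau>) \<longlonglongrightarrow> (SUP n. \<integral>\<^sup>+ c. b n c \<partial>\<tau>)"
    by (rule LIMSEQ_SUP) (use inc in \<open>auto simp: incseq_def le_fun_def intro!: nn_integral_mono\<close>)
  then have "(SUP n. \<integral>\<^sup>+ c. b n c \<partial>\<tau>) = ennreal (Hr 1)"
    using lim unfolding bH by (metis LIMSEQ_unique diff_zero)
  then have SUPH: "(\<integral>\<^sup>+ c. (SUP n. b n c) \<partial>\<tau>) = ennreal (Hr 1)"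
    by (subst nn_integral_monotone_convergence_SUP[OF inc]) measurable
  then have "AE c in \<tau>. (SUP n. b n c) \<noteq> \<infinity>"
    by (intro nn_integral_noteq_infinite) (auto simp: borel_measurable_SUP)
  with supp have AE1: "AE c in \<tau>. m = 0 \<or> -1 < c"
  proof eventually_elim
    case (elim c)
    show ?case
    proof (rule ccontr)
      assume "\<not> ?thesis"
      with elim m have c: "c = -1" and mp: "m > 0" by auto
      \<comment> \<open>At c = -1 the denominator is 4 s n, and 1 / s n - 1 = n + 1; so the
        integrand is unbounded in n.\<close>
      have an: "a n c = m * real (n + 1) / 4" for n
        by (simp add: a_def c s_def field_simps)
      have "ennreal (real k) \<le> (SUP n. b n c)" for k
      proof -
        obtain n :: nat where n: "4 * real k / m \<le> real n" using real_arch_simple by blast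
        then have "4 * real k \<le> m * real n" using mp by (simp add: divide_le_eq mult.commute)
        also have "\<dots> \<le> m * real (n + 1)" using mp by (intro mult_left_mono) auto
        finally have "ennreal (real k) \<le> b n c" by (auto simp: b_def c an[unfolded c] intro!: ennreal_leI)
        then show ?thesis by (rule SUP_upper2[OF UNIV_I])
      qed
      then have "(SUP k. of_nat k) \<le> (SUP n. b n c)" by (intro SUP_least) (simp add: ennreal_of_nat_eq_real_of_nat)
      then show False using elim by (simp add: ennreal_SUP_of_nat_eq_top top_unique)
    qed
  qed
  then show "m = 0 \<or> (AE c in \<tau>. -1 < c)" by (cases "m = 0") auto
  have "(\<integral>\<^sup>+ c. ennreal (m / (2 * (1 + c))) \<partial>\<tau>) = (\<integral>\<^sup>+ c. (SUP n. b n c) \<partial>\<tau>)"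
  proof (rule nn_integral_cong_AE)
    show "AE c in \<tau>. ennreal (m / (2 * (1 + c))) = (SUP n. b n c)"
      using supp AE1
    proof eventually_elim
      case (elim c)
      show ?case
      proof (cases "m = 0")
        case True
        then show ?thesis by (simp add: b_def a_def)
      next
        case False
        with elim have c: "c > -1" by simp
        have "(\<lambda>n. b n c) \<longlonglongrightarrow> (SUP n. b n c)"
          by (rule LIMSEQ_SUP) (use inc in \<open>auto simp: incseq_def le_fun_def\<close>)
        moreover have "(\<lambda>n. b n c) \<longlonglongrightarrow> ennreal (m / (2 * (1 + c)))"
        proof -
          have "s \<longlonglongrightarrow> 0" unfolding s_def by real_asymp
          then have "(\<lambda>n. a n c) \<longlonglongrightarrow> m * (1 - 0) / (2 * ((1 - c) * 0 + (1 + c)))"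
            unfolding a_def using c by (intro tendsto_intros) auto
          then show ?thesis using elim by (auto simp: b_def intro!: tendsto_ennrealI)
        qed
        ultimately show ?thesis using LIMSEQ_unique by blast
      qed
    qed
  qed
  with SUPH show "(\<integral>\<^sup>+ c. ennreal (m / (2 * (1 + c))) \<partial>\<tau>) = ennreal (Hr 1)" by simp
  have "Hr 1 - Hr (s n) \<ge> 0" for n
  proof -
    have "0 \<le> (\<integral>c. a n c \<partial>\<tau>)" by (rule integral_nonneg_AE) (rule eventually_mono[OF supp a0])
    also note aH
    finally show ?thesis .
  qed
  then show "Hr 1 \<ge> 0"
    using tendsto_diff[OF tendsto_const H0, of "Hr 1"] unfolding s_def
    by (intro LIMSEQ_le_const[of _ "Hr 1"]) auto
qed

text \<open>Inserting the integral for Hr 1 from \<open>pick_origin\<close> frees the formula from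
  its normalisation at 1: the two fractions combine to t m / ((1 + c) ((1 - c) t + (1 + c))), which
  is nonnegative.\<close>

lemma pick_kernel_representation:
  fixes Hr :: "real \<Rightarrow> real"
  assumes m: "m \<ge> 0" and \<tau>: "real_distribution \<tau>" and supp: "AE c in \<tau>. c \<in> {-1..1}"
    and H: "\<And>s. s > 0 \<Longrightarrow> Hr s - Hr 1 = m * (\<integral>c. (s - 1) / (2 * ((1 - c) * s + (1 + c))) \<partial>\<tau>)"
    and H0: "(\<lambda>n. Hr (1 / real (n + 2))) \<longlonglongrightarrow> 0"
    and t: "t > 0"
  shows "ennreal (Hr t / t) = (\<integral>\<^sup>+ c. ennreal (m / ((1 + c) * ((1 - c) * t + (1 + c)))) \<partial>\<tau>)"
    and "Hr t \<ge> 0"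
proof -
  interpret T: real_distribution \<tau> by (rule \<tau>)
  note o = pick_origin[OF m \<tau> supp H H0]
  have i1: "integrable \<tau> (\<lambda>c. m / (2 * (1 + c)))" and I1: "(\<integral>c. m / (2 * (1 + c)) \<partial>\<tau>) = Hr 1"
  proof -
    have "AE c in \<tau>. 0 \<le> m / (2 * (1 + c))"
      by (rule eventually_mono[OF supp]) (use m in auto)
    from nn_integral_eq_integrable[OF _ this o(3)] o(2)
    show "integrable \<tau> (\<lambda>c. m / (2 * (1 + c)))" "(\<integral>c. m / (2 * (1 + c)) \<partial>\<tau>) = Hr 1" by auto
  qed
  let ?D = "\<lambda>c. (1 - c) * t + (1 + c)"
  have i2: "integrable \<tau> (\<lambda>c. (t - 1) / (2 * ?D c))"
  proof (rule T.integrable_const_bound[where B = "\<bar>t - 1\<bar> / (2 * (2 * min t 1))"])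
    show "AE c in \<tau>. norm ((t - 1) / (2 * ?D c)) \<le> \<bar>t - 1\<bar> / (2 * (2 * min t 1))"
    proof (rule eventually_mono[OF supp])
      fix c :: real assume c: "c \<in> {-1..1}"
      have D: "2 * min t 1 \<le> ?D c" using pick_kernel_bound[OF t] c by auto
      have mp: "0 < 2 * min t 1" using t by auto
      with D have "0 < ?D c" by linarith
      then have "norm ((t - 1) / (2 * ?D c)) = \<bar>t - 1\<bar> / (2 * ?D c)" by (simp add: abs_divide abs_mult)
      also have "\<dots> \<le> \<bar>t - 1\<bar> / (2 * (2 * min t 1))"
        using D mp \<open>0 < ?D c\<close> by (intro divide_left_mono mult_left_mono mult_pos_pos) auto
      finally show "norm ((t - 1) / (2 * ?D c)) \<le> \<bar>t - 1\<bar> / (2 * (2 * min t 1))" .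
    qed
  qed measurable
  have "Hr t = (\<integral>c. m / (2 * (1 + c)) \<partial>\<tau>) + m * (\<integral>c. (t - 1) / (2 * ?D c) \<partial>\<tau>)"
    using H[OF t] I1 by simp
  also have "\<dots> = (\<integral>c. m / (2 * (1 + c)) + m * ((t - 1) / (2 * ?D c)) \<partial>\<tau>)"
    unfolding Bochner_Integration.integral_add[OF i1 integrable_mult_right[OF i2]] integral_mult_right_zero ..
  finally have Ht: "Hr t = \<dots>" .
  have pt: "AE c in \<tau>. m / (2 * (1 + c)) + m * ((t - 1) / (2 * ?D c)) = t * (m / ((1 + c) * ?D c))"
    and nn: "AE c in \<tau>. 0 \<le> m / ((1 + c) * ?D c)"
  proof -
    have "AE c in \<tau>. m = 0 \<or> -1 < c" using o(1) by auto
    with supp have "AE c in \<tau>. m / (2 * (1 + c)) + m * ((t - 1) / (2 * ?D c)) = t * (m / ((1 + c) * ?D c)) \<and> 0 \<le> m / ((1 + c) * ?D c)"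
    proof eventually_elim
      case (elim c)
      show ?case
      proof (cases "m = 0")
        case False
        with elim have c: "1 + c > 0" by simp
        have D: "?D c > 0" using pick_kernel_bound[OF t, of c] elim t by (auto simp: min_def split: if_splits)
        have e: "?D c + (t - 1) * (1 + c) = 2 * t" by (simp add: algebra_simps)
        have "m / (2 * (1 + c)) + m * ((t - 1) / (2 * ?D c)) = m * (?D c + (t - 1) * (1 + c)) / (2 * ((1 + c) * ?D c))"
        proof -
          have "m / (2 * a) + m * ((t - 1) / (2 * b)) = m * (b + (t - 1) * a) / (2 * (a * b))"
            if "a > 0" "b > 0" for a b :: real
            using that by (simp add: field_simps)
          from this[OF c D] show ?thesis .
        qed
        then show ?thesis using c D m unfolding e by simp
      qed simp
    qed
    then show "AE c in \<tau>. m / (2 * (1 + c)) + m * ((t - 1) / (2 * ?D c)) = t * (m / ((1 + c) * ?D c))"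
       "AE c in \<tau>. 0 \<le> m / ((1 + c) * ?D c)" by (auto elim: eventually_mono)
  qed
  have i3: "integrable \<tau> (\<lambda>c. m / ((1 + c) * ?D c))"
  proof -
    have "integrable \<tau> (\<lambda>c. m / (2 * (1 + c)) + m * ((t - 1) / (2 * ?D c)))"
      by (intro Bochner_Integration.integrable_add i1 integrable_mult_right i2)
    then have "integrable \<tau> (\<lambda>c. t * (m / ((1 + c) * ?D c)))"
      by (rule integrable_cong_AE_imp) (use pt in \<open>auto elim: eventually_mono\<close>)
    then have "integrable \<tau> (\<lambda>c. 1 / t * (t * (m / ((1 + c) * ?D c))))" by (rule integrable_mult_right)
    moreover have "(\<lambda>c. 1 / t * (t * (m / ((1 + c) * ?D c)))) = (\<lambda>c. m / ((1 + c) * ?D c))"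
      using t by (simp add: fun_eq_iff)
    ultimately show ?thesis by (simp only:)
  qed
  have "Hr t = (\<integral>c. t * (m / ((1 + c) * ?D c)) \<partial>\<tau>)"
    unfolding Ht by (rule integral_cong_AE) (use pt in auto)
  also have "\<dots> = t * (\<integral>c. m / ((1 + c) * ?D c) \<partial>\<tau>)" by (rule integral_mult_right_zero)
  finally have Htt: "Hr t / t = (\<integral>c. m / ((1 + c) * ?D c) \<partial>\<tau>)" using t by simp
  show "ennreal (Hr t / t) = (\<integral>\<^sup>+ c. ennreal (m / ((1 + c) * ?D c)) \<partial>\<tau>)"
    unfolding Htt by (rule nn_integral_eq_integral[symmetric, OF i3 nn])
  have "Hr t / t \<ge> 0" unfolding Htt by (rule integral_nonneg_AE[OF nn])
  then show "Hr t \<ge> 0" using t by (simp add: zero_le_divide_iff)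
qed

text \<open>The parameter \<open>c\<close> corresponds to the point \<open>u = (1 + c) / (1 - c)\<close> of the Thorin measure; \<open>c = 1\<close>
  stands for \<open>u = \<infinity>\<close>, that is, for the drift.\<close>

definition thorin_kernel :: "real \<Rightarrow> real \<Rightarrow> real" where
  "thorin_kernel c s = (if c = 1 then s / 4 else ln (1 + s * ((1 - c) / (1 + c))) / ((1 + c) * (1 - c)))"

lemma thorin_kernel_deriv:
  assumes "-1 < c" "c \<le> 1" "t \<ge> 0"
  shows "(thorin_kernel c has_real_derivative 1 / ((1 + c) * ((1 - c) * t + (1 + c)))) (at t)"
proof (cases "c = 1")
  case True
  have "((\<lambda>s. s / 4) has_real_derivative 1 / 4) (at t)" by (auto intro!: derivative_eq_intros)
  then show ?thesis using True by (simp add: thorin_kernel_def[abs_def])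
next
  case False
  with assms have c: "1 + c > 0" "1 - c > 0" by auto
  have pos: "1 + t * ((1 - c) / (1 + c)) > 0" using assms c by (intro add_pos_nonneg) auto
  have "((\<lambda>s. ln (1 + s * ((1 - c) / (1 + c))) / ((1 + c) * (1 - c))) has_real_derivative
      ((1 - c) / (1 + c)) / (1 + t * ((1 - c) / (1 + c))) / ((1 + c) * (1 - c))) (at t)"
    using pos c by (auto intro!: derivative_eq_intros)
  also have "((1 - c) / (1 + c)) / (1 + t * ((1 - c) / (1 + c))) / ((1 + c) * (1 - c)) = 1 / ((1 + c) * ((1 - c) * t + (1 + c)))"
  proof -
    have e: "1 + t * ((1 - c) / (1 + c)) = ((1 - c) * t + (1 + c)) / (1 + c)" using c by (simp add: field_simps)
    show ?thesis unfolding e using c by simp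
  qed
  finally show ?thesis using False by (simp add: thorin_kernel_def[abs_def])
qed

lemma thorin_kernel_deriv_nonneg:
  assumes "-1 < c" "c \<le> 1" "t \<ge> (0::real)"
  shows "0 \<le> 1 / ((1 + c) * ((1 - c) * t + (1 + c)))"
proof -
  have "1 + c \<ge> 0" "(1 - c) * t \<ge> 0" using assms by auto
  then have "(1 + c) * ((1 - c) * t + (1 + c)) \<ge> 0" by (simp only: mult_nonneg_nonneg add_nonneg_nonneg)
  then show ?thesis by simp
qed

text \<open>Here f is the logarithm of the transform. Integrating the kernel of
  \<open>pick_kernel_representation\<close> over [d, s] and exchanging integrals gives differences
  of \<open>thorin_kernel\<close>, its antiderivative. Then d decreases to 0, where both f and
  \<open>thorin_kernel\<close> tend to 0.\<close>

lemma thorin_representation: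
  fixes f Hr :: "real \<Rightarrow> real"
  assumes m: "m \<ge> 0" and \<tau>: "real_distribution \<tau>" and supp: "AE c in \<tau>. c \<in> {-1..1}"
    and H: "\<And>s. s > 0 \<Longrightarrow> Hr s - Hr 1 = m * (\<integral>c. (s - 1) / (2 * ((1 - c) * s + (1 + c))) \<partial>\<tau>)"
    and H0: "(\<lambda>n. Hr (1 / real (n + 2))) \<longlonglongrightarrow> 0"
    and f: "\<And>s. s > 0 \<Longrightarrow> (f has_real_derivative - (Hr s / s)) (at s)"
    and f0: "(f \<longlongrightarrow> 0) (at_right 0)" and s: "s > 0"
  shows "ennreal (- f s) = (\<integral>\<^sup>+ c. (if -1 < c \<and> c \<le> 1 then ennreal (m * thorin_kernel c s) else 0) \<partial>\<tau>)" "f s \<le> 0"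
proof -
  interpret T: real_distribution \<tau> by (rule \<tau>)
  interpret pair_sigma_finite \<tau> lborel ..
  note K = pick_kernel_representation[OF m \<tau> supp H H0]
  have AEc: "AE c in \<tau>. m = 0 \<or> (-1 < c \<and> c \<le> 1)"
  proof -
    have "AE c in \<tau>. m = 0 \<or> -1 < c" using pick_origin(1)[OF m \<tau> supp H H0] by auto
    with supp show ?thesis by eventually_elim auto
  qed
  \<comment> \<open>Parameters outside (-1, 1] are given the value 0; by \<open>AEc\<close> they
    carry no weight unless m = 0, when the kernel vanishes anyway.\<close>
  define k where "k c t = (if -1 < c \<and> c \<le> 1 then ennreal (m / ((1 + c) * ((1 - c) * t + (1 + c)))) else 0)" for c t
  have [measurable]: "case_prod k \<in> borel_measurable (borel \<Otimes>\<^sub>M borel)"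
    unfolding k_def[abs_def] by measurable
  have step: "ennreal (f d - f s) = (\<integral>\<^sup>+ c. (if -1 < c \<and> c \<le> 1 then ennreal (m * (thorin_kernel c s - thorin_kernel c d)) else 0) \<partial>\<tau>)"
    and step0: "f s \<le> f d" if d: "0 < d" "d \<le> s" for d
  proof -
    have "((\<lambda>t. - (Hr t / t)) has_integral f s - f d) {d..s}"
    proof (rule fundamental_theorem_of_calculus[OF d(2)])
      fix t assume "t \<in> {d..s}"
      then have "t > 0" using d by simp
      from has_field_derivative_at_within[OF f[OF this], of "{d..s}"]
      show "(f has_vector_derivative - (Hr t / t)) (at t within {d..s})"
        by (simp only: has_real_derivative_iff_has_vector_derivative)
    qed
    from has_integral_neg[OF this] have I: "((\<lambda>t. Hr t / t) has_integral f d - f s) {d..s}" by simp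
    have H0': "0 \<le> Hr t / t" if "t \<in> {d..s}" for t using K(2)[of t] d that by simp
    show "f s \<le> f d" using has_integral_nonneg[OF I H0'] by simp
    have "ennreal (f d - f s) = (\<integral>\<^sup>+ t. ennreal (indicator {d..s} t * (Hr t / t)) \<partial>lborel)"
      by (rule nn_integral_has_integral_lebesgue[OF H0' I, unfolded nn_integral_completion, symmetric])
    also have "\<dots> = (\<integral>\<^sup>+ t. \<integral>\<^sup>+ c. indicator {d..s} t * k c t \<partial>\<tau> \<partial>lborel)"
    proof (rule nn_integral_cong)
      fix t
      show "ennreal (indicator {d..s} t * (Hr t / t)) = (\<integral>\<^sup>+ c. indicator {d..s} t * k c t \<partial>\<tau>)"
      proof (cases "t \<in> {d..s}")
        case True
        have "(\<integral>\<^sup>+ c. k c t \<partial>\<tau>) = (\<integral>\<^sup>+ c. ennreal (m / ((1 + c) * ((1 - c) * t + (1 + c)))) \<partial>\<tau>)"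
          by (rule nn_integral_cong_AE, rule eventually_mono[OF AEc]) (auto simp: k_def)
        then show ?thesis using True K(1)[of t] d by simp
      qed simp
    qed
    also have "\<dots> = (\<integral>\<^sup>+ c. \<integral>\<^sup>+ t. indicator {d..s} t * k c t \<partial>lborel \<partial>\<tau>)"
      by (rule Fubini') measurable
    also have "\<dots> = (\<integral>\<^sup>+ c. (if -1 < c \<and> c \<le> 1 then ennreal (m * (thorin_kernel c s - thorin_kernel c d)) else 0) \<partial>\<tau>)"
    proof (rule nn_integral_cong)
      fix c
      show "(\<integral>\<^sup>+ t. indicator {d..s} t * k c t \<partial>lborel) = (if -1 < c \<and> c \<le> 1 then ennreal (m * (thorin_kernel c s - thorin_kernel c d)) else 0)"
      proof (cases "-1 < c \<and> c \<le> 1")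
        case True
        let ?g = "\<lambda>t. m / ((1 + c) * ((1 - c) * t + (1 + c)))"
        have "(\<integral>\<^sup>+ t. indicator {d..s} t * k c t \<partial>lborel) = (\<integral>\<^sup>+ t. ennreal (?g t) * indicator {d..s} t \<partial>lborel)"
          using True by (simp add: k_def mult.commute)
        also have "\<dots> = ennreal (m * thorin_kernel c s - m * thorin_kernel c d)"
        proof (rule nn_integral_FTC_Icc[OF _ _ _ d(2)])
          fix t assume "t \<in> {d..s}"
          then have t: "d \<le> t" "t \<le> s" by auto
          show "((\<lambda>t. m * thorin_kernel c t) has_real_derivative ?g t) (at t)"
            using DERIV_cmult[OF thorin_kernel_deriv[of c t], of m] True t d by simp
          show "0 \<le> ?g t" using m True t d thorin_kernel_deriv_nonneg[of c t] by (simp add: divide_inverse)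
        qed measurable
        finally show ?thesis using True by (simp add: right_diff_distrib)
      next
        case False
        then have "k c t = 0" for t by (auto simp: k_def)
        then show ?thesis using False by auto
      qed
    qed
    finally show "ennreal (f d - f s) = (\<integral>\<^sup>+ c. (if -1 < c \<and> c \<le> 1 then ennreal (m * (thorin_kernel c s - thorin_kernel c d)) else 0) \<partial>\<tau>)" .
  qed
  define d where "d n = s / real (n + 1)" for n :: nat
  have d: "0 < d n" "d n \<le> s" for n using s by (auto simp: d_def divide_le_eq mult_le_cancel_left1)
  have dlim: "d \<longlonglongrightarrow> 0" unfolding d_def by real_asymp
  have flim: "(\<lambda>n. f (d n)) \<longlonglongrightarrow> 0"
    by (rule filterlim_compose[OF f0]) (auto simp: filterlim_at d dlim less_imp_neq[OF d(1), symmetric] intro!: always_eventually)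
  have "(\<lambda>n. f (d n) - f s) \<longlonglongrightarrow> 0 - f s" by (intro tendsto_intros flim)
  then have L1: "(\<lambda>n. ennreal (f (d n) - f s)) \<longlonglongrightarrow> ennreal (- f s)" by (simp add: tendsto_ennrealI)
  show "f s \<le> 0" by (rule LIMSEQ_le_const[OF flim]) (use step0 d in auto)
  define G where "G n c = (if -1 < c \<and> c \<le> 1 then ennreal (m * (thorin_kernel c s - thorin_kernel c (d n))) else 0)" for n c
  have mono: "thorin_kernel c x \<le> thorin_kernel c y" if c: "-1 < c" "c \<le> 1" and xy: "0 \<le> x" "x \<le> y" for c x y
  proof (rule DERIV_nonneg_imp_nondecreasing[OF xy(2)])
    fix t assume t: "x \<le> t" "t \<le> y"
    show "\<exists>z. (thorin_kernel c has_real_derivative z) (at t) \<and> z \<ge> 0"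
      using thorin_kernel_deriv[OF c, of t] t xy c
        thorin_kernel_deriv_nonneg[OF c, of t] by auto
  qed
  have "(\<lambda>n. \<integral>\<^sup>+ c. G n c \<partial>\<tau>) \<longlonglongrightarrow> (\<integral>\<^sup>+ c. (if -1 < c \<and> c \<le> 1 then ennreal (m * thorin_kernel c s) else 0) \<partial>\<tau>)"
  proof (rule nn_integral_LIMSEQ)
    show "incseq G"
      unfolding incseq_def le_fun_def
    proof (intro allI impI)
      fix i j :: nat and c assume ij: "i \<le> j"
      have "d j \<le> d i" using ij s by (auto simp: d_def intro!: divide_left_mono)
      then show "G i c \<le> G j c" using mono[of c "d j" "d i"] d[of j] m
        by (auto simp: G_def intro!: ennreal_leI mult_left_mono)
    qed
    show "G n \<in> borel_measurable \<tau>" for n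
      unfolding G_def[abs_def] thorin_kernel_def by measurable
    fix c
    show "(\<lambda>n. G n c) \<longlonglongrightarrow> (if -1 < c \<and> c \<le> 1 then ennreal (m * thorin_kernel c s) else 0)"
    proof (cases "-1 < c \<and> c \<le> 1")
      case True
      have "isCont (thorin_kernel c) 0" by (rule DERIV_isCont[OF thorin_kernel_deriv]) (use True in auto)
      moreover have "thorin_kernel c 0 = 0" by (simp add: thorin_kernel_def)
      ultimately have "(\<lambda>n. thorin_kernel c (d n)) \<longlonglongrightarrow> 0"
        using isCont_tendsto_compose[OF _ dlim, of "thorin_kernel c"] by simp
      then have "(\<lambda>n. m * (thorin_kernel c s - thorin_kernel c (d n))) \<longlonglongrightarrow> m * (thorin_kernel c s - 0)"
        by (intro tendsto_intros)
      then show ?thesis using True by (simp add: G_def tendsto_ennrealI)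
    next
      case False
      then have "G n c = 0" for n by (auto simp: G_def)
      then show ?thesis using False by auto
    qed
  qed
  moreover have "(\<integral>\<^sup>+ c. G n c \<partial>\<tau>) = ennreal (f (d n) - f s)" for n
    unfolding step[OF d, of n] G_def ..
  ultimately show "ennreal (- f s) = (\<integral>\<^sup>+ c. (if -1 < c \<and> c \<le> 1 then ennreal (m * thorin_kernel c s) else 0) \<partial>\<tau>)"
    using L1 LIMSEQ_unique by simp
qed

section \<open>Holomorphic extension of Laplace transforms\<close>

text \<open>Only the integrand is assumed to be dominated. Cauchy's inequality on small circles
  bounds its derivative by a multiple of g, the mean value inequality passes this to difference
  quotients, and dominated convergence applies to them.\<close>

lemma holomorphic_on_integral:
  fixes F :: "complex \<Rightarrow> 'a \<Rightarrow> complex"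
  assumes S: "open S" and hol: "\<And>x. x \<in> space M \<Longrightarrow> (\<lambda>z. F z x) holomorphic_on S"
    and meas: "\<And>z. z \<in> S \<Longrightarrow> F z \<in> borel_measurable M"
    and bound: "\<And>z. z \<in> S \<Longrightarrow> \<exists>e>0. \<exists>g. integrable M g \<and> (\<forall>w\<in>ball z e. \<forall>x\<in>space M. norm (F w x) \<le> g x)"
  shows "(\<lambda>z. \<integral>x. F z x \<partial>M) holomorphic_on S"
  unfolding holomorphic_on_open[OF S]
proof
  fix z0 assume z0: "z0 \<in> S"
  obtain e1 where e1: "e1 > 0" "ball z0 e1 \<subseteq> S" using S z0 by (meson open_contains_ball)
  obtain e2 g where e2: "e2 > 0" "integrable M g" "\<And>w x. w \<in> ball z0 e2 \<Longrightarrow> x \<in> space M \<Longrightarrow> norm (F w x) \<le> g x"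
    using bound[OF z0] by blast
  define e where "e = min e1 e2"
  have e: "e > 0" "ball z0 e \<subseteq> S" "\<And>w x. w \<in> ball z0 e \<Longrightarrow> x \<in> space M \<Longrightarrow> norm (F w x) \<le> g x"
    using e1 e2 by (auto simp: e_def)
  define D where "D x = deriv (\<lambda>z. F z x) z0" for x
  have der: "((\<lambda>z. F z x) has_field_derivative deriv (\<lambda>z. F z x) w) (at w)" if "w \<in> ball z0 e" "x \<in> space M" for w x
    by (rule holomorphic_derivI[OF hol S]) (use that e in auto)
  \<comment> \<open>Circles of radius e / 4 around points of the ball of radius e / 2 stay in the
    ball of radius e, whence the factor 4 / e.\<close>
  have lip: "norm (F w x - F z0 x) \<le> 4 / e * g x * norm (w - z0)" if w: "w \<in> ball z0 (e / 2)" and x: "x \<in> space M" for w x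
  proof (rule field_differentiable_bound[where S = "ball z0 (e / 2)" and f' = "\<lambda>w. deriv (\<lambda>z. F z x) w"])
    fix \<xi> assume \<xi>: "\<xi> \<in> ball z0 (e / 2)"
    have sub: "cball \<xi> (e / 4) \<subseteq> ball z0 e"
    proof
      fix y assume "y \<in> cball \<xi> (e / 4)"
      then have "dist z0 y \<le> dist z0 \<xi> + e / 4" using dist_triangle[of z0 y \<xi>] by (simp add: mem_cball)
      then show "y \<in> ball z0 e" using \<xi> e(1) by auto
    qed
    show "((\<lambda>z. F z x) has_field_derivative deriv (\<lambda>z. F z x) \<xi>) (at \<xi> within ball z0 (e / 2))"
      by (rule has_field_derivative_at_within[OF der]) (use \<xi> x e(1) in auto)
    have hol': "(\<lambda>z. F z x) holomorphic_on cball \<xi> (e / 4)"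
      by (rule holomorphic_on_subset[OF hol[OF x]]) (use sub e in auto)
    have "norm ((deriv ^^ 1) (\<lambda>z. F z x) \<xi>) \<le> fact 1 * g x / (e / 4) ^ 1"
    proof (rule Cauchy_inequality)
      show "(\<lambda>z. F z x) holomorphic_on ball \<xi> (e / 4)"
        by (rule holomorphic_on_subset[OF hol']) auto
      show "continuous_on (cball \<xi> (e / 4)) (\<lambda>z. F z x)" by (rule holomorphic_on_imp_continuous_on[OF hol'])
      show "norm (F y x) \<le> g x" if "norm (\<xi> - y) = e / 4" for y
        by (rule e(3)[OF _ x]) (use sub that in \<open>auto simp: dist_norm\<close>)
    qed (use e in auto)
    then show "norm (deriv (\<lambda>z. F z x) \<xi>) \<le> 4 / e * g x" by (simp add: field_simps)
  qed (use w e(1) in auto)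
  have quot: "(\<lambda>n. \<integral>x. (F (u n) x - F z0 x) / (u n - z0) \<partial>M) \<longlonglongrightarrow> (\<integral>x. D x \<partial>M)"
    and Dm: "D \<in> borel_measurable M"
    if u: "\<And>n. u n \<in> ball z0 (e / 2)" "\<And>n. u n \<noteq> z0" "u \<longlonglongrightarrow> z0" for u
  proof -
    have uS: "u n \<in> S" for n using u(1)[of n] e by auto
    have lim: "(\<lambda>n. (F (u n) x - F z0 x) / (u n - z0)) \<longlonglongrightarrow> D x" if x: "x \<in> space M" for x
    proof -
      have "((\<lambda>y. (F y x - F z0 x) / (y - z0)) \<longlongrightarrow> D x) (at z0)"
        using der[of z0 x] x e(1) by (simp add: has_field_derivative_iff D_def)
      from this[unfolded tendsto_at_iff_sequentially, rule_format, of u] u show ?thesis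
        by (simp add: o_def)
    qed
    have m: "(\<lambda>x. (F (u n) x - F z0 x) / (u n - z0)) \<in> borel_measurable M" for n
      using meas[OF uS[of n]] meas[OF z0] by measurable
    show Dm: "D \<in> borel_measurable M"
      by (rule borel_measurable_LIMSEQ_metric[OF m lim])
    show "(\<lambda>n. \<integral>x. (F (u n) x - F z0 x) / (u n - z0) \<partial>M) \<longlonglongrightarrow> (\<integral>x. D x \<partial>M)"
    proof (rule integral_dominated_convergence[where w = "\<lambda>x. 4 / e * g x"])
      show "integrable M (\<lambda>x. 4 / e * g x)" using e2(2) by simp
      show "AE x in M. norm ((F (u n) x - F z0 x) / (u n - z0)) \<le> 4 / e * g x" for n
      proof (rule AE_I2)
        fix x assume "x \<in> space M"
        from lip[OF u(1)[of n] this] show "norm ((F (u n) x - F z0 x) / (u n - z0)) \<le> 4 / e * g x"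
          using u(2)[of n] by (simp add: norm_divide pos_divide_le_eq)
      qed
      show "AE x in M. (\<lambda>n. (F (u n) x - F z0 x) / (u n - z0)) \<longlonglongrightarrow> D x" by (rule AE_I2) (rule lim)
    qed (use Dm m in auto)
  qed
  have int: "integrable M (F w)" if "w \<in> ball z0 e" for w
    by (rule Bochner_Integration.integrable_bound[OF e2(2)])
      (use that e meas in \<open>auto intro!: AE_I2 order_trans[OF _ abs_ge_self]\<close>)
  have "((\<lambda>z. \<integral>x. F z x \<partial>M) has_field_derivative (\<integral>x. D x \<partial>M)) (at z0)"
    unfolding has_field_derivative_iff tendsto_at_iff_sequentially
  proof (intro allI impI)
    fix u :: "nat \<Rightarrow> complex" assume u: "\<forall>i. u i \<in> UNIV - {z0}" "u \<longlonglongrightarrow> z0"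
    have "eventually (\<lambda>n. u n \<in> ball z0 (e / 2)) sequentially"
      using u(2) e(1) by (intro topological_tendstoD) auto
    then obtain n0 where n0: "\<And>n. n \<ge> n0 \<Longrightarrow> u n \<in> ball z0 (e / 2)" by (auto simp: eventually_sequentially)
    have "(\<lambda>n. \<integral>x. (F (u (n + n0)) x - F z0 x) / (u (n + n0) - z0) \<partial>M) \<longlonglongrightarrow> (\<integral>x. D x \<partial>M)"
      by (rule quot) (use u n0 LIMSEQ_ignore_initial_segment[OF u(2)] in auto)
    moreover have "(\<integral>x. (F (u (n + n0)) x - F z0 x) / (u (n + n0) - z0) \<partial>M) =
        ((\<integral>x. F (u (n + n0)) x \<partial>M) - (\<integral>x. F z0 x \<partial>M)) / (u (n + n0) - z0)" for n
    proof -
      have "integrable M (F (u (n + n0)))" "integrable M (F z0)"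
        using n0[of "n + n0"] e(1) by (auto intro!: int)
      then show ?thesis by simp
    qed
    ultimately have "(\<lambda>n. ((\<integral>x. F (u (n + n0)) x \<partial>M) - (\<integral>x. F z0 x \<partial>M)) / (u (n + n0) - z0)) \<longlonglongrightarrow> (\<integral>x. D x \<partial>M)"
      by (simp only:)
    then show "((\<lambda>y. ((\<integral>x. F y x \<partial>M) - (\<integral>x. F z0 x \<partial>M)) / (y - z0)) \<circ> u) \<longlonglongrightarrow> (\<integral>x. D x \<partial>M)"
      unfolding o_def by (rule LIMSEQ_offset)
  qed
  then show "\<exists>f'. ((\<lambda>z. \<integral>x. F z x \<partial>M) has_field_derivative f') (at z0)" by blast
qed

text \<open>The argument of z lies strictly between -pi and pi, so multiplying it by q leads into
  the right half-plane. The lemma is applied with q = 1 / 2 and q = - r / 2, the latter using that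
  the modulus of r is at most 1.\<close>

lemma slit_powr_Re_pos:
  assumes z: "z \<in> slit" and q: "\<bar>q\<bar> \<le> 1 / 2"
  shows "Re (z powr of_real q) > 0"
proof -
  have nz: "z \<noteq> 0" using z by (auto simp: slit_iff)
  have Im: "\<bar>Im (Ln z)\<bar> < pi"
  proof -
    have "Im (Ln z) \<noteq> pi" using z Im_Ln_eq_pi[OF nz] by (auto simp: slit_iff complex_nonpos_Reals_iff)
    then show ?thesis using mpi_less_Im_Ln[OF nz] Im_Ln_le_pi[OF nz] by auto
  qed
  have "\<bar>q * Im (Ln z)\<bar> < pi / 2"
  proof -
    have "\<bar>q * Im (Ln z)\<bar> \<le> 1 / 2 * \<bar>Im (Ln z)\<bar>" unfolding abs_mult using q by (intro mult_right_mono) auto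
    also have "\<dots> < pi / 2" using Im by simp
    finally show ?thesis .
  qed
  then have "cos (q * Im (Ln z)) > 0" by (intro cos_gt_zero_pi) auto
  then show ?thesis using nz by (simp add: powr_def Re_exp)
qed

text \<open>Scaling x by d powr (1 / r) replaces c by c d at the cost of a constant factor. This
  yields integrable majorants when a complex z varies, d being a lower bound for the real part of z
  powr (- r / 2).\<close>

lemma nn_integral_gen_gamma_rescale:
  assumes r: "r \<noteq> 0" and d: "d > 0" and fin: "(\<integral>\<^sup>+ x. ennreal (x powr a * exp (- c * x powr r)) \<partial>haar) < \<infinity>"
  shows "(\<integral>\<^sup>+ x. ennreal (x powr a * exp (- (c * d) * x powr r)) \<partial>haar) < \<infinity>"
proof -
  define k where "k = d powr (1 / r)"
  have k: "k > 0" "k powr r = d" using d r by (auto simp: k_def powr_powr)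
  have "(\<integral>\<^sup>+ x. ennreal (x powr a * exp (- (c * d) * x powr r)) \<partial>haar)
     = (\<integral>\<^sup>+ x. ennreal (k powr (- a)) * ennreal ((k * x) powr a * exp (- c * (k * x) powr r)) \<partial>haar)"
  proof (rule nn_integral_haar_cong)
    fix x :: real assume x: "x > 0"
    have "k powr (- a) * ((k * x) powr a * exp (- c * (k * x) powr r)) = (k powr (-a) * k powr a) * (x powr a * exp (- c * (d * x powr r)))"
      using k x by (simp add: powr_mult)
    also have "k powr (-a) * k powr a = 1" using k by (simp add: powr_add[symmetric])
    finally show "ennreal (x powr a * exp (- (c * d) * x powr r)) = ennreal (k powr (- a)) * ennreal ((k * x) powr a * exp (- c * (k * x) powr r))"
      by (simp add: ennreal_mult[symmetric] mult_ac)
  qed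
  also have "\<dots> = ennreal (k powr (- a)) * (\<integral>\<^sup>+ x. ennreal ((k * x) powr a * exp (- c * (k * x) powr r)) \<partial>haar)"
    by (rule nn_integral_cmult) measurable
  also have "(\<integral>\<^sup>+ x. ennreal ((k * x) powr a * exp (- c * (k * x) powr r)) \<partial>haar) = (\<integral>\<^sup>+ x. ennreal (x powr a * exp (- c * x powr r)) \<partial>haar)"
    by (rule nn_integral_haar_scale) (use k in auto)
  finally show ?thesis using fin by (simp add: ennreal_mult_less_top)
qed

text \<open>Rescaling \<open>x\<close> by \<open>\<surd>s\<close> splits the rotation by \<open>arg s\<close> evenly between the exponential and the
  density, so that each factor stays in the right half-plane on the whole slit plane.\<close>

lemma laplace_slit_extension:
  assumes P: "prob_space P" and sP[measurable_cong]: "sets P = sets borel" and Ppos: "AE y in P. y > 0"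
    and r: "0 < \<bar>r\<bar>" "\<bar>r\<bar> \<le> 1" and c: "c > 0" and c1: "c1 > 0"
    and fin: "(\<integral>\<^sup>+ x. ennreal (x powr a * exp (- c * x powr r)) \<partial>haar) < \<infinity>"
    and f0: "\<And>s. s > 0 \<Longrightarrow> 0 \<le> f s"
    and f: "\<And>s. s > 0 \<Longrightarrow> ennreal (f s) = (\<integral>\<^sup>+ y. \<integral>\<^sup>+ x. ennreal (exp (- s * (x * y)) * (c1 * x powr a * exp (- c * x powr r))) \<partial>haar \<partial>P)"
  obtains \<phi> where "\<phi> holomorphic_on slit" "\<And>s :: real. s > 0 \<Longrightarrow> \<phi> (of_real s) = of_real (f s)"
proof -
  interpret P: prob_space P by (rule P)
  interpret pair_sigma_finite P haar ..
  \<comment> \<open>The integrand of f after x is replaced by x / sqrt z, with principal powers. It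
    is set to 0 off x, y > 0 so that the bounds hold at every point.\<close>
  define F where "F z w = (case w of (y, x) \<Rightarrow> if 0 < x \<and> 0 < y then
      of_real (c1 * x powr a) * (z powr (of_real (- a / 2)) *
       exp (- (z powr of_real (1 / 2)) * of_real (x * y) - of_real (c * x powr r) * z powr of_real (- r / 2))) else 0)" for z :: complex and w
  have Fmeas: "F z \<in> borel_measurable (P \<Otimes>\<^sub>M haar)" for z
    unfolding F_def by measurable
  have Fbound: "norm (F z (y, x)) \<le> c1 * x powr a * (norm (z powr (of_real (- a / 2))) * exp (- (c * d) * x powr r))"
    if z: "z \<in> slit" and d: "Re (z powr of_real (- r / 2)) \<ge> d" for z x y d
  proof (cases "0 < x \<and> 0 < y")
    case True
    have q1: "Re (z powr of_real (1 / 2)) > 0" by (rule slit_powr_Re_pos[OF z]) auto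
    have "norm (F z (y, x)) = c1 * x powr a * (norm (z powr (of_real (- a / 2))) *
        exp (- Re (z powr of_real (1 / 2)) * (x * y) - c * x powr r * Re (z powr of_real (- r / 2))))"
      using True c1 by (simp add: F_def norm_mult)
    also have "\<dots> \<le> c1 * x powr a * (norm (z powr (of_real (- a / 2))) * exp (- (c * d) * x powr r))"
    proof (intro mult_left_mono)
      have "c * x powr r * d \<le> c * x powr r * Re (z powr of_real (- r / 2))" using d c by (intro mult_left_mono) auto
      moreover have "Re (z powr of_real (1 / 2)) * (x * y) \<ge> 0" using q1 True by simp
      ultimately show "exp (- Re (z powr of_real (1 / 2)) * (x * y) - c * x powr r * Re (z powr of_real (- r / 2))) \<le> exp (- (c * d) * x powr r)"
        by (simp add: mult_ac)
    qed (use c1 in auto)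
    finally show ?thesis .
  qed (use c1 in \<open>auto simp: F_def\<close>)
  have gint: "integrable (P \<Otimes>\<^sub>M haar) (\<lambda>(y, x). c1 * x powr a * (A * exp (- (c * d) * x powr r)))" if d: "d > 0" and A: "A \<ge> 0" for A d
  proof (rule integrableI_nonneg)
    have "(\<integral>\<^sup>+ w. ennreal (case w of (y, x) \<Rightarrow> c1 * x powr a * (A * exp (- (c * d) * x powr r))) \<partial>(P \<Otimes>\<^sub>M haar))
      = (\<integral>\<^sup>+ y. \<integral>\<^sup>+ x. ennreal (c1 * A) * ennreal (x powr a * exp (- (c * d) * x powr r)) \<partial>haar \<partial>P)"
      using c1 A by (subst haar.nn_integral_fst[symmetric]) (auto simp: ennreal_mult[symmetric] mult_ac)
    also have "\<dots> = ennreal (c1 * A) * (\<integral>\<^sup>+ x. ennreal (x powr a * exp (- (c * d) * x powr r)) \<partial>haar)"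
      by (simp add: nn_integral_cmult P.emeasure_space_1)
    also have "\<dots> < \<infinity>"
      using nn_integral_gen_gamma_rescale[OF _ d fin] r by (simp add: ennreal_mult_less_top)
    finally show "(\<integral>\<^sup>+ w. ennreal (case w of (y, x) \<Rightarrow> c1 * x powr a * (A * exp (- (c * d) * x powr r))) \<partial>(P \<Otimes>\<^sub>M haar)) < \<infinity>" .
  qed (use c1 A in \<open>auto intro!: AE_I2\<close>)
  have hol: "(\<lambda>z. \<integral>w. F z w \<partial>(P \<Otimes>\<^sub>M haar)) holomorphic_on slit"
  proof (rule holomorphic_on_integral[OF slit_open _ Fmeas])
    fix w :: "real \<times> real"
    show "(\<lambda>z. F z w) holomorphic_on slit"
    proof (cases "0 < snd w \<and> 0 < fst w")
      case True
      then show ?thesis unfolding F_def split_beta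
        by (simp, intro holomorphic_intros) (auto simp: slit_iff)
    qed (auto simp: F_def split_beta)
  next
    fix z assume z: "z \<in> slit"
    have "continuous_on slit (\<lambda>z. z powr of_real (- a / 2))" "continuous_on slit (\<lambda>z. z powr of_real (- r / 2))"
      by (intro holomorphic_on_imp_continuous_on holomorphic_intros, auto simp: slit_iff)+
    then have cont: "isCont (\<lambda>z. norm (z powr of_real (- a / 2))) z" "isCont (\<lambda>z. Re (z powr of_real (- r / 2))) z"
      using z slit_open by (auto simp: continuous_on_eq_continuous_at intro!: continuous_norm continuous_Re)
    \<comment> \<open>By continuity these bounds persist near z: the modulus grows by less than 1,
      and the real part stays above half of its positive value.\<close>
    let ?A = "norm (z powr of_real (- a / 2)) + 1" and ?d = "Re (z powr of_real (- r / 2)) / 2"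
    have dpos: "?d > 0" using slit_powr_Re_pos[OF z, of "- r / 2"] r by auto
    have "eventually (\<lambda>w. norm (w powr of_real (- a / 2)) < ?A) (at z)" "eventually (\<lambda>w. ?d < Re (w powr of_real (- r / 2))) (at z)"
      by (rule order_tendstoD(2)[OF cont(1)[unfolded isCont_def]], simp)
        (rule order_tendstoD(1)[OF cont(2)[unfolded isCont_def]], use dpos in simp)
    then have "eventually (\<lambda>w. norm (w powr of_real (- a / 2)) < ?A \<and> ?d < Re (w powr of_real (- r / 2))) (nhds z)"
      using dpos by (auto simp: eventually_nhds_conv_at intro: eventually_conj)
    moreover have "eventually (\<lambda>w. w \<in> slit) (nhds z)" using z slit_open by (intro eventually_nhds_in_open)
    ultimately have "eventually (\<lambda>w. w \<in> slit \<and> norm (w powr of_real (- a / 2)) < ?A \<and> ?d < Re (w powr of_real (- r / 2))) (nhds z)"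
      by eventually_elim auto
    then obtain e where e: "e > 0" "\<And>w. dist w z < e \<Longrightarrow> w \<in> slit \<and> norm (w powr of_real (- a / 2)) < ?A \<and> ?d < Re (w powr of_real (- r / 2))"
      by (auto simp: eventually_nhds_metric)
    show "\<exists>e>0. \<exists>g. integrable (P \<Otimes>\<^sub>M haar) g \<and> (\<forall>w\<in>ball z e. \<forall>x\<in>space (P \<Otimes>\<^sub>M haar). norm (F w x) \<le> g x)"
    proof (intro exI conjI ballI)
      show "e > 0" by fact
      show "integrable (P \<Otimes>\<^sub>M haar) (\<lambda>(y, x). c1 * x powr a * (?A * exp (- (c * ?d) * x powr r)))"
        by (rule gint[OF dpos]) auto
      fix w and yx :: "real \<times> real" assume w: "w \<in> ball z e"
      obtain y x where yx: "yx = (y, x)" by (cases yx)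
      have w': "w \<in> slit" "norm (w powr of_real (- a / 2)) \<le> ?A" "?d \<le> Re (w powr of_real (- r / 2))"
        using e(2)[of w] w by (auto simp: dist_commute)
      have "norm (F w (y, x)) \<le> c1 * x powr a * (norm (w powr (of_real (- a / 2))) * exp (- (c * ?d) * x powr r))"
        by (rule Fbound[OF w'(1,3)])
      also have "\<dots> \<le> c1 * x powr a * (?A * exp (- (c * ?d) * x powr r))"
        using w'(2) c1 by (intro mult_left_mono mult_right_mono) auto
      finally show "norm (F w yx) \<le> (case yx of (y, x) \<Rightarrow> c1 * x powr a * (?A * exp (- (c * ?d) * x powr r)))"
        by (simp add: yx)
    qed
  qed
  have val: "(\<integral>w. F (of_real s) w \<partial>(P \<Otimes>\<^sub>M haar)) = of_real (f s)" if s: "s > 0" for s :: real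
  proof -
    define q where "q = s powr (1 / 2)"
    have q: "q > 0" "q * q = s" using s by (auto simp: q_def powr_add[symmetric])
    define G where "G w = (case w of (y, x) \<Rightarrow> if 0 < x \<and> 0 < y then
      c1 * x powr a * (q powr (- a) * exp (- q * (x * y) - c * x powr r * q powr (- r))) else 0)" for w
    have Gmeas: "G \<in> borel_measurable (P \<Otimes>\<^sub>M haar)" unfolding G_def by measurable
    have FG: "F (of_real s) w = of_real (G w)" for w
    proof -
      obtain y x where w: "w = (y, x)" by (cases w)
      have 1: "(of_real s :: complex) powr of_real (- a / 2) = of_real (q powr (- a))"
        using powr_of_real[of s "- a / 2"] s by (simp only: q_def powr_powr less_imp_le) (simp add: mult.commute)
      have 2: "(of_real s :: complex) powr of_real (1 / 2) = of_real q"
        using powr_of_real[of s "1 / 2"] s by (simp add: q_def)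
      have 3: "(of_real s :: complex) powr of_real (- r / 2) = of_real (q powr (- r))"
        using powr_of_real[of s "- r / 2"] s by (simp only: q_def powr_powr less_imp_le) (simp add: mult.commute)
      show ?thesis
        unfolding w F_def G_def prod.case 1 2 3
        by (simp add: exp_of_real[symmetric])
    qed
    have G0: "G w \<ge> 0" for w using c1 by (auto simp: G_def split_beta)
    have "(\<integral>\<^sup>+ w. ennreal (G w) \<partial>(P \<Otimes>\<^sub>M haar)) = (\<integral>\<^sup>+ y. \<integral>\<^sup>+ x. ennreal (G (y, x)) \<partial>haar \<partial>P)"
      using Gmeas by (subst haar.nn_integral_fst[symmetric]) auto
    also have "\<dots> = (\<integral>\<^sup>+ y. \<integral>\<^sup>+ x. ennreal (exp (- s * (x * y)) * (c1 * x powr a * exp (- c * x powr r))) \<partial>haar \<partial>P)"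
    proof (rule nn_integral_cong_AE, rule eventually_mono[OF Ppos])
      fix y :: real assume y: "y > 0"
      have "(\<integral>\<^sup>+ x. ennreal (G (y, x)) \<partial>haar) = (\<integral>\<^sup>+ x. ennreal (G (y, q * x)) \<partial>haar)"
        unfolding G_def prod.case by (rule nn_integral_haar_scale[OF _ q(1), symmetric]) measurable
      also have "\<dots> = (\<integral>\<^sup>+ x. ennreal (exp (- s * (x * y)) * (c1 * x powr a * exp (- c * x powr r))) \<partial>haar)"
      proof (rule nn_integral_haar_cong)
        fix x :: real assume x: "x > 0"
        have e1: "(q * x) powr a * q powr (- a) = x powr a" and e2: "(q * x) powr r * q powr (- r) = x powr r"
          using q x by (auto simp: powr_mult powr_minus field_simps)
        have "G (y, q * x) = c1 * ((q * x) powr a * q powr (- a)) * exp (- (q * q) * (x * y) - c * ((q * x) powr r * q powr (- r)))"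
          using q x y by (simp add: G_def mult_ac)
        then have "G (y, q * x) = exp (- s * (x * y)) * (c1 * x powr a * exp (- c * x powr r))"
          unfolding e1 e2 q(2) by (simp add: exp_diff exp_minus field_simps)
        then show "ennreal (G (y, q * x)) = ennreal (exp (- s * (x * y)) * (c1 * x powr a * exp (- c * x powr r)))" by simp
      qed
      finally show "(\<integral>\<^sup>+ x. ennreal (G (y, x)) \<partial>haar) = \<dots>" .
    qed
    also have "\<dots> = ennreal (f s)" by (rule f[OF s, symmetric])
    finally have "(\<integral>w. G w \<partial>(P \<Otimes>\<^sub>M haar)) = f s"
      using Gmeas G0 f0[OF s] by (subst integral_eq_nn_integral) auto
    then show ?thesis unfolding FG by simp
  qed
  show ?thesis by (rule that[OF hol val])
qed

section \<open>Generalized gamma convolutions and infinite divisibility\<close>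

text \<open>Both transforms extend to the half-plane Re z > 0 and agree there by the identity
  theorem. Letting z approach the imaginary axis gives equal characteristic functions, and Levy's
  uniqueness theorem applies.\<close>

lemma laplace_transform_unique:
  assumes K1: "real_distribution K1" "AE l in K1. 0 \<le> l" and K2: "real_distribution K2" "AE l in K2. 0 \<le> l"
    and eq: "\<And>s. s > 0 \<Longrightarrow> (\<integral>l. exp (- s * l) \<partial>K1) = (\<integral>l. exp (- s * l) \<partial>K2)"
  shows "K1 = K2"
proof -
  \<comment> \<open>Replacing l by max 0 l changes nothing almost everywhere and keeps the integrand
    bounded by 1 at every l, as \<open>holomorphic_on_integral\<close> requires.\<close>
  define L where "L K z = (\<integral>l. exp (- z * of_real (max 0 l)) \<partial>K)" for K :: "real measure" and z :: complex
  have L: "L K holomorphic_on {z. Re z > 0}"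
    "\<And>s. s > 0 \<Longrightarrow> L K (of_real s) = of_real (\<integral>l. exp (- s * l) \<partial>K)"
    "\<And>t. (\<lambda>n. L K (Complex (1 / real (Suc n)) (- t))) \<longlonglongrightarrow> char K t"
    if K: "real_distribution K" "AE l in K. 0 \<le> l" for K
  proof -
    interpret real_distribution K by (rule K)
    show "L K holomorphic_on {z. Re z > 0}"
      unfolding L_def
    proof (rule holomorphic_on_integral)
      show "open {z. 0 < Re z}" by (simp add: open_halfspace_Re_gt)
      fix z assume z: "z \<in> {z. 0 < Re z}"
      show "\<exists>e>0. \<exists>g. integrable K g \<and> (\<forall>w\<in>ball z e. \<forall>x\<in>space K. norm (exp (- w * of_real (max 0 x))) \<le> g x)"
      proof (intro exI conjI ballI)
        show "Re z > 0" using z by simp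
        show "integrable K (\<lambda>_. 1 :: real)" by simp
        fix w x assume "w \<in> ball z (Re z)"
        then have "Re w > 0" using complex_Re_le_cmod[of "z - w"] by (simp add: dist_norm)
        then show "norm (exp (- w * of_real (max 0 x))) \<le> 1" by simp
      qed
    qed (auto intro!: holomorphic_intros)
    show "L K (of_real s) = of_real (\<integral>l. exp (- s * l) \<partial>K)" if "s > 0" for s
    proof -
      have "L K (of_real s) = (\<integral>l. of_real (exp (- s * max 0 l)) \<partial>K)"
        unfolding L_def by (intro Bochner_Integration.integral_cong refl) (simp add: exp_of_real[symmetric])
      also have "\<dots> = of_real (\<integral>l. exp (- s * max 0 l) \<partial>K)" by simp
      also have "(\<integral>l. exp (- s * max 0 l) \<partial>K) = (\<integral>l. exp (- s * l) \<partial>K)"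
        by (rule integral_cong_AE) (auto intro!: eventually_mono[OF K(2)])
      finally show ?thesis .
    qed
    show "(\<lambda>n. L K (Complex (1 / real (Suc n)) (- t))) \<longlonglongrightarrow> char K t" for t
      unfolding L_def char_def
    proof (rule integral_dominated_convergence[where w = "\<lambda>_. 1"])
      show "AE l in K. (\<lambda>n. exp (- Complex (1 / real (Suc n)) (- t) * of_real (max 0 l))) \<longlonglongrightarrow> iexp (t * l)"
      proof (rule eventually_mono[OF K(2)])
        fix l :: real assume l: "0 \<le> l"
        have "(\<lambda>n. 1 / real (Suc n)) \<longlonglongrightarrow> 0" using LIMSEQ_inverse_real_of_nat by (simp add: inverse_eq_divide)
        then have "(\<lambda>n. exp (- Complex (1 / real (Suc n)) (- t) * of_real (max 0 l))) \<longlonglongrightarrow> exp (- Complex 0 (- t) * of_real (max 0 l))"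
          by (intro tendsto_intros)
        also have "- Complex 0 (- t) * of_real (max 0 l) = \<i> * of_real (t * l)"
          using l by (simp add: complex_eq_iff)
        finally show "(\<lambda>n. exp (- Complex (1 / real (Suc n)) (- t) * of_real (max 0 l))) \<longlonglongrightarrow> iexp (t * l)" .
      qed
    qed auto
  qed
  have LL: "L K1 z = L K2 z" if z: "Re z > 0" for z
  proof -
    have "L K1 z - L K2 z = 0"
    proof (rule analytic_continuation[where f = "\<lambda>z. L K1 z - L K2 z" and S = "{z. Re z > 0}" and U = "of_real ` {0<..}" and \<xi> = 1])
      show "(\<lambda>z. L K1 z - L K2 z) holomorphic_on {z. Re z > 0}" by (intro holomorphic_intros L K1 K2)
      show "open {z. 0 < Re z}" by (simp add: open_halfspace_Re_gt)
      show "connected {z. 0 < Re z}" by (intro convex_connected convex_halfspace_Re_gt)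
      show "1 islimpt complex_of_real ` {0<..}"
        unfolding islimpt_approachable
      proof (intro allI impI)
        fix e :: real assume e: "e > 0"
        then show "\<exists>x'\<in>complex_of_real ` {0<..}. x' \<noteq> 1 \<and> dist x' 1 < e"
          by (intro bexI[of _ "of_real (1 + e / 2)"] imageI) (auto simp: dist_norm norm_divide)
      qed
      show "L K1 z - L K2 z = 0" if "z \<in> complex_of_real ` {0<..}" for z
        using that L(2)[OF K1] L(2)[OF K2] eq by auto
    qed (use z in auto)
    then show ?thesis by simp
  qed
  have "char K1 t = char K2 t" for t
  proof (rule LIMSEQ_unique[OF L(3)[OF K1]])
    have "L K1 (Complex (1 / real (Suc n)) (- t)) = L K2 (Complex (1 / real (Suc n)) (- t))" for n
      by (rule LL) simp
    then show "(\<lambda>n. L K1 (Complex (1 / real (Suc n)) (- t))) \<longlonglongrightarrow> char K2 t"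
      using L(3)[OF K2] by simp
  qed
  then show ?thesis by (intro Levy_uniqueness K1 K2) auto
qed

text \<open>From y \<le> exp y - 1 with y = s l / 2 one gets s l exp (- s l) \<le> 2 (exp (- s l /
  2) - exp (- s l)), and integration over l bounds - s f' s. The bound tends to 0 with s because f
  is continuous at 0. The proof runs through difference quotients, so no derivative is taken under
  the integral.\<close>

lemma laplace_derivative_bound:
  assumes f: "laplace_fn f" and f0: "f 0 > 0" and s: "s > 0" and D: "(f has_real_derivative D) (at s)"
  shows "D \<le> 0" "- (s * D) \<le> 2 * (f (s / 2) - f s)"
proof -
  obtain K where K: "real_distribution K" "AE l in K. 0 \<le> l" "\<And>s. s \<ge> 0 \<Longrightarrow> f s = f 0 * (\<integral>l. exp (- s * l) \<partial>K)"
    using laplace_fn_distribution[OF f f0] by metis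
  interpret real_distribution K by (rule K)
  have int: "integrable K (\<lambda>l. exp (- s * l))" if "s \<ge> 0" for s
    by (rule integrable_const_bound[where B = 1]) (use that K(2) in \<open>auto elim!: eventually_mono\<close>)
  have step: "f s - f t \<le> (t - s) * (2 / s * (f (s / 2) - f s))" if t: "t > s" for t
  proof -
    have "(\<integral>l. exp (- s * l) - exp (- t * l) \<partial>K) \<le> (\<integral>l. (t - s) * (2 / s) * (exp (- (s / 2) * l) - exp (- s * l)) \<partial>K)"
    proof (rule integral_mono_AE)
      show "AE l in K. exp (- s * l) - exp (- t * l) \<le> (t - s) * (2 / s) * (exp (- (s / 2) * l) - exp (- s * l))"
      proof (rule eventually_mono[OF K(2)])
        fix l :: real assume l: "0 \<le> l"
        have "1 - exp (- (t - s) * l) \<le> (t - s) * l" using exp_ge_add_one_self[of "- (t - s) * l"] by (simp only: mult_minus_left)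
        then have m1: "exp (- s * l) * (1 - exp (- (t - s) * l)) \<le> exp (- s * l) * ((t - s) * l)" by (rule mult_left_mono) simp
        have e1: "exp (- s * l) * (1 - exp (- (t - s) * l)) = exp (- s * l) - exp (- t * l)"
          by (simp add: right_diff_distrib exp_add[symmetric] algebra_simps)
        have "s / 2 * l \<le> exp (s / 2 * l) - 1" using exp_ge_add_one_self[of "s / 2 * l"] by linarith
        then have m2: "exp (- s * l) * (s / 2 * l) \<le> exp (- s * l) * (exp (s / 2 * l) - 1)" by (rule mult_left_mono) simp
        have e2: "exp (- s * l) * (exp (s / 2 * l) - 1) = exp (- (s / 2) * l) - exp (- s * l)"
          by (simp add: right_diff_distrib exp_add[symmetric] algebra_simps)
        note 1 = m1[unfolded e1] and 2 = m2[unfolded e2]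
        have "exp (- s * l) * ((t - s) * l) = (t - s) * (2 / s) * (exp (- s * l) * (s / 2 * l))" using s by simp
        also have "\<dots> \<le> (t - s) * (2 / s) * (exp (- (s / 2) * l) - exp (- s * l))"
          using 2 t s by (intro mult_left_mono) auto
        finally show "exp (- s * l) - exp (- t * l) \<le> (t - s) * (2 / s) * (exp (- (s / 2) * l) - exp (- s * l))"
          using 1 by linarith
      qed
    qed (use int[of s] int[of t] int[of "s / 2"] s t in auto)
    also have "(\<integral>l. exp (- s * l) - exp (- t * l) \<partial>K) = (\<integral>l. exp (- s * l) \<partial>K) - (\<integral>l. exp (- t * l) \<partial>K)"
      by (rule Bochner_Integration.integral_diff) (use int s t in auto)
    also have "(\<integral>l. (t - s) * (2 / s) * (exp (- (s / 2) * l) - exp (- s * l)) \<partial>K) =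
       (t - s) * (2 / s) * ((\<integral>l. exp (- (s / 2) * l) \<partial>K) - (\<integral>l. exp (- s * l) \<partial>K))"
      using Bochner_Integration.integral_diff[OF int[of "s / 2"] int[of s]] s by (simp only: integral_mult_right_zero)
    finally have "f 0 * ((\<integral>l. exp (- s * l) \<partial>K) - (\<integral>l. exp (- t * l) \<partial>K)) \<le>
       f 0 * ((t - s) * (2 / s) * ((\<integral>l. exp (- (s / 2) * l) \<partial>K) - (\<integral>l. exp (- s * l) \<partial>K)))"
      using f0 by (intro mult_left_mono) auto
    also have "f 0 * ((\<integral>l. exp (- s * l) \<partial>K) - (\<integral>l. exp (- t * l) \<partial>K)) = f s - f t"
      using K(3)[of s] K(3)[of t] s t by (simp add: right_diff_distrib)
    also have "f 0 * ((t - s) * (2 / s) * ((\<integral>l. exp (- (s / 2) * l) \<partial>K) - (\<integral>l. exp (- s * l) \<partial>K))) =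
      (t - s) * (2 / s * (f 0 * (\<integral>l. exp (- (s / 2) * l) \<partial>K) - f 0 * (\<integral>l. exp (- s * l) \<partial>K)))"
      by (simp only: right_diff_distrib mult_ac)
    also have "\<dots> = (t - s) * (2 / s * (f (s / 2) - f s))"
      using K(3)[of s] K(3)[of "s / 2"] s by (simp only: less_imp_le half_gt_zero)
    finally show ?thesis .
  qed
  show "D \<le> 0"
  proof (rule ccontr)
    assume "\<not> D \<le> 0"
    then obtain d where "d > 0" "\<forall>h>0. h < d \<longrightarrow> f s < f (s + h)" using has_real_derivative_pos_inc_right[of f D s UNIV] D by auto
    then have "f s < f (s + d / 2)" by simp
    moreover have "f (s + d / 2) \<le> f s" using laplace_fn_antimono[OF f] s \<open>d > 0\<close> by simp
    ultimately show False by simp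
  qed
  define B where "B = 2 / s * (f (s / 2) - f s)"
  have dB: "((\<lambda>t. f t + B * (t - s)) has_real_derivative D + B) (at s)"
    by (auto intro!: derivative_eq_intros D)
  have "D + B \<ge> 0"
  proof (rule ccontr)
    assume "\<not> D + B \<ge> 0"
    then obtain d where d: "d > 0" "\<forall>h>0. h < d \<longrightarrow> f (s + h) + B * (s + h - s) < f s + B * (s - s)"
      using has_real_derivative_neg_dec_right[of "\<lambda>t. f t + B * (t - s)" "D + B" s UNIV] dB by auto
    have "f (s + d / 2) + B * (d / 2) < f s" using d(2)[rule_format, of "d / 2"] d(1) by simp
    moreover have "f s - f (s + d / 2) \<le> d / 2 * B" using step[of "s + d / 2"] d(1) by (simp add: B_def)
    ultimately show False by (simp add: mult.commute)
  qed
  then have "- D \<le> B" by simp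
  then have "s * - D \<le> s * B" using s by (intro mult_left_mono) auto
  then show "- (s * D) \<le> 2 * (f (s / 2) - f s)" using s by (simp add: B_def)
qed

lemma hcm_laplace_pick_measure:
  assumes f: "laplace_fn f" and f0: "f 0 = 1" and fpos: "\<And>s. s > 0 \<Longrightarrow> f s > 0" and hcm: "hcm f"
    and \<phi>: "\<phi> holomorphic_on slit" and real: "\<And>x :: real. x > 0 \<Longrightarrow> \<phi> (of_real x) = of_real (f x)"
  obtains m \<tau> where "m \<ge> 0" "real_distribution \<tau>" "AE c in \<tau>. m = 0 \<or> (-1 < c \<and> c \<le> 1)"
    "\<And>s. s > 0 \<Longrightarrow> ennreal (- ln (f s)) = (\<integral>\<^sup>+ c. (if -1 < c \<and> c \<le> 1 then ennreal (m * thorin_kernel c s) else 0) \<partial>\<tau>)"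
    "\<And>s. s > 0 \<Longrightarrow> ln (f s) \<le> 0"
proof -
  define H where "H z = - z * deriv \<phi> z / \<phi> z" for z
  have H: "H holomorphic_on slit" "\<And>z. Im z > 0 \<Longrightarrow> Im (H z) \<ge> 0" "\<And>z. z \<in> slit \<Longrightarrow> H (cnj z) = cnj (H z)"
    unfolding H_def[abs_def] by (rule hcm_pick[OF \<phi> hcm fpos real]; assumption)+
  have real_slit: "of_real x \<in> slit" if "x > 0" for x :: real using that by (simp add: slit_iff)
  have Hreal: "H (of_real x) = of_real (Re (H (of_real x)))" if "x > 0" for x :: real
  proof -
    have "H (cnj (of_real x)) = cnj (H (of_real x))" using H(3)[OF real_slit[OF that]] .
    then have "Im (H (of_real x)) = 0" by (simp add: complex_eq_iff)
    then show ?thesis by (simp add: complex_eq_iff)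
  qed
  have Hdn: "Im (H z) \<le> 0" if "Im z < 0" for z
  proof -
    have "cnj z \<in> slit" using that by (auto simp: slit_iff complex_nonpos_Reals_iff)
    then have "H z = cnj (H (cnj z))" using H(3)[of "cnj z"] by simp
    then show ?thesis using H(2)[of "cnj z"] that by simp
  qed
  obtain m \<tau> where m: "m \<ge> (0::real)" and \<tau>: "real_distribution \<tau>" and supp: "AE c in \<tau>. c \<in> {-1..1}"
    and rep: "\<And>s. s > 0 \<Longrightarrow> Re (H (of_real s)) - Re (H 1) = m * (\<integral>c. (s - 1) / (2 * ((1 - c) * s + (1 + c))) \<partial>\<tau>)"
    using pick_representation[OF H(1) Hreal H(2) Hdn] by auto
  define Hr where "Hr s = Re (H (of_real s))" for s
  define D where "D s = Re (deriv \<phi> (of_real s))" for s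
  have fD: "(f has_real_derivative D s) (at s)" if s: "s > 0" for s
  proof -
    have "(\<phi> has_field_derivative deriv \<phi> (of_real s)) (at (of_real s))"
      by (rule holomorphic_derivI[OF \<phi> slit_open real_slit[OF s]])
    then have "((\<lambda>y. \<phi> (of_real y)) has_vector_derivative deriv \<phi> (of_real s)) (at s)"
      by (rule has_vector_derivative_real_field)
    then have "((\<lambda>y. Re (\<phi> (of_real y))) has_vector_derivative D s) (at s)"
      unfolding D_def by (rule bounded_linear.has_vector_derivative[OF bounded_linear_Re])
    then show ?thesis
      unfolding has_real_derivative_iff_has_vector_derivative
      by (rule has_vector_derivative_transform_within_open[of _ _ _ "{0<..}"]) (use s real in auto)
  qed
  have HrD: "Hr s = - (s * D s) / f s" if s: "s > 0" for s
  proof -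
    have "H (of_real s) = of_real (- s / f s) * deriv \<phi> (of_real s)" by (simp add: H_def real[OF s])
    then show ?thesis by (simp only: Hr_def D_def Re_of_real_mult) simp
  qed
  have f00: "f 0 > 0" using f0 by simp
  have cont0: "(\<lambda>n. f (u n)) \<longlonglongrightarrow> 1" if "u \<longlonglongrightarrow> 0" "\<And>n. u n \<ge> 0" for u
    using continuous_on_tendsto_compose[OF laplace_fn_continuous[OF f] that(1)] that(2) f0 by auto
  have Hr_bounds: "0 \<le> Hr s" "Hr s \<le> 2 * (f (s / 2) - f s) / f s" if s: "s > 0" for s
  proof -
    note b = laplace_derivative_bound[OF f f00 s fD[OF s]]
    have "s * D s \<le> 0" using b(1) s by (simp add: mult_nonneg_nonpos)
    then have "0 \<le> - (s * D s)" by simp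
    then show "0 \<le> Hr s" unfolding HrD[OF s] using fpos[OF s] by (rule divide_nonneg_pos)
    show "Hr s \<le> 2 * (f (s / 2) - f s) / f s"
      unfolding HrD[OF s] using b(2) fpos[OF s] by (intro divide_right_mono) auto
  qed
  \<comment> \<open>The condition at the origin required by \<open>pick_origin\<close>: Hr s is
    squeezed between 0 and 2 (f (s / 2) - f s) / f s, whose limit is 0 since f tends to 1.\<close>
  have H0: "(\<lambda>n. Hr (1 / real (n + 2))) \<longlonglongrightarrow> 0"
  proof (rule tendsto_sandwich)
    let ?u = "\<lambda>n. 1 / real (n + 2)"
    have u: "?u n > 0" for n by simp
    have lim: "?u \<longlonglongrightarrow> 0" "(\<lambda>n. ?u n / 2) \<longlonglongrightarrow> 0" by real_asymp+
    show "eventually (\<lambda>n. 0 \<le> Hr (?u n)) sequentially"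
      by (intro always_eventually allI Hr_bounds u)
    show "eventually (\<lambda>n. Hr (?u n) \<le> 2 * (f (?u n / 2) - f (?u n)) / f (?u n)) sequentially"
      by (intro always_eventually allI Hr_bounds u)
    have "(\<lambda>n. 2 * (f (?u n / 2) - f (?u n)) / f (?u n)) \<longlonglongrightarrow> 2 * (1 - 1) / 1"
      by (intro tendsto_intros cont0 lim) auto
    then show "(\<lambda>n. 2 * (f (?u n / 2) - f (?u n)) / f (?u n)) \<longlonglongrightarrow> 0" by simp
  qed simp
  have lnD: "((\<lambda>s. ln (f s)) has_real_derivative - (Hr s / s)) (at s)" if s: "s > 0" for s
  proof -
    have "((\<lambda>s. ln (f s)) has_real_derivative inverse (f s) * D s) (at s)"
      by (rule DERIV_chain2[OF DERIV_ln[OF fpos[OF s]] fD[OF s]])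
    also have "inverse (f s) * D s = - (Hr s / s)" using s by (simp add: HrD[OF s] field_simps)
    finally show ?thesis .
  qed
  have ln0: "((\<lambda>s. ln (f s)) \<longlongrightarrow> 0) (at_right 0)"
  proof -
    have "(f \<longlongrightarrow> f 0) (at 0 within {0..})"
      using laplace_fn_continuous[OF f] by (auto simp: continuous_on_def)
    then have "(f \<longlongrightarrow> 1) (at_right 0)" using f0 by (auto intro: tendsto_within_subset)
    then have "((\<lambda>s. ln (f s)) \<longlongrightarrow> ln 1) (at_right 0)" by (intro tendsto_ln) auto
    then show ?thesis by simp
  qed
  have rep': "Hr s - Hr 1 = m * (\<integral>c. (s - 1) / (2 * ((1 - c) * s + (1 + c))) \<partial>\<tau>)" if "s > 0" for s
    using rep[OF that] by (simp add: Hr_def)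
  show ?thesis
  proof (rule that[OF m \<tau>])
    have "AE c in \<tau>. m = 0 \<or> -1 < c" using pick_origin(1)[OF m \<tau> supp rep' H0] by auto
    with supp show "AE c in \<tau>. m = 0 \<or> (-1 < c \<and> c \<le> 1)" by eventually_elim auto
    fix s :: real assume s: "s > 0"
    show "ennreal (- ln (f s)) = (\<integral>\<^sup>+ c. (if -1 < c \<and> c \<le> 1 then ennreal (m * thorin_kernel c s) else 0) \<partial>\<tau>)"
      by (rule thorin_representation(1)[OF m \<tau> supp rep' H0 lnD ln0 s])
    show "ln (f s) \<le> 0"
      by (rule thorin_representation(2)[OF m \<tau> supp rep' H0 lnD ln0 s])
  qed
qed

lemma hcm_laplace_thorin_measure:
  assumes f: "laplace_fn f" and f0: "f 0 = 1" and fpos: "\<And>s. s > 0 \<Longrightarrow> f s > 0" and hcm: "hcm f"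
    and \<phi>: "\<phi> holomorphic_on slit" and real: "\<And>x :: real. x > 0 \<Longrightarrow> \<phi> (of_real x) = of_real (f x)"
  obtains a and \<mu> :: "real measure" where "a \<ge> 0" "sets \<mu> = sets (restrict_space borel {0<..})"
    "\<And>s. s \<ge> 0 \<Longrightarrow> integrable \<mu> (\<lambda>u. ln (1 + s / u))"
    "\<And>s. s \<ge> 0 \<Longrightarrow> f s = exp (- a * s - (\<integral>u. ln (1 + s / u) \<partial>\<mu>))"
proof -
  obtain m \<tau> where m: "m \<ge> 0" and \<tau>: "real_distribution \<tau>" and AEc: "AE c in \<tau>. m = 0 \<or> (-1 < c \<and> c \<le> 1)"
    and rep: "\<And>s. s > 0 \<Longrightarrow> ennreal (- ln (f s)) = (\<integral>\<^sup>+ c. (if -1 < c \<and> c \<le> 1 then ennreal (m * thorin_kernel c s) else 0) \<partial>\<tau>)"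
    and lnle: "\<And>s. s > 0 \<Longrightarrow> ln (f s) \<le> 0"
    using hcm_laplace_pick_measure[OF assms] by blast
  interpret T: real_distribution \<tau> by (rule \<tau>)
  \<comment> \<open>Change of variables from c to u: on A the logarithm in
    \<open>thorin_kernel\<close> is ln (1 + s / u c), and w is m times its prefactor. The remaining
    point c = 1 contributes m s / 4 times its mass, which is the drift.\<close>
  define A where "A = {-1<..<1::real}"
  define w where "w c = m / ((1 + c) * (1 - c))" for c
  define u where "u c = (1 + c) / (1 - c)" for c :: real
  define \<mu> where "\<mu> = distr (density (restrict_space \<tau> A) (\<lambda>c. ennreal (w c))) (restrict_space borel {0<..}) u"
  define a where "a = m * measure \<tau> {1} / 4"
  have a: "a \<ge> 0" using m by (simp add: a_def)
  have s\<mu>: "sets \<mu> = sets (restrict_space borel {0<..})" by (simp add: \<mu>_def)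
  have [measurable]: "u \<in> borel_measurable borel" "w \<in> borel_measurable borel"
    unfolding u_def[abs_def] w_def[abs_def] by measurable
  have upos: "u c > 0" if "c \<in> A" for c using that by (auto simp: A_def u_def)
  have mu: "u \<in> measurable (density (restrict_space \<tau> A) (\<lambda>c. ennreal (w c))) (restrict_space borel {0<..})"
    by (rule measurable_restrict_space2)
      (use upos in \<open>auto simp: space_restrict_space intro!: measurable_restrict_space1\<close>)
  have nn: "(\<integral>\<^sup>+ x. g x \<partial>\<mu>) = (\<integral>\<^sup>+ c. indicator A c * (ennreal (w c) * g (u c)) \<partial>\<tau>)" if g[measurable]: "g \<in> borel_measurable borel" for g
  proof -
    have "(\<integral>\<^sup>+ x. g x \<partial>\<mu>) = (\<integral>\<^sup>+ c. g (u c) \<partial>density (restrict_space \<tau> A) (\<lambda>c. ennreal (w c)))"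
      unfolding \<mu>_def by (rule nn_integral_distr[OF mu]) (simp add: measurable_restrict_space1[OF g])
    also have "\<dots> = (\<integral>\<^sup>+ c. ennreal (w c) * g (u c) \<partial>restrict_space \<tau> A)"
      by (rule nn_integral_density) (auto intro!: measurable_restrict_space1)
    also have "\<dots> = (\<integral>\<^sup>+ c. ennreal (w c) * g (u c) * indicator A c \<partial>\<tau>)"
      by (rule nn_integral_restrict_space) (simp add: A_def)
    finally show ?thesis by (simp add: mult.commute)
  qed
  have main: "(\<integral>\<^sup>+ x. ennreal (ln (1 + s / x)) \<partial>\<mu>) + ennreal (a * s) = ennreal (- ln (f s))" if s: "s > 0" for s
  proof -
    have "ennreal (- ln (f s)) = (\<integral>\<^sup>+ c. indicator A c * (ennreal (w c) * ennreal (ln (1 + s / u c))) + ennreal (m * s / 4) * indicator {1} c \<partial>\<tau>)"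
      unfolding rep[OF s]
    proof (rule nn_integral_cong)
      fix c
      show "(if -1 < c \<and> c \<le> 1 then ennreal (m * thorin_kernel c s) else 0) =
        indicator A c * (ennreal (w c) * ennreal (ln (1 + s / u c))) + ennreal (m * s / 4) * indicator {1} c"
      proof (cases "c \<in> A")
        case True
        then have c: "-1 < c" "c < 1" by (auto simp: A_def)
        have "0 \<le> w c" using c m by (simp add: w_def)
        moreover have "s / u c \<ge> 0" using upos[OF True] s by simp
        moreover have "m * thorin_kernel c s = w c * ln (1 + s / u c)"
          using c by (simp add: thorin_kernel_def w_def u_def)
        ultimately show ?thesis using c True by (simp add: ennreal_mult[symmetric])
      next
        case False
        then show ?thesis by (auto simp: A_def thorin_kernel_def indicator_def)
      qed
    qed
    also have "\<dots> = (\<integral>\<^sup>+ c. indicator A c * (ennreal (w c) * ennreal (ln (1 + s / u c))) \<partial>\<tau>) + ennreal (m * s / 4) * emeasure \<tau> {1}"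
      by (subst nn_integral_add) (auto simp: A_def nn_integral_cmult)
    also have "ennreal (m * s / 4) * emeasure \<tau> {1} = ennreal (a * s)"
      using m s by (simp add: T.emeasure_eq_measure ennreal_mult[symmetric] a_def mult_ac)
    also have "(\<integral>\<^sup>+ c. indicator A c * (ennreal (w c) * ennreal (ln (1 + s / u c))) \<partial>\<tau>) = (\<integral>\<^sup>+ x. ennreal (ln (1 + s / x)) \<partial>\<mu>)"
      by (rule nn[symmetric]) measurable
    finally show ?thesis ..
  qed
  have sp: "space \<mu> = {0<..}" using sets_eq_imp_space_eq[OF s\<mu>] by (simp add: space_restrict_space)
  have ms: "(\<lambda>x. ln (1 + s / x)) \<in> borel_measurable \<mu>" for s
    unfolding measurable_cong_sets[OF s\<mu> refl] by (intro measurable_restrict_space1) measurable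
  have nonneg: "AE x in \<mu>. 0 \<le> ln (1 + s / x)" if "s \<ge> 0" for s
    by (rule AE_I2) (use that sp in auto)
  have int: "integrable \<mu> (\<lambda>x. ln (1 + s / x))" if s: "s > 0" for s
  proof (rule integrableI_nonneg[OF ms nonneg])
    show "(\<integral>\<^sup>+ x. ennreal (ln (1 + s / x)) \<partial>\<mu>) < \<infinity>"
      using main[OF s] by (metis ennreal_add_eq_top ennreal_neq_top infinity_ennreal_def less_top)
  qed (use s in simp)
  show ?thesis
  proof (rule that[OF a s\<mu>])
    fix s :: real assume s0: "s \<ge> 0"
    show "integrable \<mu> (\<lambda>x. ln (1 + s / x))"
      using int[of s] s0 by (cases "s = 0") auto
    show "f s = exp (- a * s - (\<integral>u. ln (1 + s / u) \<partial>\<mu>))"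
    proof (cases "s = 0")
      case False
      with s0 have s: "s > 0" by simp
      define I where "I = (\<integral>u. ln (1 + s / u) \<partial>\<mu>)"
      have I0: "I \<ge> 0" unfolding I_def by (rule integral_nonneg_AE[OF nonneg[OF s0]])
      have "ennreal (I + a * s) = ennreal (- ln (f s))"
        using main[OF s] nn_integral_eq_integral[OF int[OF s] nonneg[OF s0]] I0 a s by (simp add: I_def)
      then have "I + a * s = - ln (f s)" using I0 a s lnle[OF s] by (subst (asm) ennreal_inj) auto
      then have "ln (f s) = - a * s - I" by simp
      then show ?thesis using exp_ln[OF fpos[OF s]] by (simp add: I_def)
    qed (use f0 in simp)
  qed
qed

text \<open>The n-th root of the transform has drift a / n and Thorin measure \<mu> / n, so by
  \<open>laplace_fn_thorin\<close> it is the transform of a law K. The sum of n independent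
  coordinates with law K has the transform of X, and transforms determine laws.\<close>

lemma (in prob_space) infinitely_divisible_rvI:
  assumes X: "random_variable borel X" and Xpos: "AE x in M. 0 \<le> X x"
    and a: "a \<ge> 0" and s\<mu>: "sets \<mu> = sets (restrict_space borel {0<..})"
    and int: "\<And>s. s \<ge> 0 \<Longrightarrow> integrable \<mu> (\<lambda>u. ln (1 + s / u))"
    and rep: "\<And>s. s \<ge> 0 \<Longrightarrow> expectation (\<lambda>x. exp (- s * X x)) = exp (- a * s - (\<integral>u. ln (1 + s / u) \<partial>\<mu>))"
  shows "infinitely_divisible_rv M X"
  unfolding infinitely_divisible_rv_def nonneg_rv_def
proof (intro conjI allI impI X Xpos)
  fix n :: nat assume n: "1 \<le> n"
  have sp: "space \<mu> = {0<..}" using sets_eq_imp_space_eq[OF s\<mu>] by (simp add: space_restrict_space)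
  have m1: "(\<lambda>u. 1 / u) \<in> borel_measurable \<mu>" for s :: real
    unfolding measurable_cong_sets[OF s\<mu> refl] by (intro measurable_restrict_space1) measurable
  define g where "g s = exp (- (a / n) * s) * exp (- (\<integral>u. ln (1 + s * (1 / u)) \<partial>density \<mu> (\<lambda>_. ennreal (1 / n))))" for s
  have intn: "integrable (density \<mu> (\<lambda>_. ennreal (1 / n))) (\<lambda>u. ln (1 + s * (1 / u)))" if "s \<ge> 0" for s
    using int[OF that] m1 by (subst integrable_density) (auto simp: borel_measurable_integrable)
  have g: "laplace_fn g"
    unfolding g_def
    by (intro laplace_fn_mult laplace_fn_exp laplace_fn_thorin intn) (use a m1 sp in auto)
  have gn: "g s ^ n = expectation (\<lambda>x. exp (- s * X x))" if s: "s \<ge> 0" for s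
  proof -
    have "(\<integral>u. ln (1 + s * (1 / u)) \<partial>density \<mu> (\<lambda>_. ennreal (1 / n))) = 1 / n * (\<integral>u. ln (1 + s / u) \<partial>\<mu>)"
      using int[OF s] by (subst integral_density) (auto simp: borel_measurable_integrable)
    then have "g s = exp ((- a * s - (\<integral>u. ln (1 + s / u) \<partial>\<mu>)) / n)"
      by (simp add: g_def exp_add[symmetric] diff_divide_distrib)
    then show ?thesis using n rep[OF s] by (simp add: exp_of_nat_mult[symmetric])
  qed
  have g0: "g 0 = 1" by (simp add: g_def)
  obtain K where K: "real_distribution K" "AE l in K. 0 \<le> l" "\<And>s. s \<ge> 0 \<Longrightarrow> g s = (\<integral>l. exp (- s * l) \<partial>K)"
    using laplace_fn_distribution[OF g] g0 by auto
  interpret K: real_distribution K by (rule K)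
  define P where "P = PiM {1..n} (\<lambda>_. K)"
  define Y where "Y i \<omega> = \<omega> i" for i :: nat and \<omega> :: "nat \<Rightarrow> real"
  interpret PP: product_prob_space "\<lambda>_. K" "{1..n}" ..
  interpret P: prob_space P unfolding P_def by (rule prob_space_PiM) (rule K.prob_space_axioms)
  have Ym[measurable]: "Y i \<in> borel_measurable P" if "i \<in> {1..n}" for i
    using that measurable_component_singleton[of i "{1..n}" "\<lambda>_. K"] unfolding P_def Y_def[abs_def]
    by (simp add: measurable_cong_sets[OF refl K.events_eq_borel])
  have Yd: "distr P borel (Y i) = K" if "i \<in> {1..n}" for i
  proof -
    have "distr P borel (Y i) = distr P K (Y i)" by (intro distr_cong) auto
    also have "\<dots> = K" unfolding P_def Y_def[abs_def] by (rule distr_PiM_component) (use that K.prob_space_axioms in auto)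
    finally show ?thesis .
  qed
  have indep: "P.indep_vars (\<lambda>_. borel) Y {1..n}"
  proof (subst P.indep_vars_iff_distr_eq_PiM')
    have s1: "sets (Pi\<^sub>M {1..n} (\<lambda>_. borel)) = sets P" unfolding P_def by (intro sets_PiM_cong) auto
    have "distr P (Pi\<^sub>M {1..n} (\<lambda>_. borel)) (\<lambda>x. \<lambda>i\<in>{1..n}. Y i x) = distr P P (\<lambda>x. x)"
    proof (rule distr_cong)
      fix x assume "x \<in> space P"
      then show "(\<lambda>i\<in>{1..n}. Y i x) = x" by (auto simp: P_def space_PiM Y_def PiE_restrict)
    qed (use s1 in auto)
    also have "\<dots> = P" by (rule distr_id)
    also have "P = Pi\<^sub>M {1..n} (\<lambda>i. distr P borel (Y i))" unfolding P_def
      by (intro PiM_cong refl) (metis Yd P_def)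
    finally show "distr P (Pi\<^sub>M {1..n} (\<lambda>_. borel)) (\<lambda>x. \<lambda>i\<in>{1..n}. Y i x) = Pi\<^sub>M {1..n} (\<lambda>i. distr P borel (Y i))" .
  qed (use n in auto)
  have sum_rv: "(\<lambda>\<omega>. \<Sum>i=1..n. Y i \<omega>) \<in> borel_measurable P" by (intro borel_measurable_sum Ym)
  have "distr M borel X = distr P borel (\<lambda>\<omega>. \<Sum>i=1..n. Y i \<omega>)"
  proof (rule laplace_transform_unique)
    show "real_distribution (distr M borel X)" by (rule real_distribution_distr[OF X])
    show "real_distribution (distr P borel (\<lambda>\<omega>. \<Sum>i=1..n. Y i \<omega>))" by (rule P.real_distribution_distr[OF sum_rv])
    show "AE l in distr M borel X. 0 \<le> l" using Xpos X by (subst AE_distr_iff) auto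
    have "AE \<omega> in P. \<forall>i\<in>{1..n}. 0 \<le> Y i \<omega>"
    proof (rule AE_finite_allI)
      fix i assume i: "i \<in> {1..n}"
      have "AE l in distr P borel (Y i). 0 \<le> l" using K(2) unfolding Yd[OF i] .
      then show "AE \<omega> in P. 0 \<le> Y i \<omega>" using Ym[OF i] by (subst (asm) AE_distr_iff) auto
    qed simp
    then show "AE l in distr P borel (\<lambda>\<omega>. \<Sum>i=1..n. Y i \<omega>). 0 \<le> l"
      using sum_rv by (subst AE_distr_iff) (auto elim!: eventually_mono intro!: sum_nonneg)
    fix s :: real assume s: "s > 0"
    have "(\<integral>l. exp (- s * l) \<partial>distr P borel (\<lambda>\<omega>. \<Sum>i=1..n. Y i \<omega>)) = (\<integral>\<omega>. exp (- s * (\<Sum>i=1..n. Y i \<omega>)) \<partial>P)"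
      by (rule integral_distr[OF sum_rv]) measurable
    also have "\<dots> = (\<integral>\<omega>. (\<Prod>i=1..n. exp (- s * \<omega> i)) \<partial>Pi\<^sub>M {1..n} (\<lambda>_. K))"
      unfolding P_def Y_def by (simp add: sum_distrib_left exp_sum sum_negf[symmetric])
    also have "\<dots> = (\<Prod>i=1..n. \<integral>l. exp (- s * l) \<partial>K)"
    proof (rule PP.product_integral_prod)
      show "integrable K (\<lambda>l. exp (- s * l))"
        by (rule K.integrable_const_bound[where B = 1]) (use s K(2) in \<open>auto elim!: eventually_mono\<close>)
    qed simp
    also have "\<dots> = expectation (\<lambda>x. exp (- s * X x))"
      using K(3)[of s] gn[of s] s by simp
    also have "\<dots> = (\<integral>l. exp (- s * l) \<partial>distr M borel X)"
      by (rule integral_distr[OF X, symmetric]) measurable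
    finally show "(\<integral>l. exp (- s * l) \<partial>distr M borel X) = (\<integral>l. exp (- s * l) \<partial>distr P borel (\<lambda>\<omega>. \<Sum>i=1..n. Y i \<omega>))" ..
  qed
  then show "\<exists>(P :: (nat \<Rightarrow> real) measure) Y. prob_space P \<and> prob_space.indep_vars P (\<lambda>_. borel) Y {1..n} \<and>
      (\<forall>i\<in>{1..n}. \<forall>j\<in>{1..n}. distr P borel (Y i) = distr P borel (Y j)) \<and>
      distr M borel X = distr P borel (\<lambda>\<omega>. \<Sum>i=1..n. Y i \<omega>)"
    using P.prob_space_axioms indep Yd by (intro exI[of _ P] exI[of _ Y]) auto
qed

text \<open>Both halves of the finiteness condition follow from integrability at s = 1: the modulus
  of ln u is at most ln (1 + 1 / u) for 0 < u \<le> 1, and 1 / u \<le> 2 / (u + 1) \<le> 2 ln (1 + 1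
  / u) for u > 1.\<close>

lemma (in prob_space) GGC_rvI:
  assumes X: "random_variable borel X" and Xpos: "AE x in M. 0 \<le> X x"
    and a: "a \<ge> 0" and s\<mu>: "sets \<mu> = sets (restrict_space borel {0<..})"
    and int: "\<And>s. s \<ge> 0 \<Longrightarrow> integrable \<mu> (\<lambda>u. ln (1 + s / u))"
    and rep: "\<And>s. s \<ge> 0 \<Longrightarrow> expectation (\<lambda>x. exp (- s * X x)) = exp (- a * s - (\<integral>u. ln (1 + s / u) \<partial>\<mu>))"
  shows "GGC_rv M X"
proof -
  have sp: "space \<mu> = {0<..}" using sets_eq_imp_space_eq[OF s\<mu>] by (simp add: space_restrict_space)
  have m: "(\<lambda>u. ennreal (ln (1 + 1 / u))) \<in> borel_measurable \<mu>"
    using borel_measurable_integrable[OF int[of 1]] by simp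
  have I: "(\<integral>\<^sup>+ u. ennreal (ln (1 + 1 / u)) \<partial>\<mu>) < \<infinity>"
  proof -
    have "AE u in \<mu>. 0 \<le> ln (1 + 1 / u)" by (rule AE_I2) (use sp in auto)
    from nn_integral_eq_integral[OF int[OF zero_le_one] this] show ?thesis by simp
  qed
  have "(\<integral>\<^sup>+ u \<in> {0<..1}. ennreal \<bar>ln u\<bar> \<partial>\<mu>) \<le> (\<integral>\<^sup>+ u. ennreal (ln (1 + 1 / u)) \<partial>\<mu>)"
  proof (rule nn_integral_mono)
    fix u assume "u \<in> space \<mu>"
    then have u: "u > 0" using sp by simp
    show "ennreal \<bar>ln u\<bar> * indicator {0<..1} u \<le> ennreal (ln (1 + 1 / u))"
    proof (cases "u \<le> 1")
      case True
      have "\<bar>ln u\<bar> = ln (1 / u)" using u True by (simp add: ln_div)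
      also have "\<dots> \<le> ln (1 + 1 / u)" using u by (subst ln_le_cancel_iff) (auto intro: add_pos_pos)
      finally show ?thesis using u True by (simp add: ennreal_leI)
    qed simp
  qed
  moreover have "(\<integral>\<^sup>+ u \<in> {1<..}. ennreal (inverse u) \<partial>\<mu>) \<le> (\<integral>\<^sup>+ u. 2 * ennreal (ln (1 + 1 / u)) \<partial>\<mu>)"
  proof (rule nn_integral_mono)
    fix u assume "u \<in> space \<mu>"
    then have u: "u > 0" using sp by simp
    show "ennreal (inverse u) * indicator {1<..} u \<le> 2 * ennreal (ln (1 + 1 / u))"
    proof (cases "u > 1")
      case True
      have "1 + 1 / u > 0" using u by (simp add: add_pos_pos)
      then have lnd: "ln (1 / (1 + 1 / u)) = - ln (1 + 1 / u)" by (subst ln_div) auto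
      have "ln (1 / (1 + 1 / u)) \<le> 1 / (1 + 1 / u) - 1" by (rule ln_le_minus_one) (use u in \<open>simp add: add_pos_pos\<close>)
      also have "1 / (1 + 1 / u) - 1 = - (1 / (u + 1))" using u by (simp add: field_simps)
      finally have "1 / (u + 1) \<le> ln (1 + 1 / u)" unfolding lnd by simp
      moreover have "inverse u \<le> 2 * (1 / (u + 1))" using True by (simp add: field_simps)
      ultimately have "inverse u \<le> 2 * ln (1 + 1 / u)" by linarith
      then have "ennreal (inverse u) \<le> ennreal (2 * ln (1 + 1 / u))" by (rule ennreal_leI)
      then show ?thesis using True by (simp add: ennreal_mult')
    qed simp
  qed
  moreover have "(\<integral>\<^sup>+ u. 2 * ennreal (ln (1 + 1 / u)) \<partial>\<mu>) < \<infinity>"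
    using I m by (simp add: nn_integral_cmult ennreal_mult_less_top)
  ultimately have "(\<integral>\<^sup>+ u \<in> {0<..1}. ennreal \<bar>ln u\<bar> \<partial>\<mu>) + (\<integral>\<^sup>+ u \<in> {1<..}. ennreal (inverse u) \<partial>\<mu>) < \<infinity>"
    using I by (auto simp: less_top intro: le_less_trans)
  then show ?thesis
    unfolding GGC_rv_def nonneg_rv_def using X Xpos a s\<mu> int rep by blast
qed

section \<open>Products of independent random variables\<close>

text \<open>In y = x powr r and g = a / r > 0 the expression is y powr g times exp (- c y), whose
  maximum, at y = g / c, is the witness \<open>?B\<close>. The bound makes the convolution in
  \<open>haar_density_product\<close> finite everywhere.\<close>

lemma powr_exp_bounded:
  assumes q: "a / r > 0" and c: "c > (0::real)"
  obtains B where "B > 0" "\<And>x. x > 0 \<Longrightarrow> x powr a * exp (- c * x powr r) \<le> B"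
proof -
  define g where "g = a / r"
  have g: "g > 0" using q by (simp add: g_def)
  have r: "r \<noteq> 0" using q by auto
  let ?B = "exp (- g - g * ln (c / g))"
  have "x powr a * exp (- c * x powr r) \<le> ?B" if x: "x > 0" for x
  proof -
    define y where "y = x powr r"
    have y: "y > 0" using x by (simp add: y_def)
    have "ln (c / g * y) \<le> c / g * y - 1" by (rule ln_le_minus_one) (use c y g in simp)
    also have "ln (c / g * y) = ln (c / g) + ln y"
      by (rule ln_mult_pos) (use c y g in simp_all)
    finally have "g * (ln (c / g) + ln y) \<le> g * (c / g * y - 1)" using g by (intro mult_left_mono) auto
    also have "g * (c / g * y - 1) = c * y - g" using g by (simp add: field_simps)
    finally have "g * ln y - c * y \<le> - g - g * ln (c / g)" by (simp add: distrib_left)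
    then have "exp (g * ln y - c * y) \<le> ?B" by simp
    also have "exp (g * ln y - c * y) = x powr a * exp (- c * x powr r)"
    proof -
      have "g * ln y = a * ln x" using x r by (simp add: g_def y_def ln_powr)
      then show ?thesis using x by (simp add: powr_def exp_diff exp_minus y_def field_simps)
    qed
    finally show ?thesis .
  qed
  then show ?thesis by (intro that[of ?B]) auto
qed

text \<open>Laws are handled through integrals against dx/x, the form in which products of variables
  become convolutions; the factor x is the change of reference measure.\<close>

lemma has_density_on_pos_haar:
  assumes d: "has_density_on_pos M X f" and [measurable]: "g \<in> borel_measurable borel"
  shows "(\<integral>\<^sup>+ \<omega>. g (X \<omega>) \<partial>M) = (\<integral>\<^sup>+ x. g x * ennreal (x * f x) \<partial>haar)"
proof -
  have D: "distributed M lborel X (\<lambda>x. ennreal (f x) * indicator {0<..} x)" and f0: "\<And>x. x > 0 \<Longrightarrow> 0 \<le> f x"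
    using d by (auto simp: has_density_on_pos_def)
  have [measurable]: "(\<lambda>x. ennreal (f x) * indicator {0<..} x) \<in> borel_measurable borel"
    using distributed_borel_measurable[OF D] by simp
  have "(\<integral>\<^sup>+ \<omega>. g (X \<omega>) \<partial>M) = (\<integral>\<^sup>+ x. ennreal (f x) * indicator {0<..} x * g x \<partial>lborel)"
    using distributed_nn_integral[OF D, of g] by simp
  also have "\<dots> = (\<integral>\<^sup>+ x. ennreal (indicator {0<..} x / x) * (g x * (ennreal x * (ennreal (f x) * indicator {0<..} x))) \<partial>lborel)"
  proof (intro nn_integral_cong)
    fix x :: real
    show "ennreal (f x) * indicator {0<..} x * g x = ennreal (indicator {0<..} x / x) * (g x * (ennreal x * (ennreal (f x) * indicator {0<..} x)))"
    proof (cases "x > 0")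
      case True
      have "ennreal (1 / x) * ennreal x = 1" using True by (simp add: ennreal_mult[symmetric])
      then have "ennreal (1 / x) * (g x * (ennreal x * ennreal (f x))) = g x * ennreal (f x)"
        by (metis (no_types, opaque_lifting) mult.assoc mult.commute mult.right_neutral)
      then show ?thesis using True by (simp add: mult.commute)
    qed simp
  qed
  also have "\<dots> = (\<integral>\<^sup>+ x. g x * (ennreal x * (ennreal (f x) * indicator {0<..} x)) \<partial>haar)"
    by (rule nn_integral_haar[symmetric]) measurable
  also have "\<dots> = (\<integral>\<^sup>+ x. g x * ennreal (x * f x) \<partial>haar)"
    by (rule nn_integral_haar_cong) (use f0 in \<open>simp add: ennreal_mult\<close>)
  finally show ?thesis .
qed

lemma (in prob_space) haar_density_imp_has_density_on_pos:
  assumes X: "random_variable borel X" and [measurable]: "h \<in> borel_measurable borel"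
    and h0: "\<And>x. x > 0 \<Longrightarrow> 0 \<le> h x"
    and eq: "\<And>g. g \<in> borel_measurable borel \<Longrightarrow> (\<integral>\<^sup>+ \<omega>. g (X \<omega>) \<partial>M) = (\<integral>\<^sup>+ x. g x * ennreal (h x) \<partial>haar)"
  shows "has_density_on_pos M X (\<lambda>x. h x / x)"
  unfolding has_density_on_pos_def distributed_def
proof (intro conjI allI impI)
  show "distr M lborel X = density lborel (\<lambda>x. ennreal (h x / x) * indicator {0<..} x)"
  proof (rule measure_eqI)
    fix A assume "A \<in> sets (distr M lborel X)"
    then have A[measurable]: "A \<in> sets borel" by simp
    have "emeasure (distr M lborel X) A = (\<integral>\<^sup>+ x. indicator A x \<partial>distr M lborel X)" by simp
    also have "\<dots> = (\<integral>\<^sup>+ \<omega>. indicator A (X \<omega>) \<partial>M)"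
      by (rule nn_integral_distr) (use X in auto)
    also have "\<dots> = (\<integral>\<^sup>+ x. indicator A x * ennreal (h x) \<partial>haar)" by (rule eq) simp
    also have "\<dots> = (\<integral>\<^sup>+ x. ennreal (indicator {0<..} x / x) * (indicator A x * ennreal (h x)) \<partial>lborel)"
      by (rule nn_integral_haar) measurable
    also have "\<dots> = (\<integral>\<^sup>+ x. ennreal (h x / x) * indicator {0<..} x * indicator A x \<partial>lborel)"
      using h0 by (intro nn_integral_cong) (auto simp: indicator_def ennreal_mult[symmetric])
    also have "\<dots> = emeasure (density lborel (\<lambda>x. ennreal (h x / x) * indicator {0<..} x)) A"
      by (rule emeasure_density[symmetric]) auto
    finally show "emeasure (distr M lborel X) A = \<dots>" .
  qed simp
qed (use h0 X in auto)

text \<open>The density k of the product with respect to dx/x is the multiplicative convolution,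
  with integrand f (x / y) h y. As \<open>hcm_conv\<close> is phrased with f (x y), it is applied to
  y -> h (1 / y). Boundedness of f makes k finite at every x > 0, not only almost
  everywhere.\<close>

lemma (in prob_space) haar_density_product:
  assumes ind: "indep_var borel X borel Y"
    and f: "hcm f" "f \<in> borel_measurable borel" "\<And>x. x > 0 \<Longrightarrow> f x \<le> B" and B: "B > 0"
    and X: "\<And>g. g \<in> borel_measurable borel \<Longrightarrow> (\<integral>\<^sup>+ \<omega>. g (X \<omega>) \<partial>M) = (\<integral>\<^sup>+ x. g x * ennreal (f x) \<partial>haar)"
    and h: "hcm h" "h \<in> borel_measurable borel"
    and Y: "\<And>g. g \<in> borel_measurable borel \<Longrightarrow> (\<integral>\<^sup>+ \<omega>. g (Y \<omega>) \<partial>M) = (\<integral>\<^sup>+ x. g x * ennreal (h x) \<partial>haar)"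
  shows "\<exists>k. hcm k \<and> k \<in> borel_measurable borel \<and>
    (\<forall>g\<in>borel_measurable borel. (\<integral>\<^sup>+ \<omega>. g (X \<omega> * Y \<omega>) \<partial>M) = (\<integral>\<^sup>+ x. g x * ennreal (k x) \<partial>haar))"
proof -
  note [measurable] = f(2) h(2)
  interpret hh: pair_sigma_finite haar haar ..
  have f0: "0 \<le> f x" and h0: "0 \<le> h x" if "x > 0" for x using f(1) h(1) that by (auto simp: hcm_def)
  have X_rv[measurable]: "random_variable borel X" and Y_rv[measurable]: "random_variable borel Y"
    using indep_var_rv1[OF ind] indep_var_rv2[OF ind] by auto
  define I where "I x = (\<integral>\<^sup>+ y. ennreal (f (x * (1 / y)) * h y) \<partial>haar)" for x
  have [measurable]: "I \<in> borel_measurable borel" unfolding I_def by measurable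
  have hint: "(\<integral>\<^sup>+ y. ennreal (h y) \<partial>haar) = 1"
    using Y[of "\<lambda>_. 1"] by (simp add: emeasure_space_1)
  have Ifin: "I x < \<infinity>" if x: "x > 0" for x
  proof -
    have "I x \<le> (\<integral>\<^sup>+ y. ennreal B * ennreal (h y) \<partial>haar)"
      unfolding I_def
    proof (rule nn_integral_mono_AE, rule eventually_mono[OF AE_haar])
      fix y :: real assume y: "y > 0"
      have "f (x * (1 / y)) * h y \<le> B * h y" using f(3)[of "x * (1 / y)"] h0[OF y] x y by (intro mult_right_mono) auto
      then show "ennreal (f (x * (1 / y)) * h y) \<le> ennreal B * ennreal (h y)"
        using B h0[OF y] by (simp add: ennreal_mult[symmetric] ennreal_leI)
    qed
    also have "\<dots> = ennreal B" by (simp add: nn_integral_cmult hint)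
    finally show ?thesis by (simp add: le_less_trans)
  qed
  define k where "k x = enn2real (I x)" for x
  have kI: "ennreal (k x) = I x" if "x > 0" for x using Ifin[OF that] by (simp add: k_def)
  have km[measurable]: "k \<in> borel_measurable borel" unfolding k_def by measurable
  have "hcm k"
  proof (rule hcm_conv[OF f(1) hcm_inverse[OF h(1)]])
    fix x :: real assume x: "x > 0"
    have "ennreal (k x) = (\<integral>\<^sup>+ y. ennreal (f (x * (1 / y)) * h y) \<partial>haar)" unfolding kI[OF x] I_def ..
    also have "\<dots> = (\<integral>\<^sup>+ y. ennreal (f (x * (1 / (1 / y))) * h (1 / y)) \<partial>haar)"
      by (rule nn_integral_haar_inverse[symmetric]) measurable
    finally show "ennreal (k x) = (\<integral>\<^sup>+ y. ennreal (f (x * y) * h (1 / y)) \<partial>haar)" by simp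
  qed (auto simp: k_def)
  moreover have "(\<integral>\<^sup>+ \<omega>. g (X \<omega> * Y \<omega>) \<partial>M) = (\<integral>\<^sup>+ x. g x * ennreal (k x) \<partial>haar)" if g[measurable]: "g \<in> borel_measurable borel" for g
  proof -
    interpret dX: prob_space "distr M borel X" by (rule prob_space_distr) simp
    interpret dY: prob_space "distr M borel Y" by (rule prob_space_distr) simp
    interpret dd: pair_sigma_finite "distr M borel X" "distr M borel Y" ..
    have "(\<integral>\<^sup>+ \<omega>. g (X \<omega> * Y \<omega>) \<partial>M) = (\<integral>\<^sup>+ z. g (fst z * snd z) \<partial>distr M (borel \<Otimes>\<^sub>M borel) (\<lambda>\<omega>. (X \<omega>, Y \<omega>)))"
      by (subst nn_integral_distr) auto
    also have "distr M (borel \<Otimes>\<^sub>M borel) (\<lambda>\<omega>. (X \<omega>, Y \<omega>)) = distr M borel X \<Otimes>\<^sub>M distr M borel Y"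
      using ind by (simp add: indep_var_distribution_eq)
    also have "(\<integral>\<^sup>+ z. g (fst z * snd z) \<partial>(distr M borel X \<Otimes>\<^sub>M distr M borel Y)) =
       (\<integral>\<^sup>+ y. \<integral>\<^sup>+ x. g (x * y) \<partial>distr M borel X \<partial>distr M borel Y)"
      by (subst dd.nn_integral_snd[symmetric]) (auto simp: split_beta')
    also have "\<dots> = (\<integral>\<^sup>+ y. \<integral>\<^sup>+ x. g (x * y) * ennreal (f x) \<partial>haar \<partial>distr M borel Y)"
    proof (intro nn_integral_cong)
      fix y
      have "(\<integral>\<^sup>+ x. g (x * y) \<partial>distr M borel X) = (\<integral>\<^sup>+ \<omega>. g (X \<omega> * y) \<partial>M)"
        by (rule nn_integral_distr) measurable
      also have "\<dots> = (\<integral>\<^sup>+ x. g (x * y) * ennreal (f x) \<partial>haar)" by (rule X) measurable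
      finally show "(\<integral>\<^sup>+ x. g (x * y) \<partial>distr M borel X) = \<dots>" .
    qed
    also have "\<dots> = (\<integral>\<^sup>+ y. (\<integral>\<^sup>+ x. g (x * y) * ennreal (f x) \<partial>haar) * ennreal (h y) \<partial>haar)"
      by (subst nn_integral_distr, simp, measurable, rule Y, measurable)
    also have "\<dots> = (\<integral>\<^sup>+ y. \<integral>\<^sup>+ z. g z * ennreal (f (z * (1 / y)) * h y) \<partial>haar \<partial>haar)"
    proof (rule nn_integral_haar_cong)
      fix y :: real assume y: "y > 0"
      have "(\<integral>\<^sup>+ x. g (x * y) * ennreal (f x) \<partial>haar) = (\<integral>\<^sup>+ z. g (1 / y * z * y) * ennreal (f (1 / y * z)) \<partial>haar)"
        by (rule nn_integral_haar_scale[symmetric, of "\<lambda>x. g (x * y) * ennreal (f x)"]) (use y in auto)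
      also have "\<dots> = (\<integral>\<^sup>+ z. g z * ennreal (f (z * (1 / y))) \<partial>haar)"
        using y by (intro nn_integral_cong) simp
      finally have "(\<integral>\<^sup>+ x. g (x * y) * ennreal (f x) \<partial>haar) * ennreal (h y) = (\<integral>\<^sup>+ z. g z * ennreal (f (z * (1 / y))) * ennreal (h y) \<partial>haar)"
        by (simp add: nn_integral_multc)
      also have "\<dots> = (\<integral>\<^sup>+ z. g z * ennreal (f (z * (1 / y)) * h y) \<partial>haar)"
        by (rule nn_integral_haar_cong) (use y f0 h0 in \<open>simp add: ennreal_mult mult.assoc\<close>)
      finally show "(\<integral>\<^sup>+ x. g (x * y) * ennreal (f x) \<partial>haar) * ennreal (h y) = \<dots>" .
    qed
    also have "\<dots> = (\<integral>\<^sup>+ z. \<integral>\<^sup>+ y. g z * ennreal (f (z * (1 / y)) * h y) \<partial>haar \<partial>haar)"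
      by (rule hh.Fubini') measurable
    also have "\<dots> = (\<integral>\<^sup>+ z. g z * ennreal (k z) \<partial>haar)"
      by (rule nn_integral_haar_cong) (simp add: nn_integral_cmult kI I_def)
    finally show ?thesis .
  qed
  ultimately show ?thesis using km by blast
qed

text \<open>The Laplace transform of \<open>X\<close> is the multiplicative convolution of its density with \<open>e\<^sup>-\<^sup>x\<close>,
  hence hyperbolically completely monotone itself; it extends to the slit plane because of the
  generalized gamma factor.\<close>

lemma (in prob_space) hcm_product_GGC:
  assumes ind: "indep_var borel X borel Y" and Ypos: "AE \<omega> in M. Y \<omega> > 0"
    and r: "0 < \<bar>r\<bar>" "\<bar>r\<bar> \<le> 1" and c: "c > 0" and c1: "c1 > 0"
    and X: "\<And>g. g \<in> borel_measurable borel \<Longrightarrow>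
      (\<integral>\<^sup>+ \<omega>. g (X \<omega>) \<partial>M) = (\<integral>\<^sup>+ x. g x * ennreal (c1 * x powr a * exp (- c * x powr r)) \<partial>haar)"
    and h: "hcm h" "h \<in> borel_measurable borel"
    and XY: "\<And>g. g \<in> borel_measurable borel \<Longrightarrow> (\<integral>\<^sup>+ \<omega>. g (X \<omega> * Y \<omega>) \<partial>M) = (\<integral>\<^sup>+ x. g x * ennreal (h x) \<partial>haar)"
  shows "GGC_rv M (\<lambda>\<omega>. X \<omega> * Y \<omega>) \<and> infinitely_divisible_rv M (\<lambda>\<omega>. X \<omega> * Y \<omega>)"
proof -
  have X_rv[measurable]: "random_variable borel X" and Y_rv[measurable]: "random_variable borel Y"
    using indep_var_rv1[OF ind] indep_var_rv2[OF ind] by auto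
  have h0: "0 \<le> h x" if "x > 0" for x using h(1) that by (auto simp: hcm_def)
  have Z_rv: "random_variable borel (\<lambda>\<omega>. X \<omega> * Y \<omega>)" by measurable
  have Zpos: "AE \<omega> in M. 0 < X \<omega> * Y \<omega>"
  proof -
    have "(\<integral>\<^sup>+ \<omega>. indicator {..0} (X \<omega> * Y \<omega>) \<partial>M) = (\<integral>\<^sup>+ x. indicator {..0} x * ennreal (h x) \<partial>haar)"
      by (rule XY) simp
    also have "\<dots> = (\<integral>\<^sup>+ x. 0 \<partial>haar)" by (rule nn_integral_haar_cong) (simp add: indicator_def)
    also have "\<dots> = 0" by simp
    finally have "AE \<omega> in M. indicator {..0} (X \<omega> * Y \<omega>) = (0 :: ennreal)"
      by (subst (asm) nn_integral_0_iff_AE) auto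
    then show ?thesis by (rule eventually_mono) (auto simp: indicator_def not_le split: if_splits)
  qed
  then have Znn: "AE \<omega> in M. 0 \<le> X \<omega> * Y \<omega>" by (rule eventually_mono) simp
  define f where "f s = expectation (\<lambda>\<omega>. exp (- s * (X \<omega> * Y \<omega>)))" for s
  have int: "integrable M (\<lambda>\<omega>. exp (- s * (X \<omega> * Y \<omega>)))" if "s \<ge> 0" for s
    by (rule integrable_const_bound[where B = 1]) (use that Znn in \<open>auto elim!: eventually_mono\<close>)
  have nnf: "ennreal (f s) = (\<integral>\<^sup>+ \<omega>. ennreal (exp (- s * (X \<omega> * Y \<omega>))) \<partial>M)" if "s \<ge> 0" for s
    unfolding f_def by (rule nn_integral_eq_integral[symmetric, OF int[OF that]]) simp
  have f_nonneg: "0 \<le> f s" for s unfolding f_def by (rule integral_nonneg_AE) simp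
  have lf: "laplace_fn f"
    by (rule laplace_fnI[OF Z_rv Znn f_nonneg nnf])
  have f0: "f 0 = 1" by (simp add: f_def prob_space)
  have fpos: "f s > 0" if "s > 0" for s
  proof -
    have "f s \<noteq> 0"
    proof
      assume "f s = 0"
      then have "AE \<omega> in M. exp (- s * (X \<omega> * Y \<omega>)) = 0"
        using int[of s] that unfolding f_def by (subst (asm) integral_nonneg_eq_0_iff_AE) auto
      then have "AE \<omega> in M. False" by (rule eventually_mono) simp
      then show False by simp
    qed
    then show ?thesis using f_nonneg[of s] by simp
  qed
  have hcmf: "hcm f"
  proof (rule hcm_conv[OF _ h(1) _ h(2)])
    \<comment> \<open>The kernel exp (- x) of the Laplace transform is the case r = 1 of the
      generalized gamma factor.\<close>
    show "hcm (\<lambda>x. exp (- 1 * x powr 1))" by (rule hcm_exp_powr) auto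
    fix x :: real assume x: "x > 0"
    have "ennreal (f x) = (\<integral>\<^sup>+ z. ennreal (exp (- x * z)) * ennreal (h z) \<partial>haar)"
      unfolding nnf[OF less_imp_le[OF x]] by (rule XY) measurable
    also have "\<dots> = (\<integral>\<^sup>+ y. ennreal (exp (- 1 * (x * y) powr 1) * h y) \<partial>haar)"
      by (rule nn_integral_haar_cong) (use x h0 in \<open>auto simp: ennreal_mult\<close>)
    finally show "ennreal (f x) = \<dots>" .
  qed (use f_nonneg in auto)
  let ?P = "distr M borel Y"
  have fin: "(\<integral>\<^sup>+ x. ennreal (x powr a * exp (- c * x powr r)) \<partial>haar) < \<infinity>"
  proof -
    \<comment> \<open>Integrability of the gamma factor is read off from the total mass 1 of the law
      of X.\<close>
    have "1 = (\<integral>\<^sup>+ x. ennreal (c1 * x powr a * exp (- c * x powr r)) \<partial>haar)"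
      using X[of "\<lambda>_. 1"] by (simp add: emeasure_space_1)
    also have "\<dots> = ennreal c1 * (\<integral>\<^sup>+ x. ennreal (x powr a * exp (- c * x powr r)) \<partial>haar)"
      using c1 by (subst nn_integral_cmult[symmetric]) (auto simp: ennreal_mult[symmetric] mult_ac)
    finally show ?thesis using c1 by (auto simp: less_top[symmetric] ennreal_mult_top)
  qed
  obtain \<phi> where \<phi>: "\<phi> holomorphic_on slit" "\<And>s :: real. s > 0 \<Longrightarrow> \<phi> (of_real s) = of_real (f s)"
  proof (rule laplace_slit_extension[OF _ _ _ r c c1 fin f_nonneg])
    interpret dX: prob_space "distr M borel X" by (rule prob_space_distr) simp
    show "prob_space ?P" by (rule prob_space_distr) simp
    then interpret dY: prob_space ?P .
    interpret dd: pair_sigma_finite "distr M borel X" ?P ..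
    show "AE y in ?P. y > 0" using Ypos by (subst AE_distr_iff) auto
    fix s :: real assume s: "s > 0"
    have "ennreal (f s) = (\<integral>\<^sup>+ z. ennreal (exp (- s * (fst z * snd z))) \<partial>distr M (borel \<Otimes>\<^sub>M borel) (\<lambda>\<omega>. (X \<omega>, Y \<omega>)))"
      unfolding nnf[OF less_imp_le[OF s]] by (subst nn_integral_distr) auto
    also have "distr M (borel \<Otimes>\<^sub>M borel) (\<lambda>\<omega>. (X \<omega>, Y \<omega>)) = distr M borel X \<Otimes>\<^sub>M ?P"
      using ind by (simp add: indep_var_distribution_eq)
    also have "(\<integral>\<^sup>+ z. ennreal (exp (- s * (fst z * snd z))) \<partial>(distr M borel X \<Otimes>\<^sub>M ?P)) =
       (\<integral>\<^sup>+ y. \<integral>\<^sup>+ x. ennreal (exp (- s * (x * y))) \<partial>distr M borel X \<partial>?P)"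
      by (subst dd.nn_integral_snd[symmetric]) (auto simp: split_beta')
    also have "\<dots> = (\<integral>\<^sup>+ y. \<integral>\<^sup>+ x. ennreal (exp (- s * (x * y)) * (c1 * x powr a * exp (- c * x powr r))) \<partial>haar \<partial>?P)"
    proof (intro nn_integral_cong)
      fix y
      have "(\<integral>\<^sup>+ x. ennreal (exp (- s * (x * y))) \<partial>distr M borel X) = (\<integral>\<^sup>+ \<omega>. ennreal (exp (- s * (X \<omega> * y))) \<partial>M)"
        by (rule nn_integral_distr) measurable
      also have "\<dots> = (\<integral>\<^sup>+ x. ennreal (exp (- s * (x * y))) * ennreal (c1 * x powr a * exp (- c * x powr r)) \<partial>haar)"
        by (rule X) measurable
      finally show "(\<integral>\<^sup>+ x. ennreal (exp (- s * (x * y))) \<partial>distr M borel X) =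
          (\<integral>\<^sup>+ x. ennreal (exp (- s * (x * y)) * (c1 * x powr a * exp (- c * x powr r))) \<partial>haar)"
        using c1 by (simp add: ennreal_mult)
    qed
    finally show "ennreal (f s) = \<dots>" .
  qed auto
  obtain d and \<mu> :: "real measure" where \<mu>: "d \<ge> 0" "sets \<mu> = sets (restrict_space borel {0<..})"
    "\<And>s. s \<ge> 0 \<Longrightarrow> integrable \<mu> (\<lambda>u. ln (1 + s / u))"
    "\<And>s. s \<ge> 0 \<Longrightarrow> f s = exp (- d * s - (\<integral>u. ln (1 + s / u) \<partial>\<mu>))"
    using hcm_laplace_thorin_measure[OF lf f0 fpos hcmf \<phi>] by blast
  show ?thesis
    using GGC_rvI[OF Z_rv Znn \<mu>(1,2,3) \<mu>(4)[unfolded f_def]]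
      infinitely_divisible_rvI[OF Z_rv Znn \<mu>(1,2,3) \<mu>(4)[unfolded f_def]] by blast
qed

theorem mainTheorem3:
  fixes M :: "'a measure" and X :: "nat \<Rightarrow> 'a \<Rightarrow> real" and N :: nat
    and c1 c2 \<epsilon> r :: "nat \<Rightarrow> real"
  assumes "prob_space M"
    and "N \<ge> 1"
    and "prob_space.indep_vars M (\<lambda>_. borel) X {1..N}"
    and "\<And>i. i \<in> {1..N} \<Longrightarrow> 0 < \<bar>r i\<bar> \<and> \<bar>r i\<bar> \<le> 1"
    and "\<And>i. i \<in> {1..N} \<Longrightarrow> \<epsilon> i / r i > 0"
    and "\<And>i. i \<in> {1..N} \<Longrightarrow> c2 i > 0"
    and "\<And>i. i \<in> {1..N} \<Longrightarrow> c1 i > 0"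
    and "\<And>i. i \<in> {1..N} \<Longrightarrow>
           has_density_on_pos M (X i) (gen_gamma_density (c1 i) (c2 i) (\<epsilon> i) (r i))"
  shows "HCM_rv M (\<lambda>\<omega>. \<Prod>i=1..N. X i \<omega>)
       \<and> GGC_rv M (\<lambda>\<omega>. \<Prod>i=1..N. X i \<omega>)
       \<and> infinitely_divisible_rv M (\<lambda>\<omega>. \<Prod>i=1..N. X i \<omega>)"
proof -
  interpret prob_space M by fact
  note ind = assms(3) and r = assms(4) and \<epsilon> = assms(5) and c2 = assms(6) and c1 = assms(7) and dens = assms(8)
  \<comment> \<open>The density with respect to dx/x, that is x times the given one; hence the
    exponent \<epsilon> i in place of \<epsilon> i - 1.\<close>
  define f where "f i x = c1 i * x powr \<epsilon> i * exp (- c2 i * x powr r i)" for i x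
  have f_meas[measurable]: "f i \<in> borel_measurable borel" for i unfolding f_def[abs_def] by measurable
  have f_hcm: "hcm (f i)" if "i \<in> {1..N}" for i
    unfolding f_def[abs_def] using r[OF that] c1[OF that] c2[OF that] by (intro hcm_gen_gamma_density) auto
  have Xf: "(\<integral>\<^sup>+ \<omega>. g (X i \<omega>) \<partial>M) = (\<integral>\<^sup>+ x. g x * ennreal (f i x) \<partial>haar)"
    if i: "i \<in> {1..N}" and g: "g \<in> borel_measurable borel" for i g
    unfolding has_density_on_pos_haar[OF dens[OF i] g]
    by (rule nn_integral_haar_cong) (simp add: gen_gamma_density_def f_def powr_diff)
  have X_rv: "random_variable borel (X i)" if "i \<in> {1..N}" for i
    using ind that by (simp add: indep_vars_def)
  have Xpos: "AE \<omega> in M. 0 < X i \<omega>" if i: "i \<in> {1..N}" for i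
  proof -
    have "(\<integral>\<^sup>+ \<omega>. indicator {..0} (X i \<omega>) \<partial>M) = (\<integral>\<^sup>+ x. indicator {..0} x * ennreal (f i x) \<partial>haar)"
      by (rule Xf[OF i]) simp
    also have "\<dots> = (\<integral>\<^sup>+ x. 0 \<partial>haar)" by (rule nn_integral_haar_cong) (simp add: indicator_def)
    also have "\<dots> = 0" by simp
    finally have "AE \<omega> in M. indicator {..0} (X i \<omega>) = (0 :: ennreal)"
      using X_rv[OF i] by (subst (asm) nn_integral_0_iff_AE) auto
    then show ?thesis by (rule eventually_mono) (auto simp: indicator_def not_le split: if_splits)
  qed
  have indep: "indep_var borel (X (Suc n)) borel (\<lambda>\<omega>. \<Prod>i=1..n. X i \<omega>)" if n: "Suc n \<le> N" for n
  proof (rule indep_vars_prod)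
    show "indep_vars (\<lambda>_. borel) X (insert (Suc n) {1..n})"
      by (rule indep_vars_subset[OF ind]) (use n in auto)
  qed auto
  have Suc_prod: "(\<lambda>\<omega>. X (Suc n) \<omega> * (\<Prod>i=1..n. X i \<omega>)) = (\<lambda>\<omega>. \<Prod>i=1..Suc n. X i \<omega>)" for n
    by (simp add: mult.commute)
  \<comment> \<open>The induction starts with one factor, since the empty product has no
    density.\<close>
  have main: "\<exists>h. hcm h \<and> h \<in> borel_measurable borel \<and>
      (\<forall>g\<in>borel_measurable borel. (\<integral>\<^sup>+ \<omega>. g (\<Prod>i=1..Suc n. X i \<omega>) \<partial>M) = (\<integral>\<^sup>+ x. g x * ennreal (h x) \<partial>haar))"
    if "Suc n \<le> N" for n
    using that
  proof (induction n)
    case 0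
    then show ?case using f_hcm[of 1] Xf[of 1] by (intro exI[of _ "f 1"]) auto
  next
    case (Suc n)
    then obtain h where h: "hcm h" "h \<in> borel_measurable borel"
      "\<And>g. g \<in> borel_measurable borel \<Longrightarrow> (\<integral>\<^sup>+ \<omega>. g (\<Prod>i=1..Suc n. X i \<omega>) \<partial>M) = (\<integral>\<^sup>+ x. g x * ennreal (h x) \<partial>haar)"
      by auto
    have i: "Suc (Suc n) \<in> {1..N}" using Suc.prems by simp
    obtain B where B: "B > 0" "\<And>x. x > 0 \<Longrightarrow> x powr \<epsilon> (Suc (Suc n)) * exp (- c2 (Suc (Suc n)) * x powr r (Suc (Suc n))) \<le> B"
      using powr_exp_bounded[OF \<epsilon>[OF i] c2[OF i]] by blast
    have fB: "f (Suc (Suc n)) x \<le> c1 (Suc (Suc n)) * B" if "x > 0" for x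
      using mult_left_mono[OF B(2)[OF that] less_imp_le[OF c1[OF i]]] by (simp add: f_def mult.assoc)
    have "\<exists>k. hcm k \<and> k \<in> borel_measurable borel \<and>
      (\<forall>g\<in>borel_measurable borel. (\<integral>\<^sup>+ \<omega>. g (X (Suc (Suc n)) \<omega> * (\<Prod>i=1..Suc n. X i \<omega>)) \<partial>M) = (\<integral>\<^sup>+ x. g x * ennreal (k x) \<partial>haar))"
      by (rule haar_density_product[OF indep[OF Suc.prems] f_hcm[OF i] f_meas fB _ Xf[OF i] h])
        (use B(1) c1[OF i] in auto)
    then show ?case unfolding fun_cong[OF Suc_prod[of "Suc n"]] .
  qed
  obtain n where N: "N = Suc n" using assms(2) by (cases N) auto
  obtain h where h: "hcm h" "h \<in> borel_measurable borel"
    "\<And>g. g \<in> borel_measurable borel \<Longrightarrow> (\<integral>\<^sup>+ \<omega>. g (\<Prod>i=1..N. X i \<omega>) \<partial>M) = (\<integral>\<^sup>+ x. g x * ennreal (h x) \<partial>haar)"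
    using main[of n] N by auto
  have prod_rv: "random_variable borel (\<lambda>\<omega>. \<Prod>i=1..N. X i \<omega>)"
    by (rule borel_measurable_prod) (rule X_rv)
  have "HCM_rv M (\<lambda>\<omega>. \<Prod>i=1..N. X i \<omega>)"
    unfolding HCM_rv_def
  proof (intro exI conjI)
    show "has_density_on_pos M (\<lambda>\<omega>. \<Prod>i=1..N. X i \<omega>) (\<lambda>x. h x / x)"
      by (rule haar_density_imp_has_density_on_pos[OF prod_rv h(2) _ h(3)]) (use h(1) in \<open>auto simp: hcm_def\<close>)
    \<comment> \<open>Division by x returns from dx/x to a density for dx.\<close>
    have "hcm (\<lambda>x. h x / x)"
      by (rule hcm_cong[OF hcm_powr_mult[OF h(1), of 1 "-1"]]) (auto simp: powr_minus divide_inverse)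
    then show "HCM_function (\<lambda>x. h x / x)"
      by (rule hcm_imp_HCM_function)
  qed
  \<comment> \<open>The last factor plays the gamma variable that lets the transform extend to the
    slit plane; the others form Y. For N = 1 their product is the constant 1, which is positive and
    independent of everything.\<close>
  moreover have "GGC_rv M (\<lambda>\<omega>. X (Suc n) \<omega> * (\<Prod>i=1..n. X i \<omega>)) \<and> infinitely_divisible_rv M (\<lambda>\<omega>. X (Suc n) \<omega> * (\<Prod>i=1..n. X i \<omega>))"
  proof -
    have i: "Suc n \<in> {1..N}" using N by simp
    have "AE \<omega> in M. \<forall>i\<in>{1..n}. 0 < X i \<omega>"
      by (rule AE_finite_allI) (use Xpos N in auto)
    then have pos: "AE \<omega> in M. 0 < (\<Prod>i=1..n. X i \<omega>)"
      by (rule eventually_mono) (auto intro: prod_pos)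
    have hX: "(\<integral>\<^sup>+ \<omega>. g (X (Suc n) \<omega> * (\<Prod>i=1..n. X i \<omega>)) \<partial>M) = (\<integral>\<^sup>+ x. g x * ennreal (h x) \<partial>haar)"
      if "g \<in> borel_measurable borel" for g
      using h(3)[OF that] unfolding N fun_cong[OF Suc_prod] .
    show ?thesis
      by (rule hcm_product_GGC[OF indep pos _ _ c2[OF i] c1[OF i] Xf[OF i, unfolded f_def] h(1,2) hX])
        (use r[OF i] N in auto)
  qed
  then have "GGC_rv M (\<lambda>\<omega>. \<Prod>i=1..N. X i \<omega>) \<and> infinitely_divisible_rv M (\<lambda>\<omega>. \<Prod>i=1..N. X i \<omega>)"
    unfolding Suc_prod N .
  ultimately show ?thesis by blast
qed

end
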